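(* Let $d\ge 2$, let $q$ be a prime power with $d\mid q-1$, let $\lambda\in\mathbb{F}_q^\times$, and let $D_\lambda\subset\mathbb{P}^{d-1}$ be the Dwork hypersurface $X_1^d+\cdots+X_d^d=d\lambda X_1\cdots X_d$ over $\mathbb{F}_q$. Let $\chi=\chi^w\in\widehat{G}$ be indexed by $w=(w_1,\dots,w_d)\in(\mathbb{Z}/d\mathbb{Z})^d$ with $w_1+\cdots+w_d=0$, and suppose that none of the $w_i$ is $0$. Let $r\ge1$. If $\chi\neq\mathbf{1}$, then $$N_r(D_\lambda;\chi)=(-1)^d\, j(\varphi_d^w)^r\, F_{\rm red}\big(\widetilde{\varphi}_d^{\,w_1},\dots,\widetilde{\varphi}_d^{\,w_d};\ \widetilde{\varepsilon},\widetilde{\varphi}_d,\dots,\widetilde{\varphi}_d^{\,d-1};\ \lambda^d\big)_{q^r},$$ and if $\chi=\mathbf{1}$, then $$N_r(D_\lambda;\chi)=(-1)^d\, j(\varphi_d^w)^r\, F_{\rm red}\big(\widetilde{\varphi}_d^{\,w_1},\dots,\widetilde{\varphi}_d^{\,w_d};\ \widetilde{\varepsilon},\widetilde{\varphi}_d,\dots,\widetilde{\varphi}_d^{\,d-1};\ \lambda^d\big)_{q^r}+\frac{1-q^{r(d-1)}}{1-q^r}.$$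
   Context: **Characters and hypergeometric functions.** For a finite field $k$ with $Q$ elements let $\widehat{k^\times}=\mathrm{Hom}(k^\times,\overline{\mathbb{Q}}^\times)$, with trivial character $\varepsilon$; put $\eta(0)=0$ for every $\eta\in\widehat{k^\times}$ (including $\varepsilon$), and $\delta(\eta)=1$ if $\eta=\varepsilon$, $\delta(\eta)=0$ otherwise. Fix a nontrivial additive character $\psi$ of $k$ and put $g(\eta)=-\sum_{x\in k^\times}\eta(x)\psi(x)$, $g^\circ(\eta)=Q^{\delta(\eta)}g(\eta)$, $(\alpha)_\nu=g(\alpha\nu)/g(\alpha)$, $(\alpha)_\nu^\circ=g^\circ(\alpha\nu)/g^\circ(\alpha)$. For characters $\alpha_i,\beta_i$ and $z\in k$, $$F(\alpha_1,\dots,\alpha_m;\beta_1,\dots,\beta_m;z)_Q=\frac{1}{1-Q}\sum_{\nu\in\widehat{k^\times}}\frac{(\alpha_1)_\nu\cdots(\alpha_m)_\nu}{(\beta_1)^\circ_\nu\cdots(\beta_m)^\circ_\nu}\,\nu(z)$$ (the value does not depend on $\psi$, since there are equally many upper and lower parameters). $F_{\rm red}(\alpha_1,\dots;\beta_1,\dots;z)_Q$ denotes the value of $F$ after cancelling (with multiplicity) all parameters common to the lists $(\alpha_i)$ and $(\beta_i)$, until the remaining lists are disjoint. The Jacobi sum over $\mathbb{F}_q$ is $j(\eta_1,\dots,\eta_n)=(-1)^{n-1}\sum_{x_i\in\mathbb{F}_q^\times,\ x_1+\cdots+x_n=1}\eta_1(x_1)\cdots\eta_n(x_n)$. For $\eta\in\widehat{\mathbb{F}_q^\times}$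 put $\widetilde{\eta}=\eta\circ \mathrm{N}_{\mathbb{F}_{q^r}/\mathbb{F}_q}\in\widehat{\mathbb{F}_{q^r}^\times}$. Fix a generator $\varphi$ of $\widehat{\mathbb{F}_q^\times}$ and put $\varphi_d=\varphi^{(q-1)/d}$ (a character of exact order $d$), $j(\varphi_d^w)=j(\varphi_d^{w_1},\dots,\varphi_d^{w_d})$. **Group action and point counts.** Let $\mu_d\subset\mathbb{F}_q^\times$ be the $d$th roots of unity, $\widetilde{G}=\{\xi\in\mu_d^d\mid \xi_1\cdots\xi_d=1\}$, $\Delta\subset\widetilde{G}$ the diagonal subgroup, $G=\widetilde{G}/\Delta$, acting on $D_\lambda$ by $\xi\cdot[X_1:\dots:X_d]=[\xi_1X_1:\dots:\xi_dX_d]$. For $w\in(\mathbb{Z}/d\mathbb{Z})^d$ with $\sum w_i=0$, the character $\chi^w(\xi)=\varphi(\xi_1^{w_1}\cdots\xi_d^{w_d})$ of $\widetilde G$ factors through $G$; every element of $\widehat{G}=\mathrm{Hom}(G,\overline{\mathbb{Q}}^\times)$ is of this form, and $\chi^w=\chi^{w'}$ iff $w-w'=(m,\dots,m)$ for some $m\in\mathbb{Z}/d\mathbb{Z}$. $\mathbf{1}$ is the trivial character of $G$. With $F_{\rm Frob}$ the $q$-Frobenius on $D_\lambda(\overline{\mathbb{F}_q})$, $$N_r(D_\lambda;\chi)=\frac{1}{\#G}\sum_{\xi\in G}\chi(\xi)\,\#\{X\in D_\lambda(\overline{\mathbb{F}_q})\mid \xi^{-1}F_{\rm Frob}^r(X)=X\}.$$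 *)

theory Defs
  imports
    "HOL-Algebra.Algebraic_Closure_Type"
    "HOL-Algebra.Coset"
    "HOL-Library.Cardinality"
    "HOL-Library.FuncSet"
    "HOL-Library.Multiset"
    Complex_Main
begin

text \<open>
  The base field \<open>\<bbbF>\<^sub>q\<close> is a type \<open>'a\<close> of sort \<open>{field, finite}\<close>, with \<open>q = CARD('a)\<close>, and its
  algebraic closure is \<open>'a alg_closure\<close>. The notions that are needed both over \<open>\<bbbF>\<^sub>q\<close> and over an
  extension of it are defined for a finite subfield \<open>k\<close> of a field, given as a set; for \<open>\<bbbF>\<^sub>q\<close>
  itself, \<open>k\<close> is \<open>UNIV :: 'a set\<close>. The field of algebraic numbers is the one inside the complex
  numbers. The \<open>d\<close> coordinates are indexed by \<open>0, \<dots>, d - 1\<close>.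
\<close>

section \<open>Multiplicative characters of finite fields\<close>

definition Qbar :: "complex set" where
  "Qbar = {z. algebraic z}"

definition field_units :: "'k::field set \<Rightarrow> 'k monoid" where
  "field_units k = \<lparr>carrier = k - {0}, monoid.mult = (*), one = 1\<rparr>"

text \<open>
  Characters are extended by \<open>0\<close> to \<open>0\<close> (also the trivial one) and to the elements outside \<open>k\<close>;
  the latter makes every character a unique function.
\<close>

definition mult_chars :: "'k::field set \<Rightarrow> ('k \<Rightarrow> complex) set" where
  "mult_chars k = {\<eta> \<in> hom (field_units k) (field_units Qbar). \<forall>x. x \<notin> k - {0} \<longrightarrow> \<eta> x = 0}"

definition triv_char :: "'k::field set \<Rightarrow> 'k \<Rightarrow> complex" where
  "triv_char k x = of_bool (x \<in> k - {0})"

definition char_times :: "('k \<Rightarrow> complex) \<Rightarrow> ('k \<Rightarrow> complex) \<Rightarrow> 'k \<Rightarrow> complex" where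
  "char_times \<alpha> \<beta> x = \<alpha> x * \<beta> x"

text \<open>The case distinction is there because \<open>0 powi 0 = 1\<close>, whereas \<open>\<eta>\<^sup>0 = \<epsilon>\<close> vanishes at \<open>0\<close>.\<close>

definition char_pow :: "('k \<Rightarrow> complex) \<Rightarrow> int \<Rightarrow> 'k \<Rightarrow> complex" where
  "char_pow \<eta> n x = (if \<eta> x = 0 then 0 else \<eta> x powi n)"

definition generates_mult_chars :: "'k::field set \<Rightarrow> ('k \<Rightarrow> complex) \<Rightarrow> bool" where
  "generates_mult_chars k \<phi> \<longleftrightarrow>
     \<phi> \<in> mult_chars k \<and> (\<forall>\<eta>\<in>mult_chars k. \<exists>n. \<eta> = char_pow \<phi> n)"

definition nontrivial_add_char :: "'k::field set \<Rightarrow> ('k \<Rightarrow> complex) \<Rightarrow> bool" where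
  "nontrivial_add_char k \<psi> \<longleftrightarrow>
     (\<forall>x\<in>k. \<psi> x \<in> Qbar - {0}) \<and>
     (\<forall>x\<in>k. \<forall>y\<in>k. \<psi> (x + y) = \<psi> x * \<psi> y) \<and>
     (\<exists>x\<in>k. \<psi> x \<noteq> 1)"

section \<open>Gauss sums, Jacobi sums and hypergeometric functions\<close>

definition char_delta :: "'k::field set \<Rightarrow> ('k \<Rightarrow> complex) \<Rightarrow> nat" where
  "char_delta k \<eta> = (if \<eta> = triv_char k then 1 else 0)"

definition gauss :: "'k::field set \<Rightarrow> ('k \<Rightarrow> complex) \<Rightarrow> ('k \<Rightarrow> complex) \<Rightarrow> complex" where
  "gauss k \<psi> \<eta> = - (\<Sum>x\<in>k - {0}. \<eta> x * \<psi> x)"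

definition gauss_o :: "'k::field set \<Rightarrow> ('k \<Rightarrow> complex) \<Rightarrow> ('k \<Rightarrow> complex) \<Rightarrow> complex" where
  "gauss_o k \<psi> \<eta> = of_nat (card k) ^ char_delta k \<eta> * gauss k \<psi> \<eta>"

definition poch ::
  "'k::field set \<Rightarrow> ('k \<Rightarrow> complex) \<Rightarrow> ('k \<Rightarrow> complex) \<Rightarrow> ('k \<Rightarrow> complex) \<Rightarrow> complex" where
  "poch k \<psi> \<alpha> \<nu> = gauss k \<psi> (char_times \<alpha> \<nu>) / gauss k \<psi> \<alpha>"

definition poch_o ::
  "'k::field set \<Rightarrow> ('k \<Rightarrow> complex) \<Rightarrow> ('k \<Rightarrow> complex) \<Rightarrow> ('k \<Rightarrow> complex) \<Rightarrow> complex" where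
  "poch_o k \<psi> \<alpha> \<nu> = gauss_o k \<psi> (char_times \<alpha> \<nu>) / gauss_o k \<psi> \<alpha>"

text \<open>
  The value of \<open>F\<close> does not depend on the order of the upper (lower) parameters, so each of the
  two lists of parameters is given as a multiset. Multiset difference then cancels common
  parameters with multiplicity.
\<close>

definition hyp_F ::
  "'k::field set \<Rightarrow> ('k \<Rightarrow> complex) \<Rightarrow> ('k \<Rightarrow> complex) multiset \<Rightarrow> ('k \<Rightarrow> complex) multiset \<Rightarrow> 'k \<Rightarrow> complex"
where
  "hyp_F k \<psi> A B z =
     1 / (1 - of_nat (card k)) *
     (\<Sum>\<nu>\<in>mult_chars k. (\<Prod>\<alpha>\<in>#A. poch k \<psi> \<alpha> \<nu>) / (\<Prod>\<beta>\<in>#B. poch_o k \<psi> \<beta> \<nu>) * \<nu> z)"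

definition hyp_F_red ::
  "'k::field set \<Rightarrow> ('k \<Rightarrow> complex) \<Rightarrow> ('k \<Rightarrow> complex) multiset \<Rightarrow> ('k \<Rightarrow> complex) multiset \<Rightarrow> 'k \<Rightarrow> complex"
where
  "hyp_F_red k \<psi> A B z = hyp_F k \<psi> (A - B) (B - A) z"

definition jacobi :: "nat \<Rightarrow> (nat \<Rightarrow> 'a::{field,finite} \<Rightarrow> complex) \<Rightarrow> complex" where
  "jacobi n \<eta> =
     (-1) ^ (n - 1) *
     (\<Sum>x\<in>{x \<in> {..<n} \<rightarrow>\<^sub>E (UNIV - {0}). (\<Sum>i<n. x i) = 1}. \<Prod>i<n. \<eta> i (x i))"

section \<open>The extension of degree \<open>r\<close> and the norm\<close>

definition ext_field :: "nat \<Rightarrow> 'a::{field,finite} alg_closure set" where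
  "ext_field r = {x. x ^ (CARD('a) ^ r) = x}"

text \<open>The norm is the product of the conjugates, read as an element of the base field.\<close>

definition ext_norm :: "nat \<Rightarrow> 'a::{field,finite} alg_closure \<Rightarrow> 'a" where
  "ext_norm r x = the_inv to_ac (\<Prod>i<r. x ^ (CARD('a) ^ i))"

definition char_lift ::
  "nat \<Rightarrow> ('a::{field,finite} \<Rightarrow> complex) \<Rightarrow> 'a alg_closure \<Rightarrow> complex" where
  "char_lift r \<eta> x = (if x \<in> ext_field r then \<eta> (ext_norm r x) else 0)"

section \<open>Projective space and the Dwork hypersurface\<close>

text \<open>
  A geometric point of projective space is the set of its homogeneous coordinate vectors, that is,
  a line through the origin without the origin.
\<close>

definition proj_point :: "nat \<Rightarrow> (nat \<Rightarrow> 'k::field) \<Rightarrow> (nat \<Rightarrow> 'k) set" where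
  "proj_point d v = {\<lambda>i\<in>{..<d}. c * v i | c. c \<noteq> 0}"

definition dwork :: "nat \<Rightarrow> 'a::{field,finite} \<Rightarrow> (nat \<Rightarrow> 'a alg_closure) set set" where
  "dwork d lam =
     proj_point d ` {v \<in> {..<d} \<rightarrow>\<^sub>E UNIV. (\<exists>i<d. v i \<noteq> 0) \<and>
       (\<Sum>i<d. v i ^ d) = of_nat d * to_ac lam * (\<Prod>i<d. v i)}"

definition frob ::
  "nat \<Rightarrow> (nat \<Rightarrow> 'a::{field,finite} alg_closure) set \<Rightarrow> (nat \<Rightarrow> 'a alg_closure) set" where
  "frob d P = (\<lambda>v. \<lambda>i\<in>{..<d}. v i ^ CARD('a)) ` P"

section \<open>The group \<open>G\<close>, its characters and its action\<close>

definition Gtilde :: "nat \<Rightarrow> (nat \<Rightarrow> 'a::field) monoid" where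
  "Gtilde d =
     \<lparr>carrier = {\<xi> \<in> {..<d} \<rightarrow>\<^sub>E {x. x ^ d = 1}. (\<Prod>i<d. \<xi> i) = 1},
      monoid.mult = (\<lambda>\<xi> \<zeta>. \<lambda>i\<in>{..<d}. \<xi> i * \<zeta> i),
      one = (\<lambda>i\<in>{..<d}. 1)\<rparr>"

definition Gdiag :: "nat \<Rightarrow> (nat \<Rightarrow> 'a::field) set" where
  "Gdiag d = {\<lambda>i\<in>{..<d}. c | c. c ^ d = 1}"

definition dwork_group :: "nat \<Rightarrow> (nat \<Rightarrow> 'a::field) set monoid" where
  "dwork_group d = Gtilde d Mod Gdiag d"

text \<open>
  Elements of \<open>G\<close> are cosets of the diagonal subgroup. The diagonal subgroup fixes every projective
  point, so a coset \<open>g\<close> maps \<open>P\<close> to the set of all \<open>\<xi> \<cdot> v\<close> with \<open>\<xi> \<in> g\<close> and \<open>v \<in> P\<close>.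
\<close>

definition Gact ::
  "nat \<Rightarrow> (nat \<Rightarrow> 'a::field) set \<Rightarrow> (nat \<Rightarrow> 'a alg_closure) set \<Rightarrow> (nat \<Rightarrow> 'a alg_closure) set" where
  "Gact d g P = {\<lambda>i\<in>{..<d}. to_ac (\<xi> i) * v i | \<xi> v. \<xi> \<in> g \<and> v \<in> P}"

text \<open>
  The character \<open>\<chi>\<^sup>w\<close>, as a function on cosets: its value at \<open>g\<close> is the common value at all
  representatives of \<open>g\<close>. The vector \<open>w\<close> consists of integers representing classes modulo \<open>d\<close>.
\<close>

definition Gchar ::
  "('a::field \<Rightarrow> complex) \<Rightarrow> nat \<Rightarrow> (nat \<Rightarrow> int) \<Rightarrow> (nat \<Rightarrow> 'a) set \<Rightarrow> complex" where
  "Gchar \<phi> d w =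
     (\<lambda>g\<in>carrier (dwork_group d). the_elem ((\<lambda>\<xi>. \<phi> (\<Prod>i<d. \<xi> i powi w i)) ` g))"

definition Gchar_triv :: "nat \<Rightarrow> (nat \<Rightarrow> 'a::field) set \<Rightarrow> complex" where
  "Gchar_triv d = (\<lambda>g\<in>carrier (dwork_group d). 1)"

definition dwork_count ::
  "nat \<Rightarrow> nat \<Rightarrow> 'a::{field,finite} \<Rightarrow> ((nat \<Rightarrow> 'a) set \<Rightarrow> complex) \<Rightarrow> complex" where
  "dwork_count r d lam \<chi> =
     1 / of_nat (card (carrier (dwork_group d :: (nat \<Rightarrow> 'a) set monoid))) *
     (\<Sum>g\<in>carrier (dwork_group d).
        \<chi> g * of_nat (card {P \<in> dwork d lam. Gact d (inv\<^bsub>dwork_group d\<^esub> g) ((frob d ^^ r) P) = P}))"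

end

theory Submission
  imports
    Defs
    "HOL-Computational_Algebra.Computational_Algebra"
    "HOL-Algebra.Sylow"
begin

text \<open>
  The number of points is computed over the field \<open>k\<close> with \<open>Q = q ^ r\<close> elements. A
  projective point fixed by Frobenius composed with the inverse of \<open>\<xi>\<close> has representatives
  \<open>v\<close> with \<open>v i ^ Q = \<xi> i * v i\<close>, unique up to scalars from the units of \<open>k\<close>. For a nonzero
  coordinate this equation says that \<open>u = v i ^ d\<close> is a unit of \<open>k\<close> and that \<open>\<phi> (\<xi> i)\<close> is
  the value at \<open>u\<close> of the lift \<open>\<theta>\<close> of \<open>\<phi>\<^sub>d\<close>. So the weighted count becomes a character sum
  over \<open>k\<close> with the characters \<open>\<theta> ^ w i\<close>.

  The vectors with nonzero coordinates contribute the sum of \<open>\<Prod>i<d. (\<theta> ^ w i) (t i)\<close> over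
  the vectors \<open>t\<close> of units with product \<open>1\<close> and sum \<open>d * lam\<close> (\<open>dwork_torus_sum\<close>). Expanding
  the first condition in multiplicative and the second one in additive characters yields a
  sum over \<open>\<nu>\<close> of products of the Gauss sums of \<open>\<theta> ^ w i * \<nu>\<close> divided by the one of \<open>\<nu> ^ d\<close>.
  This is a hypergeometric function: the product formula of Hasse and Davenport
  (\<open>hasse_davenport_product\<close>) factors the Gauss sum of \<open>\<nu> ^ d\<close> into those of \<open>\<theta> ^ j * \<nu>\<close>.
  Cancelling common parameters alters only the terms at the inverses of upper parameters, by
  a factor \<open>Q\<close> (\<open>hyp_F_red_eq\<close>, \<open>torus_sum_eq_hyp_F_red\<close>).

  The vectors with some coordinate zero lie on the Fermat hypersurface. Their contribution
  is the difference of two Fourier sums (\<open>fourier_difference\<close>, \<open>fermat_minus_torus\<close>) and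
  consists of the products of Gauss sums at the same special characters. It cancels the
  alteration just described, apart from a term for the trivial character of the group, which
  gives the number of points of a projective space.

  The constant in front is a product of Gauss sums over \<open>k\<close>, which is a power of a Jacobi
  sum over the base field by the lifting theorem of Hasse and Davenport
  (\<open>hasse_davenport_lifting\<close>, \<open>prod_gauss_lift_eq_jacobi\<close>).

  Both theorems of Hasse and Davenport are derived from L-series over monic polynomials,
  which are represented by the Frobenius-stable multisets of their roots. The point is a
  recursion for the coefficients of an L-series in terms of sums over the extension fields
  (\<open>log_derivative_recursion\<close>), which results from counting the Frobenius orbits contained
  in a multiset.
\<close>

section \<open>Characters and Gauss sums of a finite subfield\<close>

lemma geometric_sum_mult: "q \<ge> 1 \<Longrightarrow> (\<Sum>i<n. q ^ i) * (q - 1) = q ^ n - (1 :: nat)"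
proof (induction n)
  case (Suc n)
  then have "1 \<le> q ^ n" "q ^ n \<le> q * q ^ n" by auto
  then show ?case using Suc by (simp add: algebra_simps)
qed simp

lemma prod_power_int:
  fixes x :: "'b::field" and n :: nat
  shows "x \<noteq> 0 \<Longrightarrow> (\<Prod>i<n. x powi w i) = x powi (\<Sum>i<n. w i)"
  by (induction n) (simp_all add: power_int_add)

text \<open>
  A base field that is a type and its extensions inside an algebraic closure are both
  instances of this locale. The unit group is abbreviated to \<open>U\<close>; the cardinality \<open>Q\<close> is a
  complex number, because it occurs only in identities between character sums.
\<close>

locale finite_subfield =
  fixes k :: "'k::field set"
  assumes finite_k: "finite k"
    and zero_in [simp]: "0 \<in> k"
    and one_in [simp]: "1 \<in> k"
    and add_in: "x \<in> k \<Longrightarrow> y \<in> k \<Longrightarrow> x + y \<in> k"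
    and uminus_in: "x \<in> k \<Longrightarrow> - x \<in> k"
    and mult_in: "x \<in> k \<Longrightarrow> y \<in> k \<Longrightarrow> x * y \<in> k"
    and inverse_in: "x \<in> k \<Longrightarrow> inverse x \<in> k"
begin

abbreviation U :: "'k set" where "U \<equiv> k - {0}"

abbreviation Q :: complex where "Q \<equiv> of_nat (card k)"

lemma finite_U [simp]: "finite U"
  using finite_k by simp

lemma U_mult: "x \<in> U \<Longrightarrow> y \<in> U \<Longrightarrow> x * y \<in> U"
  by (auto simp: mult_in)

lemma U_inverse: "x \<in> U \<Longrightarrow> inverse x \<in> U"
  by (auto simp: inverse_in)

lemma U_uminus: "x \<in> U \<Longrightarrow> - x \<in> U"
  by (auto simp: uminus_in)

lemma U_power: "x \<in> U \<Longrightarrow> x ^ n \<in> U"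
  by (induction n) (auto simp: mult_in)

lemma U_prod: "(\<And>i. i \<in> I \<Longrightarrow> f i \<in> U) \<Longrightarrow> prod f I \<in> U"
proof (induction I rule: infinite_finite_induct)
  case (insert i I)
  then show ?case using U_mult by simp
qed auto

lemma sum_in: "(\<And>i. i \<in> I \<Longrightarrow> f i \<in> k) \<Longrightarrow> sum f I \<in> k"
  by (induction I rule: infinite_finite_induct) (auto intro: add_in)

lemma of_nat_in: "of_nat n \<in> k"
  by (induction n) (auto intro: add_in)

lemma card_U: "card U = card k - 1"
  using finite_k by simp

lemma card_U_pos: "card U > 0"
  using finite_U by (metis card_gt_0_iff DiffI empty_iff one_in singletonD zero_neq_one)

lemma card_k_ge2: "card k \<ge> 2"
  using card_U card_U_pos by linarith

lemma of_nat_card_U: "of_nat (card U) = Q - 1"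
  using card_k_ge2 by (simp add: card_U of_nat_diff)

lemma card_k_neq_0 [simp]: "card k \<noteq> 0"
  using card_k_ge2 by auto

lemma Q_nonzero [simp]: "Q \<noteq> 0" and Q_neq_1: "Q \<noteq> 1"
  using card_k_ge2 by auto

lemma bij_betw_mult_U: "t \<in> U \<Longrightarrow> bij_betw (\<lambda>x. t * x) U U"
  by (rule bij_betw_byWitness[where f' = "\<lambda>x. inverse t * x"])
     (auto simp: mult_in inverse_in)

lemma bij_betw_mult_k: "t \<in> U \<Longrightarrow> bij_betw (\<lambda>x. t * x) k k"
  by (rule bij_betw_byWitness[where f' = "\<lambda>x. inverse t * x"])
     (auto simp: mult_in inverse_in)

lemma bij_betw_add_k: "t \<in> k \<Longrightarrow> bij_betw (\<lambda>x. t + x) k k"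
  by (rule bij_betw_byWitness[where f' = "\<lambda>x. - t + x"])
     (auto simp: add_in uminus_in intro: add_in[of _ "- t", simplified])

lemma U_power_card: assumes "x \<in> U" shows "x ^ card U = 1"
proof -
  have "(\<Prod>y\<in>U. y) = (\<Prod>y\<in>U. x * y)"
    using prod.reindex_bij_betw[OF bij_betw_mult_U[OF assms], of "\<lambda>y. y"] by simp
  also have "\<dots> = x ^ card U * (\<Prod>y\<in>U. y)"
    by (simp add: prod.distrib)
  finally show ?thesis using finite_U by simp
qed

lemma char_zero: "\<eta> \<in> mult_chars k \<Longrightarrow> x \<notin> U \<Longrightarrow> \<eta> x = 0"
  by (auto simp: mult_chars_def)

lemma char_nonzero: "\<eta> \<in> mult_chars k \<Longrightarrow> x \<in> U \<Longrightarrow> \<eta> x \<noteq> 0"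
  by (auto simp: mult_chars_def hom_def field_units_def Pi_def)

lemma char_mult: assumes "\<eta> \<in> mult_chars k" "x \<in> k" "y \<in> k"
  shows "\<eta> (x * y) = \<eta> x * \<eta> y"
proof (cases "x = 0 \<or> y = 0")
  case True
  then show ?thesis using assms char_zero[OF assms(1), of 0] by auto
next
  case False
  then show ?thesis using assms by (auto simp: mult_chars_def hom_def field_units_def)
qed

lemma char_one: assumes "\<eta> \<in> mult_chars k" shows "\<eta> 1 = 1"
  using char_mult[OF assms, of 1 1] char_nonzero[OF assms, of 1] by simp

lemma char_power: "\<eta> \<in> mult_chars k \<Longrightarrow> x \<in> U \<Longrightarrow> \<eta> (x ^ n) = \<eta> x ^ n"
  by (induction n) (simp_all add: char_one char_mult U_power[simplified])

lemma char_inverse: assumes "\<eta> \<in> mult_chars k" "x \<in> U"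
  shows "\<eta> (inverse x) = inverse (\<eta> x)"
  using char_mult[OF assms(1), of x "inverse x"] assms char_one[OF assms(1)] U_inverse[OF assms(2)]
    char_nonzero[OF assms]
  by (simp add: field_simps)

lemma char_prod: "\<eta> \<in> mult_chars k \<Longrightarrow> (\<And>i. i \<in> I \<Longrightarrow> f i \<in> U) \<Longrightarrow> \<eta> (prod f I) = (\<Prod>i\<in>I. \<eta> (f i))"
proof (induction I rule: infinite_finite_induct)
  case (insert i I)
  have "prod f I \<in> U" using U_prod insert by blast
  then show ?case using insert by (simp add: char_mult)
qed (auto simp: char_one)

lemma char_root_of_unity: "\<eta> \<in> mult_chars k \<Longrightarrow> x \<in> U \<Longrightarrow> \<eta> x ^ card U = 1"
  using char_power[of \<eta> x "card U"] by (simp add: U_power_card char_one del: card_Diff_insert)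

lemma algebraic_root_of_unity: assumes "(z::complex) ^ n = 1" "n > 0" shows "algebraic z"
proof (rule algebraicI[of "monom 1 n - 1"])
  have "coeff (monom 1 n - 1 :: complex poly) n = 1"
    using assms(2) by (simp add: coeff_1)
  then show "monom 1 n - 1 \<noteq> (0 :: complex poly)" by force
  show "coeff (monom 1 n - 1) i \<in> \<int>" for i :: nat
    by (auto simp: coeff_1)
  show "poly (monom 1 n - 1) z = 0" using assms(1) by (simp add: poly_monom)
qed

text \<open>
  A multiplicative function on the finite group \<open>U\<close> has roots of unity as values, so it
  takes its values among the algebraic numbers automatically.
\<close>

lemma mult_charI:
  assumes "\<And>x. x \<notin> U \<Longrightarrow> \<eta> x = 0"
    and "\<And>x. x \<in> U \<Longrightarrow> \<eta> x \<noteq> 0"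
    and "\<And>x y. x \<in> U \<Longrightarrow> y \<in> U \<Longrightarrow> \<eta> (x * y) = \<eta> x * \<eta> y"
  shows "\<eta> \<in> mult_chars k"
proof -
  have one: "\<eta> 1 = 1" using assms(2,3)[of 1] assms(3)[of 1 1] by simp
  have pow: "\<eta> (x ^ n) = \<eta> x ^ n" if "x \<in> U" for x n
    by (induction n) (use one that U_power[OF that] assms(3)[of x] in auto)
  have "algebraic (\<eta> x)" if "x \<in> U" for x
    by (rule algebraic_root_of_unity[OF _ card_U_pos])
       (use pow[OF that, of "card U"] U_power_card[OF that] one in metis)
  with assms show ?thesis
    by (auto simp: mult_chars_def hom_def field_units_def Qbar_def)
qed

lemma triv_char_in: "triv_char k \<in> mult_chars k"
  by (rule mult_charI) (auto simp: triv_char_def mult_in)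

lemma char_times_in: "\<alpha> \<in> mult_chars k \<Longrightarrow> \<beta> \<in> mult_chars k \<Longrightarrow> char_times \<alpha> \<beta> \<in> mult_chars k"
  by (rule mult_charI) (auto simp: char_times_def char_zero char_nonzero char_mult)

lemma char_pow_apply: "\<eta> \<in> mult_chars k \<Longrightarrow> x \<in> U \<Longrightarrow> char_pow \<eta> n x = \<eta> x powi n"
  by (auto simp: char_pow_def char_nonzero)

lemma char_pow_in: assumes "\<eta> \<in> mult_chars k" shows "char_pow \<eta> n \<in> mult_chars k"
proof (rule mult_charI)
  fix x y assume "x \<in> U" "y \<in> U"
  then show "char_pow \<eta> n (x * y) = char_pow \<eta> n x * char_pow \<eta> n y"
    using U_mult[of x y] assms
    by (simp add: char_pow_apply char_mult power_int_mult_distrib)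
next
  fix x assume "x \<in> U" then show "char_pow \<eta> n x \<noteq> 0"
    using assms by (simp add: char_pow_apply char_nonzero power_int_eq_0_iff)
qed (use assms in \<open>simp add: char_pow_def char_zero\<close>)

lemma char_eqI:
  "\<alpha> \<in> mult_chars k \<Longrightarrow> \<beta> \<in> mult_chars k \<Longrightarrow> (\<And>x. x \<in> U \<Longrightarrow> \<alpha> x = \<beta> x) \<Longrightarrow> \<alpha> = \<beta>"
  by (rule ext) (metis char_zero)

lemma triv_char_apply [simp]: "x \<in> U \<Longrightarrow> triv_char k x = 1"
  by (simp add: triv_char_def)

lemma sum_char:
  assumes "\<eta> \<in> mult_chars k"
  shows "(\<Sum>x\<in>U. \<eta> x) = (if \<eta> = triv_char k then Q - 1 else 0)"
proof (cases "\<eta> = triv_char k")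
  case True
  then show ?thesis by (simp add: of_nat_card_U del: card_Diff_insert)
next
  case False
  then obtain t where t: "t \<in> U" "\<eta> t \<noteq> 1"
    using char_eqI[OF assms triv_char_in] by auto
  have "(\<Sum>x\<in>U. \<eta> x) = (\<Sum>x\<in>U. \<eta> (t * x))"
    using sum.reindex_bij_betw[OF bij_betw_mult_U[OF t(1)], of \<eta>] by simp
  also have "\<dots> = \<eta> t * (\<Sum>x\<in>U. \<eta> x)"
    using t assms by (simp add: char_mult sum_distrib_left)
  finally show ?thesis using t(2) False by simp
qed

text \<open>
  With the operations of the type class, \<open>k\<close> is a
  field given by its carrier, so the
  theorem on finite subgroups of the multiplicative group applies.
\<close>

lemma cyclic: "\<exists>g\<in>U. \<forall>x\<in>U. \<exists>i. x = g ^ i"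
proof -
  define R :: "'k ring" where
    "R = \<lparr>carrier = k, monoid.mult = (*), one = 1, zero = 0, add = (+)\<rparr>"
  have "cring R"
  proof (intro cringI abelian_groupI comm_monoidI)
    fix x assume "x \<in> carrier R"
    then show "\<exists>y\<in>carrier R. y \<oplus>\<^bsub>R\<^esub> x = \<zero>\<^bsub>R\<^esub>"
      by (intro bexI[of _ "- x"]) (auto simp: R_def uminus_in)
  qed (auto simp: R_def add_in mult_in algebra_simps)
  then have "field R"
    by (rule cring.cring_fieldI2) (auto simp: R_def intro!: bexI[of _ "inverse _"] inverse_in)
  then interpret R: field R .
  have fin: "finite (carrier R)" using finite_k by (simp add: R_def)
  have pw: "a [^]\<^bsub>mult_of R\<^esub> (i::nat) = a ^ i" for a i
    by (induction i) (auto simp: R_def nat_pow_def mult_of_def)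
  obtain g where "g \<in> carrier (mult_of R)"
    "carrier (mult_of R) = {g [^]\<^bsub>mult_of R\<^esub> i | i::nat. i \<in> UNIV}"
    using R.finite_field_mult_group_has_gen[OF fin]
    by (auto simp: R_def mult_of_def nat_pow_def)
  then show ?thesis unfolding pw by (auto simp: R_def intro!: bexI[of _ g])
qed

lemma generator_powers:
  assumes g: "g \<in> U" "\<forall>x\<in>U. \<exists>i. x = g ^ i"
  shows "bij_betw (\<lambda>i. g ^ i) {..<card U} U" "g ^ i = g ^ j \<longleftrightarrow> i mod card U = j mod card U"
proof -
  let ?n = "card U"
  have red: "g ^ i = g ^ (i mod ?n)" for i
  proof -
    have "g ^ i = g ^ (?n * (i div ?n) + i mod ?n)" by simp
    also have "\<dots> = g ^ (i mod ?n)"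
      using U_power_card[OF g(1)] by (simp only: power_add power_mult) simp
    finally show ?thesis .
  qed
  have im: "(\<lambda>i. g ^ i) ` {..<?n} = U"
  proof
    show "(\<lambda>i. g ^ i) ` {..<?n} \<subseteq> U" by (intro image_subsetI U_power g(1))
    show "U \<subseteq> (\<lambda>i. g ^ i) ` {..<?n}"
    proof
      fix x assume "x \<in> U"
      then obtain i where "x = g ^ i" using g(2) by auto
      then show "x \<in> (\<lambda>i. g ^ i) ` {..<?n}"
        using red[of i] card_U_pos by (intro image_eqI[of _ _ "i mod ?n"]) auto
    qed
  qed
  then show bij: "bij_betw (\<lambda>i. g ^ i) {..<?n} U"
    by (metis bij_betw_def card_lessThan eq_card_imp_inj_on finite_lessThan)
  show "g ^ i = g ^ j \<longleftrightarrow> i mod ?n = j mod ?n"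
  proof
    assume "g ^ i = g ^ j"
    then have "g ^ (i mod ?n) = g ^ (j mod ?n)" using red by metis
    then show "i mod ?n = j mod ?n"
      using inj_onD[OF bij_betw_imp_inj_on[OF bij], of "i mod ?n" "j mod ?n"] card_U_pos by simp
  qed (use red in metis)
qed

lemma cis_power_eq_1_iff: "n > 0 \<Longrightarrow> cis (2 * pi / real n) ^ i = 1 \<longleftrightarrow> n dvd i"
proof -
  assume n: "n > 0"
  have "cis (2 * pi / real n) ^ i = cis (2 * pi * real i / real n)"
    by (simp add: Complex.DeMoivre mult.commute)
  also have "cis y = 1 \<longleftrightarrow> cos y = 1" for y
    using sin_cos_squared_add[of y] by (cases "cos y = 1") (simp_all add: complex_eq_iff)
  also have "cos (2 * pi * real i / real n) = 1 \<longleftrightarrow> (\<exists>m::int. 2 * pi * real i / real n = m * (2 * pi))"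
    unfolding cos_one_2pi_int by (simp add: mult_ac)
  also have "\<dots> \<longleftrightarrow> (\<exists>m::int. int i = m * int n)"
  proof -
    have "2 * pi * real i / real n = m * (2 * pi) \<longleftrightarrow> int i = m * int n" for m :: int
    proof -
      have "2 * pi * real i / real n = m * (2 * pi) \<longleftrightarrow> real i = m * real n"
        using n by (simp add: field_simps)
      also have "\<dots> \<longleftrightarrow> int i = m * int n"
        by (metis of_int_eq_iff of_int_mult of_int_of_nat_eq)
      finally show ?thesis .
    qed
    then show ?thesis by simp
  qed
  also have "\<dots> \<longleftrightarrow> int n dvd int i" by (auto simp: dvd_def mult.commute)
  finally show ?thesis by simp
qed

text \<open>
  Mapping a generator of the cyclic group \<open>U\<close> to a primitive root of unity of order \<open>card U\<close>
  gives a faithful character. Every character is one of its powers, since it is determined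
  by the image of the generator, which is a root of unity of order dividing \<open>card U\<close>.
\<close>

lemma faithful_char:
  obtains \<omega> where "\<omega> \<in> mult_chars k" "\<And>x. x \<in> U \<Longrightarrow> \<omega> x = 1 \<Longrightarrow> x = 1"
    and "\<And>\<eta>. \<eta> \<in> mult_chars k \<Longrightarrow> \<exists>j<card U. \<eta> = char_pow \<omega> (int j)"
proof -
  let ?n = "card U"
  obtain g where g: "g \<in> U" "\<forall>x\<in>U. \<exists>i. x = g ^ i" using cyclic by blast
  define \<zeta> where "\<zeta> = cis (2 * pi / real ?n)"
  have \<zeta>1: "\<zeta> ^ i = 1 \<longleftrightarrow> ?n dvd i" for i
    unfolding \<zeta>_def by (rule cis_power_eq_1_iff[OF card_U_pos])
  have \<zeta>0: "\<zeta> \<noteq> 0" by (simp add: \<zeta>_def)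
  have \<zeta>red: "\<zeta> ^ i = \<zeta> ^ (i mod ?n)" for i
  proof -
    have "\<zeta> ^ i = \<zeta> ^ (?n * (i div ?n) + i mod ?n)" by simp
    also have "\<dots> = \<zeta> ^ (i mod ?n)"
      using \<zeta>1[of ?n] by (simp only: power_add power_mult) simp
    finally show ?thesis .
  qed
  define \<omega> where "\<omega> x = (if x \<in> U then \<zeta> ^ (SOME i. x = g ^ i) else 0)" for x
  have \<omega>g: "\<omega> (g ^ i) = \<zeta> ^ i" for i
  proof -
    have "g ^ i = g ^ (SOME j. g ^ i = g ^ j)" by (rule someI) simp
    then have "i mod ?n = (SOME j. g ^ i = g ^ j) mod ?n"
      using generator_powers(2)[OF g] by blast
    then show ?thesis
      using U_power[OF g(1), of i] \<zeta>red unfolding \<omega>_def by metis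
  qed
  have \<omega>: "\<omega> \<in> mult_chars k"
  proof (rule mult_charI)
    fix x y assume "x \<in> U" "y \<in> U"
    then obtain i j where "x = g ^ i" "y = g ^ j" using g(2) by blast
    then show "\<omega> (x * y) = \<omega> x * \<omega> y"
      by (simp add: \<omega>g flip: power_add)
  qed (auto simp: \<omega>_def \<zeta>0)
  show ?thesis
  proof (rule that[OF \<omega>])
    fix x assume x: "x \<in> U" "\<omega> x = 1"
    then obtain i where i: "x = g ^ i" using g(2) by blast
    then have "?n dvd i" using x \<omega>g \<zeta>1 by metis
    then show "x = 1" using generator_powers(2)[OF g, of i 0] i by simp
  next
    fix \<eta> assume \<eta>: "\<eta> \<in> mult_chars k"
    have "\<eta> g ^ ?n = 1" using char_root_of_unity[OF \<eta> g(1)] .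
    moreover have "bij_betw (\<lambda>k. cis (2 * pi * real k / real ?n)) {..<?n} {z. z ^ ?n = 1}"
      by (rule bij_betw_roots_unity[OF card_U_pos])
    ultimately have "\<eta> g \<in> (\<lambda>k. cis (2 * pi * real k / real ?n)) ` {..<?n}"
      by (auto simp: bij_betw_def)
    then obtain j where j: "j < ?n" "\<eta> g = cis (2 * pi * real j / real ?n)" by auto
    have gj: "\<eta> g = \<zeta> ^ j"
      unfolding j(2) \<zeta>_def by (simp add: Complex.DeMoivre mult.commute)
    have "\<eta> = char_pow \<omega> (int j)"
    proof (rule char_eqI[OF \<eta> char_pow_in[OF \<omega>]])
      fix x assume x: "x \<in> U"
      then obtain i where i: "x = g ^ i" using g(2) by blast
      have "\<eta> x = \<zeta> ^ (j * i)" using char_power[OF \<eta> g(1), of i] i gj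
        by (simp add: power_mult)
      also have "\<dots> = \<omega> x ^ j" by (simp add: i \<omega>g mult.commute flip: power_mult)
      finally show "\<eta> x = char_pow \<omega> (int j) x"
        using char_pow_apply[OF \<omega> x] by simp
    qed
    then show "\<exists>j<?n. \<eta> = char_pow \<omega> (int j)" using j(1) by blast
  qed
qed

lemma finite_mult_chars: "finite (mult_chars k)" and card_mult_chars: "card (mult_chars k) = card U"
proof -
  obtain \<omega> where \<omega>: "\<omega> \<in> mult_chars k" "\<And>x. x \<in> U \<Longrightarrow> \<omega> x = 1 \<Longrightarrow> x = 1"
    "\<And>\<eta>. \<eta> \<in> mult_chars k \<Longrightarrow> \<exists>j<card U. \<eta> = char_pow \<omega> (int j)"
    using faithful_char by metis
  obtain g where g: "g \<in> U" "\<forall>x\<in>U. \<exists>i. x = g ^ i" using cyclic by blast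
  have "inj_on (\<lambda>j. char_pow \<omega> (int j)) {..<card U}"
  proof (rule linorder_inj_onI')
    fix i j assume ij: "i \<in> {..<card U}" "j \<in> {..<card U}" "i < j"
    show "char_pow \<omega> (int i) \<noteq> char_pow \<omega> (int j)"
    proof
      assume "char_pow \<omega> (int i) = char_pow \<omega> (int j)"
      then have "\<omega> g ^ i = \<omega> g ^ j"
        using char_pow_apply[OF \<omega>(1) g(1)] by (metis power_int_of_nat)
      then have "\<omega> g ^ (j - i) = 1"
        using ij(3) char_nonzero[OF \<omega>(1) g(1)] by (simp add: power_diff)
      then have "g ^ (j - i) = 1"
        using \<omega>(2)[OF U_power[OF g(1)]] char_power[OF \<omega>(1) g(1)] by metis
      then have "(j - i) mod card U = 0" using generator_powers(2)[OF g, of "j - i" 0] by simp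
      then show False using ij by auto
    qed
  qed
  moreover have "(\<lambda>j. char_pow \<omega> (int j)) ` {..<card U} = mult_chars k"
    using \<omega>(3) char_pow_in[OF \<omega>(1)] by blast
  ultimately have "bij_betw (\<lambda>j. char_pow \<omega> (int j)) {..<card U} (mult_chars k)"
    by (simp add: bij_betw_def)
  then show "finite (mult_chars k)" "card (mult_chars k) = card U"
    using bij_betw_finite bij_betw_same_card by fastforce+
qed

lemma char_inv_cancel: "\<eta> \<in> mult_chars k \<Longrightarrow> \<nu> \<in> mult_chars k \<Longrightarrow>
    char_times (char_pow \<eta> (-1)) (char_times \<eta> \<nu>) = \<nu>"
  by (rule char_eqI)
     (simp_all add: char_times_in char_pow_in, simp add: char_times_def char_pow_apply char_nonzero
       power_int_minus)

text \<open>
  If \<open>x \<noteq> 1\<close>, a character \<open>\<omega>\<close> with \<open>\<omega> x \<noteq> 1\<close> exists, and multiplying the summation index by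
  \<open>\<omega>\<close> multiplies the sum by \<open>\<omega> x\<close>.
\<close>

lemma sum_mult_chars:
  assumes x: "x \<in> U"
  shows "(\<Sum>\<nu>\<in>mult_chars k. \<nu> x) = (if x = 1 then Q - 1 else 0)"
proof (cases "x = 1")
  case True
  then show ?thesis using card_mult_chars of_nat_card_U
    by (simp add: char_one del: card_Diff_insert)
next
  case False
  then obtain \<omega> where \<omega>: "\<omega> \<in> mult_chars k" "\<omega> x \<noteq> 1"
    using faithful_char x by metis
  have "bij_betw (char_times \<omega>) (mult_chars k) (mult_chars k)"
  proof (rule bij_betw_byWitness[where f' = "char_times (char_pow \<omega> (-1))"])
    show "\<forall>\<nu>\<in>mult_chars k. char_times \<omega> (char_times (char_pow \<omega> (-1)) \<nu>) = \<nu>"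
      using char_inv_cancel[OF \<omega>(1)] by (auto simp: char_times_def fun_eq_iff mult_ac)
  qed (use \<omega> char_inv_cancel in \<open>auto simp: char_times_in char_pow_in\<close>)
  then have "(\<Sum>\<nu>\<in>mult_chars k. \<nu> x) = (\<Sum>\<nu>\<in>mult_chars k. char_times \<omega> \<nu> x)"
    using sum.reindex_bij_betw[of "char_times \<omega>" _ _ "\<lambda>\<nu>. \<nu> x"] by simp
  also have "\<dots> = \<omega> x * (\<Sum>\<nu>\<in>mult_chars k. \<nu> x)"
    by (simp add: char_times_def sum_distrib_left)
  finally show ?thesis using \<omega>(2) False by simp
qed

end

locale gauss_setup = finite_subfield +
  fixes \<psi> :: "'a \<Rightarrow> complex"
  assumes add_char: "nontrivial_add_char k \<psi>"
begin

lemma psi_add: "x \<in> k \<Longrightarrow> y \<in> k \<Longrightarrow> \<psi> (x + y) = \<psi> x * \<psi> y"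
  using add_char by (simp add: nontrivial_add_char_def)

lemma psi_nonzero: "x \<in> k \<Longrightarrow> \<psi> x \<noteq> 0"
  using add_char by (simp add: nontrivial_add_char_def)

lemma psi_0 [simp]: "\<psi> 0 = 1"
  using psi_add[of 0 0] psi_nonzero[of 0] by simp

lemma psi_sum: "(\<And>i. i \<in> I \<Longrightarrow> f i \<in> k) \<Longrightarrow> \<psi> (sum f I) = (\<Prod>i\<in>I. \<psi> (f i))"
proof (induction I rule: infinite_finite_induct)
  case (insert i I)
  then show ?case using sum_in[of I f] by (simp add: psi_add)
qed auto

lemma sum_psi: "(\<Sum>x\<in>k. \<psi> x) = 0"
proof -
  obtain t where t: "t \<in> k" "\<psi> t \<noteq> 1"
    using add_char by (auto simp: nontrivial_add_char_def)
  have "(\<Sum>x\<in>k. \<psi> x) = (\<Sum>x\<in>k. \<psi> (t + x))"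
    using sum.reindex_bij_betw[OF bij_betw_add_k[OF t(1)], of \<psi>] by simp
  also have "\<dots> = \<psi> t * (\<Sum>x\<in>k. \<psi> x)"
    using t by (simp add: psi_add sum_distrib_left)
  finally show ?thesis using t(2) by simp
qed

lemma sum_psi_mult: "t \<in> k \<Longrightarrow> (\<Sum>x\<in>k. \<psi> (t * x)) = (if t = 0 then Q else 0)"
  using sum_psi sum.reindex_bij_betw[OF bij_betw_mult_k[of t], of \<psi>] by auto

lemma sum_U: "(\<Sum>x\<in>U. f x) = (\<Sum>x\<in>k. f x) - (f 0 :: complex)"
  using finite_k by (subst sum_diff1) auto

text \<open>
  Detection of the condition \<open>f \<omega> = 0\<close> by additive characters: the inner sum of
  \<open>\<psi> (s * f \<omega>)\<close> over \<open>s\<close> is \<open>Q\<close> or \<open>0\<close>.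
\<close>

lemma sum_restrict_zero:
  assumes "finite \<Omega>" "\<And>\<omega>. \<omega> \<in> \<Omega> \<Longrightarrow> f \<omega> \<in> k"
  shows "(\<Sum>\<omega> | \<omega> \<in> \<Omega> \<and> f \<omega> = 0. a \<omega>) = 1 / Q * (\<Sum>s\<in>k. \<Sum>\<omega>\<in>\<Omega>. a \<omega> * \<psi> (s * f \<omega>))"
proof -
  have "(\<Sum>s\<in>k. \<Sum>\<omega>\<in>\<Omega>. a \<omega> * \<psi> (s * f \<omega>)) = (\<Sum>\<omega>\<in>\<Omega>. a \<omega> * (\<Sum>s\<in>k. \<psi> (f \<omega> * s)))"
    by (subst sum.swap) (simp add: sum_distrib_left mult.commute)
  also have "\<dots> = (\<Sum>\<omega>\<in>\<Omega>. if f \<omega> = 0 then Q * a \<omega> else 0)"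
    using assms(2) by (intro sum.cong refl) (simp add: sum_psi_mult)
  also have "\<dots> = Q * (\<Sum>\<omega> | \<omega> \<in> \<Omega> \<and> f \<omega> = 0. a \<omega>)"
    using assms(1) by (simp add: sum.inter_filter sum_distrib_left flip: sum.inter_filter)
  finally show ?thesis by simp
qed

text \<open>
  The Gauss sum without the sign that \<^const>\<open>gauss\<close> carries. Products of many Gauss sums are
  easier to handle in this normalization.
\<close>

definition gsum :: "('a \<Rightarrow> complex) \<Rightarrow> complex" where
  "gsum \<eta> = (\<Sum>x\<in>U. \<eta> x * \<psi> x)"

lemma gauss_eq: "gauss k \<psi> \<eta> = - gsum \<eta>"
  by (simp add: gauss_def gsum_def)

lemma gsum_triv: "gsum (triv_char k) = -1"
  using sum_U[of \<psi>] sum_psi by (simp add: gsum_def)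

lemma gsum_twist:
  assumes "\<eta> \<in> mult_chars k" "t \<in> U"
  shows "(\<Sum>x\<in>U. \<eta> x * \<psi> (t * x)) = inverse (\<eta> t) * gsum \<eta>"
proof -
  have "gsum \<eta> = (\<Sum>x\<in>U. \<eta> (t * x) * \<psi> (t * x))"
    unfolding gsum_def using sum.reindex_bij_betw[OF bij_betw_mult_U[OF assms(2)], of "\<lambda>x. \<eta> x * \<psi> x"]
    by simp
  also have "\<dots> = \<eta> t * (\<Sum>x\<in>U. \<eta> x * \<psi> (t * x))"
    using assms by (simp add: char_mult sum_distrib_left mult_ac)
  finally show ?thesis using char_nonzero[OF assms] by simp
qed

text \<open>
  Substituting \<open>x * y\<close> for \<open>x\<close> in the first factor turns the product into the sum of \<open>\<eta> x\<close>
  times the sum of \<open>\<psi> ((x - 1) * y)\<close> over nonzero \<open>y\<close>, which is \<open>Q - 1\<close> for \<open>x = 1\<close> and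
  \<open>- 1\<close> otherwise. Since the total sum of \<open>\<eta>\<close> vanishes, the result is \<open>Q\<close>. In particular,
  Gauss sums do not vanish.
\<close>

lemma gsum_dual:
  assumes "\<eta> \<in> mult_chars k" "\<eta> \<noteq> triv_char k"
  shows "gsum \<eta> * (\<Sum>y\<in>U. inverse (\<eta> y) * \<psi> (- y)) = Q"
proof -
  have "gsum \<eta> * (\<Sum>y\<in>U. inverse (\<eta> y) * \<psi> (- y)) =
      (\<Sum>y\<in>U. (\<Sum>x\<in>U. \<eta> x * \<psi> (y * x)) * \<psi> (- y))"
    unfolding sum_distrib_left
    by (intro sum.cong refl) (simp add: gsum_twist[OF assms(1)])
  also have "\<dots> = (\<Sum>x\<in>U. \<eta> x * (\<Sum>y\<in>U. \<psi> ((x - 1) * y)))"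
    unfolding sum_distrib_left sum_distrib_right
  proof (subst sum.swap, intro sum.cong refl)
    fix x y assume "x \<in> U" "y \<in> U"
    then show "\<eta> x * \<psi> (y * x) * \<psi> (- y) = \<eta> x * \<psi> ((x - 1) * y)"
      using psi_add[of "y * x" "- y"] by (simp add: mult_in uminus_in algebra_simps)
  qed
  also have "\<dots> = (\<Sum>x\<in>U. \<eta> x * ((if x = 1 then Q else 0) - 1))"
  proof (intro sum.cong refl)
    fix x assume x: "x \<in> U"
    have "x - 1 \<in> k" using add_in[of x "- 1"] x uminus_in[of 1] by simp
    then show "\<eta> x * (\<Sum>y\<in>U. \<psi> ((x - 1) * y)) = \<eta> x * ((if x = 1 then Q else 0) - 1)"
      unfolding sum_U[of "\<lambda>y. \<psi> ((x - 1) * y)"] by (simp add: sum_psi_mult)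
  qed
  also have "\<dots> = (\<Sum>x\<in>U. if x = 1 then Q * \<eta> 1 else 0) - (\<Sum>x\<in>U. \<eta> x)"
    unfolding sum_subtractf[symmetric] by (intro sum.cong refl) (auto simp: algebra_simps)
  also have "\<dots> = Q"
    using assms sum_char[OF assms(1)] by (simp add: sum.delta' char_one finite_k)
  finally show ?thesis .
qed

lemma gsum_nonzero: assumes "\<eta> \<in> mult_chars k" shows "gsum \<eta> \<noteq> 0"
  using gsum_dual[OF assms] gsum_triv by (cases "\<eta> = triv_char k") auto

text \<open>
  The factor \<open>Q ^ char_delta k \<eta>\<close> in \<^const>\<open>gauss_o\<close> is made so that the trivial character obeys
  the same formula as the others: its sum is \<open>- 1\<close>, where the formula without the factor
  would give \<open>- Q\<close>.
\<close>

lemma sum_inverse_char_psi: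
  assumes "\<eta> \<in> mult_chars k" "c \<in> U"
  shows "(\<Sum>s\<in>U. inverse (\<eta> s) * \<psi> (- c * s)) = - \<eta> c * Q / gauss_o k \<psi> \<eta>"
proof -
  have "(\<Sum>s\<in>U. inverse (\<eta> s) * \<psi> (- s)) = (\<Sum>s\<in>U. inverse (\<eta> (c * s)) * \<psi> (- (c * s)))"
    using sum.reindex_bij_betw[OF bij_betw_mult_U[OF assms(2)], of "\<lambda>s. inverse (\<eta> s) * \<psi> (- s)"]
    by simp
  also have "\<dots> = inverse (\<eta> c) * (\<Sum>s\<in>U. inverse (\<eta> s) * \<psi> (- c * s))"
    using assms by (simp add: char_mult sum_distrib_left mult_ac)
  finally have *: "(\<Sum>s\<in>U. inverse (\<eta> s) * \<psi> (- c * s)) =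
      \<eta> c * (\<Sum>s\<in>U. inverse (\<eta> s) * \<psi> (- s))"
    using char_nonzero[OF assms] by simp
  show ?thesis
  proof (cases "\<eta> = triv_char k")
    case True
    have "(\<Sum>s\<in>U. \<psi> (- 1 * s)) = -1"
      unfolding sum_U[of "\<lambda>s. \<psi> (- 1 * s)"] using sum_psi_mult[of "-1"] uminus_in[of 1] by simp
    then show ?thesis
      unfolding * using True by (simp add: gauss_o_def gauss_eq gsum_triv char_delta_def)
  next
    case False
    then show ?thesis
      unfolding * using gsum_dual[OF assms(1) False] gsum_nonzero[OF assms(1)]
      by (simp add: gauss_o_def gauss_eq char_delta_def field_simps)
  qed
qed

text \<open>
  The level sets of a sum of coordinates, expanded in additive characters. The frequency
  \<open>s = 0\<close> contributes only if all the \<open>\<eta> i\<close> are trivial; at \<open>s \<noteq> 0\<close> the sum over the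
  coordinates is a product of Gauss sums times \<open>inverse (E s)\<close>, and the remaining sum over
  \<open>s\<close> is the dual Gauss sum of \<open>E\<close>.
\<close>

lemma sum_prod_char_level:
  assumes I: "finite I"
    and \<eta>: "\<And>i. i \<in> I \<Longrightarrow> \<eta> i \<in> mult_chars k"
    and E: "E \<in> mult_chars k" "\<And>x. x \<in> U \<Longrightarrow> E x = (\<Prod>i\<in>I. \<eta> i x)"
    and c: "c \<in> U"
  shows "(\<Sum>t | t \<in> I \<rightarrow>\<^sub>E U \<and> (\<Sum>i\<in>I. t i) = c. \<Prod>i\<in>I. \<eta> i (t i)) =
    (of_bool (\<forall>i\<in>I. \<eta> i = triv_char k) * (Q - 1) ^ card I) / Q
      - E c * (\<Prod>i\<in>I. gsum (\<eta> i)) / gauss_o k \<psi> E"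
proof -
  have in_k: "(\<Sum>i\<in>I. t i) - c \<in> k" if "t \<in> I \<rightarrow>\<^sub>E U" for t
    using add_in[of "\<Sum>i\<in>I. t i" "- c"] sum_in[of I t] that c uminus_in[of c]
    by (fastforce simp: PiE_iff)
  have fin: "finite (I \<rightarrow>\<^sub>E U)" using I finite_U by (rule finite_PiE)
  have fact: "(\<Sum>t\<in>I \<rightarrow>\<^sub>E U. (\<Prod>i\<in>I. \<eta> i (t i)) * \<psi> (s * ((\<Sum>i\<in>I. t i) - c))) =
      \<psi> (- c * s) * (\<Prod>i\<in>I. \<Sum>x\<in>U. \<eta> i x * \<psi> (s * x))" if s: "s \<in> k" for s
  proof -
    have "\<psi> (s * ((\<Sum>i\<in>I. t i) - c)) = \<psi> (- c * s) * (\<Prod>i\<in>I. \<psi> (s * t i))"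
      if t: "t \<in> I \<rightarrow>\<^sub>E U" for t
    proof -
      have ti: "s * t i \<in> k" if "i \<in> I" for i using t s that by (auto intro!: mult_in)
      have cs: "- c * s \<in> k" using c s by (auto intro: mult_in uminus_in)
      have "\<psi> (s * ((\<Sum>i\<in>I. t i) - c)) = \<psi> (- c * s + (\<Sum>i\<in>I. s * t i))"
        by (simp add: algebra_simps sum_distrib_left)
      then show ?thesis using psi_add[OF cs sum_in[of I "\<lambda>i. s * t i"]] psi_sum[of I "\<lambda>i. s * t i"] ti
        by simp
    qed
    then have "(\<Sum>t\<in>I \<rightarrow>\<^sub>E U. (\<Prod>i\<in>I. \<eta> i (t i)) * \<psi> (s * ((\<Sum>i\<in>I. t i) - c))) =
        \<psi> (- c * s) * (\<Sum>t\<in>I \<rightarrow>\<^sub>E U. \<Prod>i\<in>I. \<eta> i (t i) * \<psi> (s * t i))"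
      by (simp add: sum_distrib_left prod.distrib mult_ac)
    then show ?thesis
      using prod_sum_PiE[OF I, of "\<lambda>_. U" "\<lambda>i x. \<eta> i x * \<psi> (s * x)"] finite_U by simp
  qed
  let ?G = "\<Prod>i\<in>I. gsum (\<eta> i)"
  have "(\<Sum>t | t \<in> I \<rightarrow>\<^sub>E U \<and> (\<Sum>i\<in>I. t i) = c. \<Prod>i\<in>I. \<eta> i (t i)) =
      (\<Sum>t | t \<in> I \<rightarrow>\<^sub>E U \<and> (\<Sum>i\<in>I. t i) - c = 0. \<Prod>i\<in>I. \<eta> i (t i))"
    by simp
  also have "\<dots> = 1 / Q * (\<Sum>s\<in>k. \<psi> (- c * s) * (\<Prod>i\<in>I. \<Sum>x\<in>U. \<eta> i x * \<psi> (s * x)))"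
    using sum_restrict_zero[OF fin in_k] fact by simp
  also have "(\<Sum>s\<in>k. \<psi> (- c * s) * (\<Prod>i\<in>I. \<Sum>x\<in>U. \<eta> i x * \<psi> (s * x))) =
      (\<Prod>i\<in>I. \<Sum>x\<in>U. \<eta> i x) + (\<Sum>s\<in>U. \<psi> (- c * s) * (\<Prod>i\<in>I. \<Sum>x\<in>U. \<eta> i x * \<psi> (s * x)))"
    unfolding sum_U[of "\<lambda>s. \<psi> (- c * s) * (\<Prod>i\<in>I. \<Sum>x\<in>U. \<eta> i x * \<psi> (s * x))"] by simp
  also have "(\<Prod>i\<in>I. \<Sum>x\<in>U. \<eta> i x) = of_bool (\<forall>i\<in>I. \<eta> i = triv_char k) * (Q - 1) ^ card I"
  proof -
    have "(\<Prod>i\<in>I. \<Sum>x\<in>U. \<eta> i x) = (\<Prod>i\<in>I. if \<eta> i = triv_char k then Q - 1 else 0)"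
      by (intro prod.cong refl) (simp add: sum_char \<eta>)
    then show ?thesis using I by auto
  qed
  also have "(\<Sum>s\<in>U. \<psi> (- c * s) * (\<Prod>i\<in>I. \<Sum>x\<in>U. \<eta> i x * \<psi> (s * x))) =
      ?G * (\<Sum>s\<in>U. inverse (E s) * \<psi> (- c * s))"
    unfolding sum_distrib_left
  proof (intro sum.cong refl)
    fix s assume s: "s \<in> U"
    have "(\<Prod>i\<in>I. \<Sum>x\<in>U. \<eta> i x * \<psi> (s * x)) = (\<Prod>i\<in>I. inverse (\<eta> i s) * gsum (\<eta> i))"
      by (intro prod.cong refl gsum_twist \<eta> s)
    also have "\<dots> = inverse (E s) * ?G"
      using E(2)[OF s] by (simp add: prod.distrib prod_inversef[unfolded comp_def])
    finally show "\<psi> (- c * s) * (\<Prod>i\<in>I. \<Sum>x\<in>U. \<eta> i x * \<psi> (s * x)) =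
        ?G * (inverse (E s) * \<psi> (- c * s))" by simp
  qed
  finally show ?thesis
    unfolding sum_inverse_char_psi[OF E(1) c] by (simp add: add_divide_distrib diff_divide_distrib mult_ac)
qed

end

section \<open>Newton's identities\<close>

definition psum :: "'c::comm_ring_1 multiset \<Rightarrow> nat \<Rightarrow> 'c" where
  "psum A k = (\<Sum>x\<in>#A. x ^ k)"

text \<open>
  The elementary symmetric function of degree \<open>k\<close>, up to the sign \<open>(-1) ^ k\<close>.
\<close>

definition sesym :: "'c::comm_ring_1 multiset \<Rightarrow> nat \<Rightarrow> 'c" where
  "sesym A k = coeff (\<Prod>x\<in>#A. [:1, - x:]) k"

lemma sesym_0 [simp]: "sesym A 0 = 1"
  by (induction A) (simp_all add: sesym_def)

lemma sesym_add_Suc: "sesym (add_mset x A) (Suc n) = sesym A (Suc n) - x * sesym A n"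
  by (simp add: sesym_def)

lemma psum_add: "psum (add_mset x A) k = x ^ k + psum A k"
  by (simp add: psum_def)

text \<open>
  Induction on \<open>A\<close>: a new element \<open>x\<close> multiplies the generating polynomial by \<open>1 - x T\<close>, and
  the contributions of the powers of \<open>x\<close> telescope.
\<close>

lemma newton:
  "of_nat n * sesym A n = - (\<Sum>k<n. psum A (Suc k) * sesym A (n - Suc k))"
proof (induction A arbitrary: n)
  case empty
  then show ?case by (cases n) (simp_all add: sesym_def psum_def)
next
  case (add x A)
  show ?case
  proof (cases n)
    case (Suc m)
    have e: "sesym (add_mset x A) (n - Suc k) = sesym A (n - Suc k) - (if k < m then x * sesym A (m - Suc k) else 0)"
      if "k < n" for k
      using that Suc sesym_add_Suc[of x A "m - Suc k"] by (cases "k < m") (auto simp: Suc_diff_Suc less_Suc_eq)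
    have tele: "(\<Sum>k<j. x ^ Suc k * sesym A (m - k)) - (\<Sum>k<j - 1. x ^ Suc (Suc k) * sesym A (m - Suc k)) =
        (if j = 0 then 0 else x * sesym A m)" for j
    proof (cases j)
      case (Suc i)
      then show ?thesis by (simp add: sum.lessThan_Suc_shift del: sum.lessThan_Suc)
    qed simp
    have if_sum: "(\<Sum>k<n. f k * (if k < m then x * sesym A (m - Suc k) else 0)) =
        (\<Sum>k<m. f k * (x * sesym A (m - Suc k)))" for f :: "nat \<Rightarrow> 'a"
      by (simp add: Suc)
    have 1: "(\<Sum>k<n. x ^ Suc k * sesym (add_mset x A) (n - Suc k)) = x * sesym A m"
    proof -
      have "(\<Sum>k<n. x ^ Suc k * sesym (add_mset x A) (n - Suc k)) =
          (\<Sum>k<n. x ^ Suc k * sesym A (n - Suc k)) - (\<Sum>k<m. x ^ Suc k * (x * sesym A (m - Suc k)))"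
        unfolding if_sum[symmetric] sum_subtractf[symmetric]
        by (intro sum.cong refl) (simp add: e algebra_simps)
      then show ?thesis using tele[of n] by (simp add: Suc mult_ac add_diff_eq diff_add_eq)
    qed
    have 2: "(\<Sum>k<n. psum A (Suc k) * sesym (add_mset x A) (n - Suc k)) =
        - (of_nat n * sesym A n) + x * (of_nat m * sesym A m)"
    proof -
      have "(\<Sum>k<n. psum A (Suc k) * sesym (add_mset x A) (n - Suc k)) =
          (\<Sum>k<n. psum A (Suc k) * sesym A (n - Suc k)) - (\<Sum>k<m. psum A (Suc k) * (x * sesym A (m - Suc k)))"
        unfolding if_sum[symmetric] sum_subtractf[symmetric]
        by (intro sum.cong refl) (simp add: e algebra_simps)
      then show ?thesis using add[of n] add[of m] by (simp add: sum_distrib_left mult_ac)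
    qed
    have "(\<Sum>k<n. psum (add_mset x A) (Suc k) * sesym (add_mset x A) (n - Suc k)) =
        - (of_nat n * sesym (add_mset x A) n)"
      unfolding psum_add distrib_right sum.distrib 1 2
      by (simp add: Suc sesym_add_Suc algebra_simps)
    then show ?thesis by simp
  qed simp
qed

lemma psum_Suc_newton:
  "psum A (Suc m) + of_nat (Suc m) * sesym A (Suc m) = - (\<Sum>k<m. psum A (Suc k) * sesym A (m - k))"
  using newton[of "Suc m" A] by simp

lemma psum_cong_sesym:
  assumes "\<And>i. i < n \<Longrightarrow> sesym A i = sesym B i" and "0 < m" "m < n"
  shows "psum A m = psum B m"
  using assms(2,3)
proof (induction m rule: less_induct)
  case (less m)
  obtain l where l: "m = Suc l" using less.prems(1) gr0_implies_Suc by blast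
  have "(\<Sum>k<l. psum A (Suc k) * sesym A (l - k)) = (\<Sum>k<l. psum B (Suc k) * sesym B (l - k))"
    using less l by (intro sum.cong refl arg_cong2[where f = "(*)"] assms(1)) auto
  then show ?case
    using psum_Suc_newton[of A l] psum_Suc_newton[of B l] assms(1)[of m] less.prems l
    by (metis add_right_cancel)
qed

text \<open>
  By Newton's identities, the power sum of degree \<open>n\<close> is \<open>- n\<close> times the top symmetric
  function plus an expression in the lower ones. So the constant coefficient of a polynomial
  of degree \<open>n\<close> enters this power sum only through a linear term.
\<close>

lemma psum_top_cong_sesym:
  assumes "\<And>i. i < n \<Longrightarrow> sesym A i = sesym B i" and "0 < n"
  shows "psum A n + of_nat n * sesym A n = psum B n + of_nat n * sesym B n"
proof -
  obtain l where l: "n = Suc l" using assms(2) gr0_implies_Suc by blast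
  have "(\<Sum>k<l. psum A (Suc k) * sesym A (l - k)) = (\<Sum>k<l. psum B (Suc k) * sesym B (l - k))"
    using l by (intro sum.cong refl arg_cong2[where f = "(*)"] assms(1) psum_cong_sesym[OF assms(1)]) auto
  then show ?thesis
    using psum_Suc_newton[of A l] psum_Suc_newton[of B l] l by simp
qed

lemma sesym_size: "sesym A (size A) = (-1) ^ size A * prod_mset A"
  and sesym_gt_size: "n > size A \<Longrightarrow> sesym A n = 0"
proof (induction A arbitrary: n)
  case empty
  {
    case 1 then show ?case by simp
  next
    case 2 then show ?case by (simp add: sesym_def)
  }
next
  case (add x A)
  {
    case 1 then show ?case using add by (simp add: sesym_add_Suc)
  next
    case (2 n) then show ?case using add by (cases n) (simp_all add: sesym_add_Suc)
  }
qed

lemma linear_prod_nonzero: "(\<Prod>x\<in>#A. [:- x, 1:]) \<noteq> (0 :: 'c::idom poly)"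
  by (auto simp: prod_mset_zero_iff image_iff)

lemma degree_linear_prod: "degree (\<Prod>x\<in>#A. [:- x, 1 :: 'c::idom:]) = size A"
proof (induction A)
  case (add x A)
  have "degree ([:- x, 1:] * (\<Prod>x\<in>#A. [:- x, 1:])) = degree [:- x, 1:] + degree (\<Prod>x\<in>#A. [:- x, 1:])"
    by (rule degree_mult_eq[OF _ linear_prod_nonzero]) simp
  then show ?case using add by (simp del: mult_pCons_left)
qed simp

lemma coeff_prod_linear:
  fixes A :: "'c::idom multiset"
  assumes "k \<le> size A"
  shows "coeff (\<Prod>x\<in>#A. [:- x, 1:]) (size A - k) = sesym A k"
proof -
  let ?P = "\<Prod>x\<in>#A. [:- x, 1:]"
  have deg: "degree ?P = size A" by (rule degree_linear_prod)
  have refl: "reflect_poly ?P = (\<Prod>x\<in>#A. [:1, - x:])"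
  proof (induction A)
    case (add x A)
    have "reflect_poly ([:- x, 1:] * (\<Prod>x\<in>#A. [:- x, 1:])) =
        reflect_poly [:- x, 1:] * reflect_poly (\<Prod>x\<in>#A. [:- x, 1:])"
      by (rule reflect_poly_mult)
    moreover have "reflect_poly [:- x, 1:] = [:1, - x:]" by (simp add: reflect_poly_def)
    ultimately show ?case using add by (simp del: mult_pCons_left)
  qed simp
  show ?thesis
    unfolding sesym_def refl[symmetric] coeff_reflect_poly deg using assms by simp
qed

lemma card_set_mset_le_size: "card (set_mset A) \<le> size A"
  by (induction A) (auto simp: card_insert_if)

section \<open>Frobenius-stable multisets and L-series\<close>

text \<open>
  The map \<open>x \<mapsto> x ^ q\<close> is a Frobenius of an algebraically closed field. The argument \<open>dummy\<close>
  fixes the field, which the number \<open>q\<close> does not determine.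
\<close>

locale frobenius_power =
  fixes q :: nat and dummy :: "'c::alg_closed_field itself"
  assumes q_ge2: "q \<ge> 2"
    and frob_add: "(x + y :: 'c) ^ q = x ^ q + y ^ q"
begin

abbreviation fr :: "'c \<Rightarrow> 'c" where "fr x \<equiv> x ^ q"

text \<open>
  The fixed field of the \<open>n\<close>-fold iterate, which for \<open>n > 0\<close> is the field with \<open>q ^ n\<close>
  elements.
\<close>

definition K :: "nat \<Rightarrow> 'c set" where "K n = {x. x ^ (q ^ n) = x}"

text \<open>
  For \<open>x \<in> K n\<close> these are the conjugates of \<open>x\<close> with multiplicity, that is, the roots of the
  characteristic polynomial of \<open>x\<close> over \<open>K 1\<close>.
\<close>

definition orbit :: "nat \<Rightarrow> 'c \<Rightarrow> 'c multiset" where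
  "orbit n x = image_mset (\<lambda>i. x ^ (q ^ i)) (mset_set {..<n})"

text \<open>
  A monic polynomial over \<open>K 1\<close> is represented by its multiset of roots, and a multiset
  arises in this way iff Frobenius maps it to itself. Multiplication of polynomials is then
  addition of multisets, and the factorization into irreducible polynomials is the
  decomposition into orbits.
\<close>

definition M :: "nat \<Rightarrow> 'c multiset set" where
  "M n = {A. size A = n \<and> image_mset fr A = A}"

lemma frob_zero [simp]: "(0 :: 'c) ^ q = 0"
  using q_ge2 by simp

lemma frob_uminus: "fr (- x) = - fr x"
  using frob_add[of x "- x"] by (simp add: eq_neg_iff_add_eq_0 add.commute)

lemma frob_diff: "fr (x - y) = fr x - fr y"
  using frob_add[of x "- y"] by (simp add: frob_uminus)

lemma frob_inj: "fr x = fr y \<Longrightarrow> x = y"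
  using frob_diff[of x y] q_ge2 by simp

lemma pow_Suc_frob: "x ^ (q ^ Suc n) = fr (x ^ (q ^ n))" "x ^ (q ^ Suc n) = (fr x) ^ (q ^ n)" for x :: 'c
  by (simp_all add: mult.commute flip: power_mult)

lemma pow_pow_add: "(x ^ (q ^ m)) ^ (q ^ n) = x ^ (q ^ (m + n))" for x :: 'c
  by (simp add: power_add flip: power_mult)

lemma frob_pow_add: "(x + y :: 'c) ^ (q ^ n) = x ^ (q ^ n) + y ^ (q ^ n)"
  by (induction n) (simp_all add: pow_Suc_frob frob_add del: power_Suc)

lemma frob_pow_inj: "x ^ (q ^ n) = y ^ (q ^ n) \<Longrightarrow> x = y" for x y :: 'c
  by (induction n) (auto simp: pow_Suc_frob simp del: power_Suc dest: frob_inj)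

lemma finite_K: assumes "n \<ge> 1" shows "finite (K n)"
proof -
  have "q ^ n > 1" using q_ge2 assms by (intro one_less_power) auto
  define p :: "'c poly" where "p = monom 1 (q ^ n) - monom 1 1"
  have "coeff p (q ^ n) = 1" using \<open>q ^ n > 1\<close> by (auto simp: p_def)
  then have "p \<noteq> 0" by force
  then have "finite {x. poly p x = 0}" by (rule poly_roots_finite)
  moreover have "K n = {x. poly p x = 0}" by (auto simp: K_def p_def poly_monom)
  ultimately show ?thesis by simp
qed

lemma size_orbit [simp]: "size (orbit n x) = n"
  by (simp add: orbit_def)

lemma orbit_0 [simp]: "orbit 0 x = {#}"
  by (simp add: orbit_def)

lemma orbit_Suc: "orbit (Suc n) x = add_mset (x ^ (q ^ n)) (orbit n x)"
  by (simp add: orbit_def lessThan_Suc)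

lemma frob_orbit: "add_mset x (image_mset fr (orbit n x)) = add_mset (x ^ (q ^ n)) (orbit n x)"
  by (induction n) (auto simp: orbit_Suc pow_Suc_frob(1) simp del: power_Suc
      simp: add_mset_commute)

lemma orbit_stable: "x \<in> K n \<Longrightarrow> image_mset fr (orbit n x) = orbit n x"
  using frob_orbit[of x n] by (simp add: K_def)

lemma orbit_in_M: "x \<in> K n \<Longrightarrow> orbit n x \<in> M n"
  by (simp add: M_def orbit_stable)

lemma orbit_add: "orbit (m + n) x = orbit m x + orbit n (x ^ (q ^ m))"
  by (induction n) (simp_all add: orbit_Suc pow_pow_add)

lemma orbit_mult: "x \<in> K p \<Longrightarrow> orbit (e * p) x = repeat_mset e (orbit p x)"
  by (induction e) (simp_all add: orbit_add K_def)

lemma x_in_orbit: "n \<ge> 1 \<Longrightarrow> x \<in># orbit n x"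
  by (auto simp: orbit_def intro!: image_eqI[of _ _ 0])

lemma count_image_inj_frob: "count (image_mset fr A) (fr x) = count A x"
  by (induction A) (auto dest: frob_inj)

lemma stable_count: "image_mset fr A = A \<Longrightarrow> count A (fr x) = count A x"
  using count_image_inj_frob[of A x] by simp

lemma stable_count_pow: "image_mset fr A = A \<Longrightarrow> count A (x ^ (q ^ n)) = count A x"
  by (induction n) (simp_all add: pow_Suc_frob(1) stable_count del: power_Suc)

text \<open>
  The images of \<open>x\<close> under the iterates of Frobenius stay in the finite set of elements of
  \<open>A\<close>, so two of them agree.
\<close>

lemma stable_periodic:
  assumes "image_mset fr A = A" "x \<in># A"
  obtains p where "0 < p" "p \<le> size A" "x \<in> K p"
proof -
  have "(\<lambda>i. x ^ (q ^ i)) ` {..size A} \<subseteq> set_mset A"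
    using stable_count_pow[OF assms(1), of x] assms(2)
    by (auto simp flip: count_greater_zero_iff)
  then have "card ((\<lambda>i. x ^ (q ^ i)) ` {..size A}) \<le> size A"
    using card_mono[OF finite_set_mset] card_set_mset_le_size by (meson le_trans)
  then have "\<not> inj_on (\<lambda>i. x ^ (q ^ i)) {..size A}"
    by (auto dest: card_image)
  then obtain i j where ij: "i < j" "j \<le> size A" "x ^ (q ^ i) = x ^ (q ^ j)"
    unfolding inj_on_def by (metis atMost_iff linorder_neqE_nat)
  have "(x ^ (q ^ (j - i))) ^ (q ^ i) = x ^ (q ^ i)"
    unfolding pow_pow_add using ij by simp
  then have "x \<in> K (j - i)" unfolding K_def using frob_pow_inj by blast
  then show ?thesis using that[of "j - i"] ij by simp
qed

lemma finite_M: "finite (M n)"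
proof -
  let ?S = "\<Union>p\<in>{1..n}. K p"
  have "finite (multisets_of_size ?S n)"
    by (rule finite_multisets_of_size) (auto intro: finite_K)
  then have "finite {A. set_mset A \<subseteq> ?S \<and> size A = n}"
    by (simp add: multisets_of_size_def)
  moreover have "M n \<subseteq> {A. set_mset A \<subseteq> ?S \<and> size A = n}"
  proof (clarsimp simp: M_def)
    fix A x assume "image_mset fr A = A" "x \<in># A"
    then show "\<exists>p\<in>{Suc 0..size A}. x \<in> K p"
      using stable_periodic by (metis Suc_leI atLeastAtMost_iff)
  qed
  ultimately show ?thesis by (rule rev_finite_subset)
qed

lemma M_0: "M 0 = {{#}}"
  by (auto simp: M_def)

lemma K_iff_dvd:
  assumes p: "0 < p" "x \<in> K p" "\<And>m. 0 < m \<Longrightarrow> x \<in> K m \<Longrightarrow> p \<le> m"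
  shows "x \<in> K m \<longleftrightarrow> p dvd m"
proof -
  have mult: "x ^ (q ^ (p * e)) = x" for e
  proof (induction e)
    case (Suc e)
    then show ?case using p(2) by (simp add: K_def flip: pow_pow_add)
  qed simp
  have "x ^ (q ^ m) = (x ^ (q ^ (p * (m div p)))) ^ (q ^ (m mod p))"
    unfolding pow_pow_add by simp
  then have "x ^ (q ^ m) = x ^ (q ^ (m mod p))" unfolding mult .
  then have "x \<in> K m \<longleftrightarrow> x \<in> K (m mod p)" by (simp add: K_def)
  also have "\<dots> \<longleftrightarrow> m mod p = 0"
    using p(3)[of "m mod p"] mod_less_divisor[OF p(1), of m]
    by (cases "m mod p = 0") (auto simp: K_def)
  finally show ?thesis by auto
qed

text \<open>
  Let \<open>p\<close> be the exact period of \<open>x\<close>. The lengths \<open>n\<close> with \<open>x \<in> K n\<close> are the multiples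
  \<open>e * p\<close>, and then \<open>orbit n x\<close> is \<open>e\<close> copies of the set of conjugates of \<open>x\<close>. All the
  conjugates have the same multiplicity in \<open>A\<close>, so \<open>orbit n x\<close> is contained in \<open>A\<close> iff \<open>e\<close>
  is at most this multiplicity.
\<close>

lemma card_orbits_at:
  assumes A: "image_mset fr A = A" and x: "x \<in># A"
  shows "card {n \<in> {1..size A}. x \<in> K n \<and> orbit n x \<subseteq># A} = count A x"
proof -
  define p where "p = (LEAST p. 0 < p \<and> x \<in> K p)"
  have ex: "\<exists>p. 0 < p \<and> x \<in> K p" using stable_periodic[OF A x] by metis
  have p: "0 < p" "x \<in> K p" and least: "\<And>m. 0 < m \<Longrightarrow> x \<in> K m \<Longrightarrow> p \<le> m"
    unfolding p_def using LeastI_ex[OF ex] by (auto intro: Least_le)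
  note dvd = K_iff_dvd[OF p least]
  have inj: "inj_on (\<lambda>i. x ^ (q ^ i)) {..<p}"
  proof (rule linorder_inj_onI')
    fix i j assume ij: "i \<in> {..<p}" "j \<in> {..<p}" "i < j"
    show "x ^ (q ^ i) \<noteq> x ^ (q ^ j)"
    proof
      assume "x ^ (q ^ i) = x ^ (q ^ j)"
      then have "(x ^ (q ^ (j - i))) ^ (q ^ i) = x ^ (q ^ i)"
        unfolding pow_pow_add using ij by simp
      then have "x \<in> K (j - i)" unfolding K_def using frob_pow_inj by blast
      then show False using least[of "j - i"] ij by simp
    qed
  qed
  have orb: "orbit p x = mset_set ((\<lambda>i. x ^ (q ^ i)) ` {..<p})"
    unfolding orbit_def using inj by (rule image_mset_mset_set)
  have sub: "orbit (e * p) x \<subseteq># A \<longleftrightarrow> e \<le> count A x" for e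
  proof
    assume "orbit (e * p) x \<subseteq># A"
    then have "count (orbit (e * p) x) x \<le> count A x" by (rule mset_subset_eq_count)
    moreover have "count (orbit p x) x = 1"
      using x_in_orbit[of p x] p(1) unfolding orb by (auto simp: count_mset_set')
    ultimately show "e \<le> count A x"
      using orbit_mult[OF p(2)] by simp
  next
    assume e: "e \<le> count A x"
    have "count (orbit p x) y * e \<le> count A y" for y
    proof (cases "y \<in> (\<lambda>i. x ^ (q ^ i)) ` {..<p}")
      case True
      then obtain i where "y = x ^ (q ^ i)" by auto
      then show ?thesis using e True stable_count_pow[OF A, of x] unfolding orb by simp
    next
      case False
      then show ?thesis unfolding orb by simp
    qed
    then show "orbit (e * p) x \<subseteq># A"
      unfolding orbit_mult[OF p(2)] by (intro mset_subset_eqI) (simp add: mult.commute)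
  qed
  have "{n \<in> {1..size A}. x \<in> K n \<and> orbit n x \<subseteq># A} = (\<lambda>e. e * p) ` {1..count A x}"
  proof (intro equalityI subsetI)
    fix n assume n: "n \<in> {n \<in> {1..size A}. x \<in> K n \<and> orbit n x \<subseteq># A}"
    then obtain e where e: "n = e * p" using dvd by (metis (lifting) dvd_def mem_Collect_eq mult.commute)
    moreover have "e \<noteq> 0" using n e by auto
    ultimately show "n \<in> (\<lambda>e. e * p) ` {1..count A x}" using n sub by auto
  next
    fix n assume "n \<in> (\<lambda>e. e * p) ` {1..count A x}"
    then obtain e where e: "n = e * p" and "e \<in> {1..count A x}" by (rule imageE)
    then have e: "n = e * p" "1 \<le> e" "e \<le> count A x" by simp_all
    then have "orbit n x \<subseteq># A" using sub by simp
    moreover from this have "n \<le> size A" using size_mset_mono by fastforce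
    ultimately show "n \<in> {n \<in> {1..size A}. x \<in> K n \<and> orbit n x \<subseteq># A}"
      using e p(1) dvd by auto
  qed
  moreover have "inj_on (\<lambda>e. e * p) {1..count A x}" using p(1) by (auto simp: inj_on_def)
  ultimately show ?thesis by (simp add: card_image)
qed

lemma size_eq_card_orbits:
  assumes A: "A \<in> M n"
  shows "(\<Sum>k=1..n. card {x \<in> K k. orbit k x \<subseteq># A}) = n"
proof -
  have st: "image_mset fr A = A" "size A = n" using A by (auto simp: M_def)
  have "(\<Sum>k=1..n. card {x \<in> K k. orbit k x \<subseteq># A}) =
      (\<Sum>k=1..n. \<Sum>x\<in>set_mset A. if x \<in> K k \<and> orbit k x \<subseteq># A then 1 else 0)"
  proof (intro sum.cong refl)
    fix k assume "k \<in> {1..n}"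
    then have "{x \<in> K k. orbit k x \<subseteq># A} = {x \<in> set_mset A. x \<in> K k \<and> orbit k x \<subseteq># A}"
      using x_in_orbit[of k] by (auto dest: mset_subset_eqD)
    then show "card {x \<in> K k. orbit k x \<subseteq># A} =
        (\<Sum>x\<in>set_mset A. if x \<in> K k \<and> orbit k x \<subseteq># A then 1 else 0)"
      by (simp add: sum.If_cases Int_def)
  qed
  also have "\<dots> = (\<Sum>x\<in>set_mset A. card {k \<in> {1..n}. x \<in> K k \<and> orbit k x \<subseteq># A})"
    by (subst sum.swap) (simp add: sum.If_cases Int_def)
  also have "\<dots> = (\<Sum>x\<in>set_mset A. count A x)"
    using card_orbits_at[OF st(1)] st(2) by (intro sum.cong refl) auto
  also have "\<dots> = n" using st(2) by (simp add: size_multiset_overloaded_eq)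
  finally show ?thesis .
qed

lemma M_add: "A \<in> M m \<Longrightarrow> B \<in> M n \<Longrightarrow> A + B \<in> M (m + n)"
  by (auto simp: M_def)

lemma M_diff: "C \<in> M (m + n) \<Longrightarrow> A \<in> M m \<Longrightarrow> A \<subseteq># C \<Longrightarrow> C - A \<in> M n"
  by (auto simp: M_def image_mset_Diff size_Diff_submset)

text \<open>
  The logarithmic derivative of the L-series with coefficients \<open>\<Sum>A\<in>M n. \<Lambda> A\<close>, in the form of
  a recursion. It expresses the Euler product without naming primes: \<open>n\<close> is the number of
  pairs \<open>(k, x)\<close> such that \<open>orbit k x\<close> is contained in \<open>A \<in> M n\<close>, one may sum over the orbit
  first, and removing the orbit \<open>orbit k x\<close> from \<open>A\<close> leaves an arbitrary member of
  \<open>M (n - k)\<close>.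
\<close>

theorem log_derivative_recursion:
  fixes \<Lambda> :: "'c multiset \<Rightarrow> complex"
  assumes mult: "\<And>m n A B. A \<in> M m \<Longrightarrow> B \<in> M n \<Longrightarrow> \<Lambda> (A + B) = \<Lambda> A * \<Lambda> B"
  shows "of_nat n * (\<Sum>A\<in>M n. \<Lambda> A) =
    (\<Sum>k=1..n. (\<Sum>x\<in>K k. \<Lambda> (orbit k x)) * (\<Sum>A\<in>M (n - k). \<Lambda> A))"
proof -
  have "of_nat n * (\<Sum>A\<in>M n. \<Lambda> A) =
      (\<Sum>A\<in>M n. \<Sum>k=1..n. \<Sum>x\<in>K k. if orbit k x \<subseteq># A then \<Lambda> A else 0)"
    unfolding sum_distrib_left
  proof (intro sum.cong refl)
    fix A assume A: "A \<in> M n"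
    have "of_nat n * \<Lambda> A = (\<Sum>k=1..n. of_nat (card {x \<in> K k. orbit k x \<subseteq># A}) * \<Lambda> A)"
      by (subst size_eq_card_orbits[OF A, symmetric]) (simp only: of_nat_sum sum_distrib_right)
    also have "\<dots> = (\<Sum>k=1..n. \<Sum>x\<in>K k. if orbit k x \<subseteq># A then \<Lambda> A else 0)"
    proof (intro sum.cong refl)
      fix k assume "k \<in> {1..n}"
      then have "finite (K k)" by (intro finite_K) simp
      then have "(\<Sum>x\<in>K k. if orbit k x \<subseteq># A then \<Lambda> A else 0) = (\<Sum>x | x \<in> K k \<and> orbit k x \<subseteq># A. \<Lambda> A)"
        by (rule sum.inter_filter[symmetric])
      then show "of_nat (card {x \<in> K k. orbit k x \<subseteq># A}) * \<Lambda> A =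
          (\<Sum>x\<in>K k. if orbit k x \<subseteq># A then \<Lambda> A else 0)" by simp
    qed
    finally show "of_nat n * \<Lambda> A = (\<Sum>k=1..n. \<Sum>x\<in>K k. if orbit k x \<subseteq># A then \<Lambda> A else 0)" .
  qed
  also have "\<dots> = (\<Sum>k=1..n. \<Sum>A\<in>M n. \<Sum>x\<in>K k. if orbit k x \<subseteq># A then \<Lambda> A else 0)"
    by (rule sum.swap)
  also have "\<dots> = (\<Sum>k=1..n. \<Sum>x\<in>K k. \<Sum>A\<in>M n. if orbit k x \<subseteq># A then \<Lambda> A else 0)"
    by (rule sum.cong[OF refl], rule sum.swap)
  also have "\<dots> = (\<Sum>k=1..n. (\<Sum>x\<in>K k. \<Lambda> (orbit k x)) * (\<Sum>A\<in>M (n - k). \<Lambda> A))"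
    unfolding sum_distrib_right
  proof (intro sum.cong refl)
    fix k x assume k: "k \<in> {1..n}" and x: "x \<in> K k"
    have kn: "k + (n - k) = n" using k by simp
    have o: "orbit k x \<in> M k" by (rule orbit_in_M[OF x])
    have bij: "bij_betw (\<lambda>B. orbit k x + B) (M (n - k)) {A \<in> M n. orbit k x \<subseteq># A}"
      by (rule bij_betw_byWitness[where f' = "\<lambda>A. A - orbit k x"])
         (use M_add[OF o, of _ "n - k"] M_diff[of _ k "n - k", OF _ o] kn in auto)
    have "(\<Sum>A\<in>M n. if orbit k x \<subseteq># A then \<Lambda> A else 0) = (\<Sum>A | A \<in> M n \<and> orbit k x \<subseteq># A. \<Lambda> A)"
      by (rule sum.inter_filter[symmetric]) (rule finite_M)
    also have "\<dots> = (\<Sum>B\<in>M (n - k). \<Lambda> (orbit k x + B))"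
      using sum.reindex_bij_betw[OF bij, of \<Lambda>] by simp
    also have "\<dots> = \<Lambda> (orbit k x) * (\<Sum>A\<in>M (n - k). \<Lambda> A)"
      using mult[OF o] by (simp add: sum_distrib_left)
    finally show "(\<Sum>A\<in>M n. if orbit k x \<subseteq># A then \<Lambda> A else 0) =
        \<Lambda> (orbit k x) * (\<Sum>A\<in>M (n - k). \<Lambda> A)" .
  qed
  finally show ?thesis .
qed

section \<open>Monic polynomials over the fixed field\<close>

definition monic_polys :: "nat \<Rightarrow> 'c poly set" where
  "monic_polys n = {f. degree f = n \<and> lead_coeff f = 1 \<and> (\<forall>i. coeff f i \<in> K 1)}"

text \<open>
  Frobenius acts on the coefficients of a polynomial as it does on its roots.
\<close>

lemma sesym_frob: "sesym (image_mset fr A) k = fr (sesym A k)"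
proof (induction A arbitrary: k)
  case empty
  then show ?case using q_ge2 by (simp add: sesym_def coeff_1)
next
  case (add x A)
  then show ?case
    by (cases k) (simp_all add: sesym_add_Suc frob_diff power_mult_distrib)
qed

lemma linear_prod:
  fixes A :: "'c multiset"
  shows "degree (\<Prod>x\<in>#A. [:- x, 1:]) = size A" "lead_coeff (\<Prod>x\<in>#A. [:- x, 1:]) = 1"
    "proots (\<Prod>x\<in>#A. [:- x, 1:]) = A"
proof -
  show "degree (\<Prod>x\<in>#A. [:- x, 1:]) = size A"
    by (rule degree_linear_prod)
  show "lead_coeff (\<Prod>x\<in>#A. [:- x, 1:]) = 1"
  proof (induction A)
    case (add x A)
    have "lead_coeff ([:- x, 1:] * (\<Prod>x\<in>#A. [:- x, 1:])) =
        lead_coeff [:- x, 1:] * lead_coeff (\<Prod>x\<in>#A. [:- x, 1:])"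
      by (rule lead_coeff_mult)
    then show ?case using add by (simp del: mult_pCons_left)
  qed simp
  show "proots (\<Prod>x\<in>#A. [:- x, 1:]) = A"
  proof (induction A)
    case (add x A)
    have "proots ([:- x, 1:] * (\<Prod>x\<in>#A. [:- x, 1:])) = proots [:- x, 1:] + proots (\<Prod>x\<in>#A. [:- x, 1:])"
      by (rule proots_mult[OF _ linear_prod_nonzero]) simp
    then show ?case using add by (simp del: mult_pCons_left)
  qed simp
qed

lemma coeff_linear_prod: "k \<le> size A \<Longrightarrow> coeff (\<Prod>x\<in>#A. [:- (x::'c), 1:]) k = sesym A (size A - k)"
  using coeff_prod_linear[of "size A - k" A] by simp

lemma bij_linear_prod: "bij_betw (\<lambda>A. \<Prod>x\<in>#A. [:- x, 1:]) (M n) (monic_polys n)"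
proof (rule bij_betw_byWitness[where f' = proots])
  let ?P = "\<lambda>A :: 'c multiset. \<Prod>x\<in>#A. [:- x, 1:]"
  show "\<forall>A\<in>M n. proots (?P A) = A" by (simp add: linear_prod)
  have fact: "?P (proots f) = f" if "f \<in> monic_polys n" for f
  proof -
    have "f \<noteq> 0" using that by (auto simp: monic_polys_def)
    then obtain A where A: "f = smult (lead_coeff f) (?P A)"
      using alg_closed_imp_factorization by blast
    have "lead_coeff f = 1" using that unfolding monic_polys_def by blast
    then have "smult (lead_coeff f) (?P A) = ?P A" by (simp only: smult_1_left)
    with A have "f = ?P A" by (rule trans)
    then show ?thesis by (simp add: linear_prod)
  qed
  then show "\<forall>f\<in>monic_polys n. ?P (proots f) = f" by blast
  show "?P ` M n \<subseteq> monic_polys n"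
  proof (intro image_subsetI)
    fix A assume A: "A \<in> M n"
    have "sesym A k \<in> K 1" for k using sesym_frob[of A k] A by (simp add: M_def K_def)
    then have le: "coeff (?P A) i \<in> K 1" if "i \<le> size A" for i
      unfolding coeff_linear_prod[OF that] .
    have gt: "coeff (?P A) i = 0" if "i > size A" for i
      using that by (intro coeff_eq_0) (simp add: linear_prod)
    have "0 \<in> K 1" by (simp add: K_def)
    then have "coeff (?P A) i \<in> K 1" for i
      using le[of i] gt[of i] by (cases "i \<le> size A") auto
    moreover have "degree (?P A) = n" using A linear_prod(1)[of A] by (simp add: M_def)
    ultimately show "?P A \<in> monic_polys n"
      unfolding monic_polys_def using linear_prod(2)[of A] by blast
  qed
  show "proots ` monic_polys n \<subseteq> M n"
  proof (intro image_subsetI)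
    fix f assume f: "f \<in> monic_polys n"
    let ?A = "proots f"
    have sz: "size ?A = n" using fact[OF f] linear_prod(1)[of ?A] f by (simp add: monic_polys_def)
    have co: "sesym ?A k \<in> K 1" for k
    proof (cases "k \<le> n")
      case True
      then have "sesym ?A k = coeff f (n - k)"
        using coeff_prod_linear[of k ?A] fact[OF f] sz by simp
      then show ?thesis using f by (simp add: monic_polys_def)
    qed (use sz in \<open>simp add: sesym_gt_size K_def\<close>)
    have "?P (image_mset fr ?A) = ?P ?A"
    proof (rule poly_eqI)
      fix i
      show "coeff (?P (image_mset fr ?A)) i = coeff (?P ?A) i"
      proof (cases "i \<le> n")
        case True
        then have i: "i \<le> size (image_mset fr ?A)" "i \<le> size ?A" using sz by simp_all
        show ?thesis
          unfolding coeff_linear_prod[OF i(1)] coeff_linear_prod[OF i(2)] sesym_frob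
          using co by (simp add: K_def)
      next
        case False
        then have "degree (?P (image_mset fr ?A)) < i" "degree (?P ?A) < i"
          unfolding linear_prod(1) using sz by simp_all
        then show ?thesis using coeff_eq_0 by metis
      qed
    qed
    then have "proots (?P (image_mset fr ?A)) = proots (?P ?A)" by (rule arg_cong)
    then have "image_mset fr ?A = ?A" unfolding linear_prod(3) .
    then show "?A \<in> M n" using sz by (simp add: M_def)
  qed
qed

end

section \<open>The Hasse--Davenport theorems\<close>

text \<open>
  A double root would also be a root of the derivative. So the linear factors of \<open>p\<close> are
  distinct.
\<close>

lemma card_roots_separable:
  fixes p :: "'c::alg_closed_field poly"
  assumes "p \<noteq> 0" and sep: "\<And>a. poly p a = 0 \<Longrightarrow> poly (pderiv p) a \<noteq> 0"
  shows "card {a. poly p a = 0} = degree p"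
proof -
  obtain A where A: "size A = degree p" "p = smult (lead_coeff p) (\<Prod>x\<in>#A. [:- x, 1:])"
    using alg_closed_imp_factorization[OF assms(1)] by blast
  have lc: "lead_coeff p \<noteq> 0" using assms(1) by simp
  have root: "poly p a = 0 \<longleftrightarrow> a \<in># A" for a
    by (subst A(2)) (use lc in \<open>auto simp: poly_prod_mset prod_mset_zero_iff image_iff\<close>)
  have "count A a \<le> 1" for a
  proof (rule ccontr)
    assume "\<not> count A a \<le> 1"
    then have "count A a \<ge> 2" by simp
    then have "{#a, a#} \<subseteq># A" by (simp add: subseteq_mset_def numeral_2_eq_2)
    then obtain B where B: "A = {#a, a#} + B" by (auto simp: mset_subset_eq_exists_conv)
    define g where "g = smult (lead_coeff p) (\<Prod>x\<in>#B. [:- x, 1:])"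
    have "p = [:- a, 1:] * ([:- a, 1:] * g)"
      unfolding g_def by (subst A(2)) (simp add: B mult_ac del: mult_pCons_left mult_pCons_right)
    then have "pderiv p = pderiv ([:- a, 1:] * ([:- a, 1:] * g))" by (rule arg_cong)
    then have "poly (pderiv p) a = 0"
      by (simp add: pderiv_mult del: mult_pCons_left mult_pCons_right)
    moreover have "poly p a = 0" using root B by simp
    ultimately show False using sep by blast
  qed
  then have "A = mset_set (set_mset A)"
    by (intro multiset_eqI) (metis Suc_le_eq count_eq_zero_iff count_greater_eq_one_iff
      count_mset_set(1) count_mset_set(3) finite_set_mset le_antisym One_nat_def)
  then have "size A = card (set_mset A)" by (metis size_mset_set)
  moreover have "{a. poly p a = 0} = set_mset A" using root by blast
  ultimately show ?thesis using A(1) by simp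
qed

lemma card_nth_roots:
  fixes x :: "'c::alg_closed_field"
  assumes "x \<noteq> 0" "d > 0" "of_nat d \<noteq> (0 :: 'c)"
  shows "card {y. y ^ d = x} = d"
proof -
  let ?p = "monom 1 d - [:x:]"
  have deg: "degree ?p = d"
    unfolding diff_conv_add_uminus
    using degree_add_eq_left[of "- [:x:]" "monom 1 d"] assms(2) by (simp add: degree_monom_eq del: minus_pCons)
  have "card {y. poly ?p y = 0} = degree ?p"
  proof (rule card_roots_separable)
    show "?p \<noteq> 0" using deg assms(2) by auto
    fix a assume "poly ?p a = 0"
    then have "a ^ d = x" by (simp add: poly_monom)
    then have "a \<noteq> 0" using assms by auto
    then show "poly (pderiv ?p) a \<noteq> 0" using assms(3)
      by (simp add: pderiv_diff pderiv_monom pderiv_pCons poly_monom)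
  qed
  then show ?thesis using deg by (simp add: poly_monom)
qed

locale hasse_davenport = frobenius_power q dummy + gauss_setup k \<psi>
  for q :: nat and dummy :: "'c::alg_closed_field itself" and k :: "'c set" and \<psi> +
  assumes k_eq: "k = K 1"
begin

lemma in_k_iff: "x \<in> k \<longleftrightarrow> fr x = x"
  by (simp add: k_eq K_def)

lemma frob_prod_mset: "fr (prod_mset A) = prod_mset (image_mset fr A)"
  by (induction A) (simp_all add: power_mult_distrib)

lemma frob_psum: "fr (psum A m) = psum (image_mset fr A) m"
  by (induction A) (simp_all add: psum_def frob_add power_mult_distrib flip: power_mult,
      simp_all add: mult.commute)

lemma prod_mset_in_k: "A \<in> M n \<Longrightarrow> prod_mset A \<in> k"
  by (simp add: in_k_iff frob_prod_mset M_def)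

lemma psum_in_k: "A \<in> M n \<Longrightarrow> psum A m \<in> k"
  by (simp add: in_k_iff frob_psum M_def)

lemma sum_mset_in_k: "A \<in> M n \<Longrightarrow> sum_mset A \<in> k"
  using psum_in_k[of A n 1] by (simp add: psum_def)

definition norm :: "nat \<Rightarrow> 'c \<Rightarrow> 'c" where "norm n x = (\<Prod>i<n. x ^ (q ^ i))"
definition trace :: "nat \<Rightarrow> 'c \<Rightarrow> 'c" where "trace n x = (\<Sum>i<n. x ^ (q ^ i))"

lemma prod_orbit: "prod_mset (orbit n x) = norm n x"
  by (simp add: orbit_def norm_def prod_unfold_prod_mset)

lemma sum_orbit: "sum_mset (orbit n x) = trace n x"
  by (simp add: orbit_def trace_def sum_unfold_sum_mset)

lemma norm_in_k: "x \<in> K n \<Longrightarrow> norm n x \<in> k"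
  using prod_mset_in_k[OF orbit_in_M] by (simp add: prod_orbit)

lemma trace_in_k: "x \<in> K n \<Longrightarrow> trace n x \<in> k"
  using sum_mset_in_k[OF orbit_in_M] by (simp add: sum_orbit)

lemma norm_eq_0_iff: "n \<ge> 1 \<Longrightarrow> norm n x = 0 \<longleftrightarrow> x = 0"
  using q_ge2 by (auto simp: norm_def intro!: exI[of _ 0])

lemma norm_power: "norm n (x ^ m) = norm n x ^ m"
  by (simp add: norm_def prod_power_distrib mult.commute flip: power_mult)

lemma geometric_sum: "(\<Sum>i<n. q ^ i) * (q - 1) = q ^ n - 1"
  by (rule geometric_sum_mult) (use q_ge2 in simp)

lemma sum_M_0:
  assumes "\<Lambda> {#} = 1" shows "(\<Sum>A\<in>M 0. \<Lambda> A) = (1 :: complex)"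
  using assms by (simp add: M_0)

text \<open>
  In terms of polynomials the summand depends only on the constant coefficient and on the
  coefficient of degree \<open>n - 1\<close>. For \<open>n \<ge> 2\<close> these are different coefficients, and
  translating the latter by \<open>- c\<close> multiplies the sum by \<open>\<psi> c\<close>, where \<open>c\<close> can be chosen with
  \<open>\<psi> c \<noteq> 1\<close>.
\<close>

lemma sum_M_gauss_eq_0:
  assumes \<eta>: "\<eta> \<in> mult_chars k" and n: "n \<ge> 2"
  shows "(\<Sum>A\<in>M n. \<eta> (prod_mset A) * \<psi> (sum_mset A)) = 0"
proof -
  define F where "F f = \<eta> ((-1) ^ n * coeff f 0) * \<psi> (- coeff f (n - 1))" for f :: "'c poly"
  have val: "\<eta> (prod_mset A) * \<psi> (sum_mset A) = F (\<Prod>x\<in>#A. [:- x, 1:])" if "A \<in> M n" for A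
  proof -
    have sz: "size A = n" using that by (simp add: M_def)
    have "coeff (\<Prod>x\<in>#A. [:- x, 1:]) 0 = (-1) ^ n * prod_mset A"
      using coeff_linear_prod[of 0 A] sesym_size[of A] sz by simp
    moreover have "(-1) ^ n * ((-1) ^ n * prod_mset A) = prod_mset A"
      by (simp flip: mult.assoc power_add mult_2)
    moreover have "coeff (\<Prod>x\<in>#A. [:- x, 1:]) (n - 1) = - sum_mset A"
      using coeff_linear_prod[of "n - 1" A] newton[of 1 A] sz n by (simp add: psum_def)
    ultimately show ?thesis by (simp add: F_def)
  qed
  have "(\<Sum>A\<in>M n. \<eta> (prod_mset A) * \<psi> (sum_mset A)) = (\<Sum>A\<in>M n. F (\<Prod>x\<in>#A. [:- x, 1:]))"
    using val by (rule sum.cong[OF refl])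
  also have "\<dots> = (\<Sum>f\<in>monic_polys n. F f)"
    by (rule sum.reindex_bij_betw[OF bij_linear_prod])
  also have "\<dots> = 0"
  proof -
    obtain c where c: "c \<in> k" "\<psi> c \<noteq> 1"
      using add_char by (auto simp: nontrivial_add_char_def)
    have shift: "f + monom a (n - 1) \<in> monic_polys n" if "f \<in> monic_polys n" "a \<in> k" for f a
    proof -
      have deg: "degree (f + monom a (n - 1)) = n"
        using that n degree_monom_le[of a "n - 1"]
        by (subst degree_add_eq_left) (auto simp: monic_polys_def intro: le_less_trans)
      moreover have "lead_coeff (f + monom a (n - 1)) = 1"
        unfolding deg using that n by (auto simp: monic_polys_def)
      moreover have "coeff (f + monom a (n - 1)) i \<in> K 1" for i
        using that add_in[of "coeff f i" a] unfolding monic_polys_def k_eq[symmetric] by auto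
      ultimately show ?thesis unfolding monic_polys_def by blast
    qed
    have bij: "bij_betw (\<lambda>f. f + monom (- c) (n - 1)) (monic_polys n) (monic_polys n)"
      by (rule bij_betw_byWitness[where f' = "\<lambda>f. f + monom c (n - 1)"])
         (use shift c uminus_in in \<open>auto simp: add.assoc simp flip: add_monom\<close>,
          simp_all add: add.assoc add_monom)
    have "(\<Sum>f\<in>monic_polys n. F f) = (\<Sum>f\<in>monic_polys n. F (f + monom (- c) (n - 1)))"
      by (rule sum.reindex_bij_betw[OF bij, symmetric])
    also have "\<dots> = \<psi> c * (\<Sum>f\<in>monic_polys n. F f)"
      unfolding sum_distrib_left
    proof (intro sum.cong refl)
      fix f assume "f \<in> monic_polys n"
      then have "- coeff f (n - 1) \<in> k" unfolding monic_polys_def k_eq[symmetric] by (simp add: uminus_in)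
      then have "\<psi> (c + (- coeff f (n - 1))) = \<psi> c * \<psi> (- coeff f (n - 1))"
        using c(1) by (rule psi_add[rotated])
      then show "F (f + monom (- c) (n - 1)) = \<psi> c * F f"
        using n by (simp add: F_def)
    qed
    finally show ?thesis using c(2) by simp
  qed
  finally show ?thesis .
qed

text \<open>
  The L-series of \<open>\<Lambda> A = \<eta> (\<Prod>A) * \<psi> (\<Sum>A)\<close> is the linear polynomial \<open>1 + gsum \<eta> * T\<close>. So the
  recursion for the logarithmic derivative has only two terms from degree \<open>2\<close> on and shows
  that each sum is \<open>- gsum \<eta>\<close> times the preceding one.
\<close>

theorem hasse_davenport_lifting:
  assumes \<eta>: "\<eta> \<in> mult_chars k" and n: "n \<ge> 1"
  shows "(\<Sum>x\<in>K n. \<eta> (norm n x) * \<psi> (trace n x)) = (-1) ^ (n - 1) * gsum \<eta> ^ n"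
  using n
proof (induction n rule: nat_induct_at_least)
  define \<Lambda> where "\<Lambda> A = \<eta> (prod_mset A) * \<psi> (sum_mset A)" for A
  define T where "T k = (\<Sum>x\<in>K k. \<Lambda> (orbit k x))" for k
  define S where "S n = (\<Sum>A\<in>M n. \<Lambda> A)" for n
  have T: "(\<Sum>x\<in>K n. \<eta> (norm n x) * \<psi> (trace n x)) = T n" for n
    by (simp add: T_def \<Lambda>_def prod_orbit sum_orbit)
  have rec: "of_nat n * S n = (\<Sum>k=1..n. T k * S (n - k))" for n
    unfolding S_def T_def
    by (rule log_derivative_recursion)
       (simp add: \<Lambda>_def psi_add char_mult[OF \<eta>] prod_mset_in_k sum_mset_in_k)
  have S0: "S 0 = 1" unfolding S_def by (rule sum_M_0) (simp add: \<Lambda>_def char_one[OF \<eta>])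
  have S2: "S n = 0" if "n \<ge> 2" for n
    unfolding S_def \<Lambda>_def by (rule sum_M_gauss_eq_0[OF \<eta> that])
  have T1: "T 1 = gsum \<eta>"
    using sum_U[of "\<lambda>x. \<eta> x * \<psi> x"] char_zero[OF \<eta>, of 0]
    by (simp add: gsum_def T_def \<Lambda>_def orbit_Suc flip: k_eq[simplified])
  {
    case base
    show ?case using T[of 1] T1 by simp
  next
    case (Suc n)
    have "0 = (\<Sum>k=1..Suc n. T k * S (Suc n - k))"
      using rec[of "Suc n"] S2[of "Suc n"] Suc.hyps by simp
    also have "\<dots> = (\<Sum>k\<in>{n, Suc n}. T k * S (Suc n - k))"
      using Suc.hyps S2 by (intro sum.mono_neutral_right) auto
    also have "\<dots> = T n * T 1 + T (Suc n)"
      using S0 rec[of 1] by simp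
    finally have "T (Suc n) = - (T n * T 1)" by (simp add: eq_neg_iff_add_eq_0 add.commute)
    then show ?case using Suc T T1 by (cases n) simp_all
  }
qed

text \<open>
  Both sides are \<open>d\<close> or \<open>0\<close> according to whether \<open>x ^ ((q ^ n - 1) div d)\<close> equals \<open>1\<close>: this
  power decides whether the \<open>d\<close>th roots of \<open>x\<close> lie in \<open>K n\<close>, and it equals
  \<open>norm n x ^ ((q - 1) div d)\<close>, which decides whether \<open>\<theta> (norm n x) = 1\<close>.
\<close>

lemma card_roots_in_K:
  assumes \<theta>: "\<theta> \<in> mult_chars k" and d: "d > 0" "d dvd q - 1" "of_nat d \<noteq> (0 :: 'c)"
    and \<theta>d: "\<And>u. u \<in> U \<Longrightarrow> \<theta> u ^ d = 1"
    and \<theta>1: "\<And>u. u \<in> U \<Longrightarrow> \<theta> u = 1 \<Longrightarrow> u ^ ((q - 1) div d) = 1"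
    and n: "n \<ge> 1" and x: "x \<in> K n" "x \<noteq> 0"
  shows "of_nat (card {y \<in> K n. y ^ d = x}) = (\<Sum>j<d. \<theta> (norm n x) ^ j)"
proof -
  define m where "m = (q ^ n - 1) div d"
  have dvd: "q - 1 dvd q ^ n - 1" by (metis dvd_triv_right geometric_sum)
  have md: "d * m = q ^ n - 1" using dvd d(2) unfolding m_def by (metis dvd_mult_div_cancel dvd_trans)
  have qn: "q ^ n \<ge> 1" using q_ge2 by simp
  have K_iff: "y \<in> K n \<longleftrightarrow> y ^ (d * m) = 1" if "y \<noteq> 0" for y
  proof -
    have "y ^ (q ^ n) = y ^ (q ^ n - 1) * y" using qn
      by (metis One_nat_def Suc_pred less_eq_Suc_le power_Suc2)
    then show ?thesis using that by (simp add: K_def md)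
  qed
  have U: "norm n x \<in> U" using norm_in_k[OF x(1)] norm_eq_0_iff[OF n, of x] x(2) by simp
  have pow: "norm n x ^ ((q - 1) div d) = x ^ m"
  proof -
    obtain e where e: "q - 1 = d * e" using d(2) by (auto simp: dvd_def)
    obtain l where l: "q ^ n - 1 = (q - 1) * l" using dvd by (auto simp: dvd_def)
    have q0: "q - 1 > 0" using q_ge2 by simp
    have "norm n x = x ^ l"
    proof -
      have "(\<Sum>i<n. q ^ i) = l" using geometric_sum[of n] l q0 by (simp add: mult.commute)
      then show ?thesis unfolding norm_def by (simp flip: power_sum)
    qed
    moreover have "m = e * l" "(q - 1) div d = e" using e l d(1) by (simp_all add: m_def)
    ultimately show ?thesis by (simp add: mult.commute flip: power_mult)
  qed
  show ?thesis
  proof (cases "x ^ m = 1")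
    case True
    have "\<theta> (norm n x) = 1"
    proof -
      obtain y where y: "y ^ d = norm n x" using nth_root_exists[OF d(1)] by blast
      have y0: "y \<noteq> 0" using y U d(1) by (auto simp: zero_power)
      have "y ^ (q - 1) = (y ^ d) ^ ((q - 1) div d)" using d(2) by (simp flip: power_mult)
      then have "y ^ (q - 1) = 1" using y pow True by simp
      then have "fr y = y" using q_ge2 by (metis One_nat_def Suc_pred gr0I le_zero_eq
          mult_1 numeral_2_eq_2 power_Suc2 nat.distinct(1))
      then have "y \<in> U" using y0 by (simp add: in_k_iff)
      then show ?thesis using \<theta>d[of y] char_power[OF \<theta>, of y d] y by simp
    qed
    moreover have "{y \<in> K n. y ^ d = x} = {y. y ^ d = x}"
    proof -
      have "y \<in> K n" if "y ^ d = x" for y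
        using K_iff[of y] that x(2) d(1) True by (auto simp: power_mult)
      then show ?thesis by blast
    qed
    ultimately show ?thesis using card_nth_roots[OF x(2) d(1,3)] by simp
  next
    case False
    then have ne: "\<theta> (norm n x) \<noteq> 1" using \<theta>1[OF U] pow by auto
    have "{y \<in> K n. y ^ d = x} = {}"
      using K_iff False x(2) d(1) by (auto simp: power_mult)
    moreover have "(\<Sum>j<d. \<theta> (norm n x) ^ j) = 0"
      using sum_gp_strict[of "\<theta> (norm n x)" d] ne \<theta>d[OF U] by simp
    ultimately show ?thesis by (simp only: card.empty of_nat_0)
  qed
qed

lemma proots_in_M: "f \<in> monic_polys n \<Longrightarrow> proots f \<in> M n"
  using bij_linear_prod[of n] unfolding bij_betw_def by (metis (no_types, lifting) imageE linear_prod(3))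

lemma sesym_proots:
  assumes "f \<in> monic_polys n" "i \<le> n"
  shows "sesym (proots f) i = coeff f (n - i)"
proof -
  obtain A where A: "A \<in> M n" "f = (\<Prod>x\<in>#A. [:- x, 1:])"
    using assms(1) bij_linear_prod[of n] by (auto simp: bij_betw_def)
  then show ?thesis
    using coeff_prod_linear[of i A] assms(2) unfolding A(2) linear_prod(3) by (simp add: M_def)
qed

text \<open>
  Consider the L-series of \<open>\<Lambda> A = \<nu> ((\<Prod>A) ^ d) * \<psi> (\<Sum>x\<in>#A. x ^ d)\<close>, the pull-back of a Gauss
  sum along the covering \<open>y \<mapsto> y ^ d\<close> of the line, and compute its coefficient of degree \<open>d\<close>
  in two ways.

  Counting the \<open>d\<close>th roots of \<open>x\<close> by the powers of \<open>\<theta>\<close> shows that the logarithmic derivative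
  is the sum of those for the characters \<open>\<theta> ^ j * \<nu>\<close>, which the lifting theorem determines.
  Hence the L-series is the product of the factors \<open>1 + gsum (\<theta> ^ j * \<nu>) * T\<close>, and its top
  coefficient is the product of the Gauss sums.

  On the other hand, the coefficient is a sum over monic polynomials of degree \<open>d\<close>. The
  power sum of degree \<open>d\<close> is \<open>- d\<close> times the constant coefficient plus a function of the
  other coefficients. So the sum over the constant coefficient is a Gauss sum of \<open>\<nu> ^ d\<close>,
  and the sum over the other coefficients is a factor \<open>C\<close> independent of \<open>\<nu>\<close>. This is the
  form that quotients of Gauss sums such as Pochhammer symbols call for.
\<close>

theorem hasse_davenport_product:
  assumes \<theta>: "\<theta> \<in> mult_chars k" and d: "d > 0" "d dvd q - 1" "of_nat d \<noteq> (0 :: 'c)"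
    and \<theta>d: "\<And>u. u \<in> U \<Longrightarrow> \<theta> u ^ d = 1"
    and \<theta>1: "\<And>u. u \<in> U \<Longrightarrow> \<theta> u = 1 \<Longrightarrow> u ^ ((q - 1) div d) = 1"
  shows "\<exists>C. \<forall>\<nu>\<in>mult_chars k. (\<Prod>j<d. gsum (char_times (char_pow \<theta> (int j)) \<nu>)) =
    C * inverse (\<nu> (of_nat d)) ^ d * gsum (char_pow \<nu> (int d))"
proof -
  define Z where "Z = {f \<in> monic_polys d. coeff f 0 = 0}"
  define C where "C = (\<Sum>h\<in>Z. \<psi> (psum (proots h) d))"
  have "(\<Prod>j<d. gsum (char_times (char_pow \<theta> (int j)) \<nu>)) =
      C * inverse (\<nu> (of_nat d)) ^ d * gsum (char_pow \<nu> (int d))" if \<nu>: "\<nu> \<in> mult_chars k" for \<nu>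
  proof -
    define G where "G j = gsum (char_times (char_pow \<theta> (int j)) \<nu>)" for j
    define \<Lambda> where "\<Lambda> A = \<nu> (prod_mset A ^ d) * \<psi> (psum A d)" for A
    define T where "T k = (\<Sum>x\<in>K k. \<Lambda> (orbit k x))" for k
    define S where "S n = (\<Sum>A\<in>M n. \<Lambda> A)" for n
    have k_power: "x ^ m \<in> k" if "x \<in> k" for x m
      using that by (induction m) (auto intro: mult_in)
    have rec: "of_nat n * S n = (\<Sum>k=1..n. T k * S (n - k))" for n
      unfolding S_def T_def
    proof (rule log_derivative_recursion)
      fix m n A B assume A: "A \<in> M m" and B: "B \<in> M n"
      have "psum (A + B) d = psum A d + psum B d" by (simp add: psum_def)
      then have "\<psi> (psum (A + B) d) = \<psi> (psum A d) * \<psi> (psum B d)"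
        using psi_add[OF psum_in_k[OF A] psum_in_k[OF B]] by simp
      moreover have "\<nu> (prod_mset (A + B) ^ d) = \<nu> (prod_mset A ^ d) * \<nu> (prod_mset B ^ d)"
        using char_mult[OF \<nu> k_power[OF prod_mset_in_k[OF A]] k_power[OF prod_mset_in_k[OF B]], of d d]
        by (simp add: power_mult_distrib)
      ultimately show "\<Lambda> (A + B) = \<Lambda> A * \<Lambda> B" by (simp add: \<Lambda>_def)
    qed
    have S0: "S 0 = 1"
      unfolding S_def by (rule sum_M_0) (simp add: \<Lambda>_def char_one[OF \<nu>] psum_def)
    have T: "T n = (\<Sum>j<d. (-1) ^ (n - 1) * G j ^ n)" if n: "n \<ge> 1" for n
    proof -
      define h where "h x = \<nu> (norm n x) * \<psi> (trace n x)" for x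
      have h0: "h 0 = 0" using norm_eq_0_iff[OF n, of 0] char_zero[OF \<nu>, of 0] by (simp add: h_def)
      have \<Lambda>_orbit: "\<Lambda> (orbit n y) = h (y ^ d)" for y
      proof -
        have "psum (orbit n y) d = trace n (y ^ d)"
          by (simp add: psum_def orbit_def trace_def sum_unfold_sum_mset image_mset.compositionality
              comp_def mult.commute flip: power_mult)
        then show ?thesis by (simp add: \<Lambda>_def h_def prod_orbit norm_power)
      qed
      have maps: "y ^ d \<in> K n" if "y \<in> K n" for y
        using that by (simp only: K_def mem_Collect_eq power_mult[symmetric] mult.commute[of d]) (simp only: power_mult)
      have "T n = (\<Sum>y\<in>K n. h (y ^ d))" by (simp add: T_def \<Lambda>_orbit)
      also have "\<dots> = (\<Sum>x\<in>K n. \<Sum>y | y \<in> K n \<and> y ^ d = x. h (y ^ d))"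
        by (rule sum.group[symmetric]) (use maps finite_K[OF n] in auto)
      also have "\<dots> = (\<Sum>x\<in>K n. \<Sum>j<d. \<theta> (norm n x) ^ j * h x)"
      proof (intro sum.cong refl)
        fix x assume x: "x \<in> K n"
        have "(\<Sum>y | y \<in> K n \<and> y ^ d = x. h (y ^ d)) = of_nat (card {y \<in> K n. y ^ d = x}) * h x"
          by (simp cong: sum.cong_simp)
        also have "\<dots> = (\<Sum>j<d. \<theta> (norm n x) ^ j) * h x"
        proof (cases "x = 0")
          case False
          show ?thesis
            using card_roots_in_K[OF \<theta> d \<theta>d \<theta>1 n x False] by (rule arg_cong[where f = "\<lambda>z. z * h x"])
        qed (simp add: h0)
        finally show "(\<Sum>y | y \<in> K n \<and> y ^ d = x. h (y ^ d)) = (\<Sum>j<d. \<theta> (norm n x) ^ j * h x)"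
          by (simp add: sum_distrib_right)
      qed
      also have "\<dots> = (\<Sum>j<d. \<Sum>x\<in>K n. \<theta> (norm n x) ^ j * h x)"
        by (rule sum.swap)
      also have "\<dots> = (\<Sum>j<d. \<Sum>x\<in>K n. char_times (char_pow \<theta> (int j)) \<nu> (norm n x) * \<psi> (trace n x))"
      proof (intro sum.cong refl)
        fix j x assume x: "x \<in> K n"
        show "\<theta> (norm n x) ^ j * h x = char_times (char_pow \<theta> (int j)) \<nu> (norm n x) * \<psi> (trace n x)"
        proof (cases "norm n x = 0")
          case True
          then show ?thesis using char_zero[OF \<nu>, of 0] by (simp add: h_def char_times_def)
        next
          case False
          then have "norm n x \<in> U" using norm_in_k[OF x] by simp
          then show ?thesis using char_pow_apply[OF \<theta>, of "norm n x" "int j"]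
            by (simp add: h_def char_times_def mult_ac)
        qed
      qed
      also have "\<dots> = (\<Sum>j<d. (-1) ^ (n - 1) * G j ^ n)"
        unfolding G_def
        by (intro sum.cong refl hasse_davenport_lifting[OF _ n] char_times_in char_pow_in \<theta> \<nu>)
      finally show ?thesis .
    qed
    have "S d = (\<Prod>j<d. G j)"
    proof -
      define A where "A = image_mset (\<lambda>j. - G j) (mset_set {..<d})"
      have p: "psum A (Suc k) = - T (Suc k)" for k
        by (simp add: psum_def A_def T image_mset.compositionality comp_def sum_unfold_sum_mset[symmetric]
            power_minus[of "G _" k] sum_negf mult_ac)
      have "S n = sesym A n" for n
      proof (induction n rule: less_induct)
        case (less n)
        show ?case
        proof (cases "n = 0")
          case False
          have "of_nat n * S n = (\<Sum>k<n. T (Suc k) * S (n - Suc k))"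
            unfolding rec by (rule sum.reindex_bij_witness[of _ Suc "\<lambda>k. k - 1"]) auto
          also have "\<dots> = (\<Sum>k<n. - (psum A (Suc k) * sesym A (n - Suc k)))"
            by (intro sum.cong refl) (simp add: p less.IH)
          also have "\<dots> = of_nat n * sesym A n" unfolding newton by (simp add: sum_negf)
          finally show ?thesis using False by simp
        qed (simp add: S0)
      qed
      moreover have "sesym A d = (-1) ^ d * prod_mset A" using sesym_size[of A] by (simp add: A_def)
      moreover have "prod_mset A = (-1) ^ d * (\<Prod>j<d. G j)"
      proof -
        have "prod_mset A = (\<Prod>j<d. - 1 * G j)" by (simp add: A_def prod_unfold_prod_mset)
        then show ?thesis by (simp only: prod.distrib prod_constant card_lessThan)
      qed
      moreover have "(-1) ^ d * ((-1) ^ d * (\<Prod>j<d. G j)) = (\<Prod>j<d. G j)"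
        by (simp flip: mult.assoc power_add mult_2)
      ultimately show ?thesis by simp
    qed
    moreover have "S d = C * inverse (\<nu> (of_nat d)) ^ d * gsum (char_pow \<nu> (int d))"
    proof -
      define F where "F f = \<nu> (((-1) ^ d * coeff f 0) ^ d) * \<psi> (psum (proots f) d)" for f :: "'c poly"
      have shift: "f + [:a:] \<in> monic_polys d" if "f \<in> monic_polys d" "a \<in> k" for f a
      proof -
        have deg: "degree (f + [:a:]) = d"
          using that d(1) by (subst degree_add_eq_left) (auto simp: monic_polys_def)
        moreover have "lead_coeff (f + [:a:]) = 1"
          unfolding deg using that d(1) by (auto simp: monic_polys_def coeff_pCons split: nat.split)
        moreover have "coeff (f + [:a:]) i \<in> K 1" for i
          using that add_in[of "coeff f i" a] unfolding monic_polys_def k_eq[symmetric]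
          by (auto simp: coeff_pCons split: nat.split)
        ultimately show ?thesis unfolding monic_polys_def by blast
      qed
      have co: "coeff f i \<in> k" if "f \<in> monic_polys d" for f i
        using that by (simp add: monic_polys_def k_eq)
      have "S d = (\<Sum>A\<in>M d. F (\<Prod>x\<in>#A. [:- x, 1:]))"
        unfolding S_def
      proof (intro sum.cong refl)
        fix A assume "A \<in> M d"
        then have sz: "size A = d" by (simp add: M_def)
        have "coeff (\<Prod>x\<in>#A. [:- x, 1:]) 0 = (-1) ^ d * prod_mset A"
          using coeff_linear_prod[of 0 A] sesym_size[of A] sz by simp
        moreover have "(-1) ^ d * ((-1) ^ d * prod_mset A) = prod_mset A"
          by (simp flip: mult.assoc power_add mult_2)
        ultimately show "\<Lambda> A = F (\<Prod>x\<in>#A. [:- x, 1:])"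
          unfolding F_def \<Lambda>_def linear_prod(3) by simp
      qed
      also have "\<dots> = (\<Sum>f\<in>monic_polys d. F f)"
        by (rule sum.reindex_bij_betw[OF bij_linear_prod])
      also have "(\<Sum>f\<in>monic_polys d. F f) = (\<Sum>(h, a)\<in>Z \<times> k. F (h + [:a:]))"
      proof (rule sum.reindex_bij_witness[of _ "\<lambda>(h, a). h + [:a:]" "\<lambda>f. (f - [:coeff f 0:], coeff f 0)"])
        fix f assume f: "f \<in> monic_polys d"
        show "(f - [:coeff f 0:], coeff f 0) \<in> Z \<times> k"
        proof -
          have eq: "f - [:coeff f 0:] = f + [:- coeff f 0:]"
            by (rule poly_eqI) (simp add: coeff_pCons split: nat.split)
          have "f - [:coeff f 0:] \<in> monic_polys d"
            unfolding eq by (rule shift[OF f uminus_in[OF co[OF f]]])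
          then show ?thesis using co[OF f] by (simp add: Z_def)
        qed
      next
        fix z assume z: "z \<in> Z \<times> k"
        then show "(\<lambda>(h, a). h + [:a:]) z \<in> monic_polys d"
          using shift by (auto simp: Z_def)
      qed (auto simp: Z_def)
      also have "\<dots> = (\<Sum>(h, a)\<in>Z \<times> k. \<psi> (psum (proots h) d) * (\<nu> (((-1) ^ d * a) ^ d) * \<psi> (- of_nat d * a)))"
      proof (intro sum.cong refl, clarify)
        fix h a assume h: "h \<in> Z" and a: "a \<in> k"
        have hm: "h \<in> monic_polys d" "coeff h 0 = 0" using h by (auto simp: Z_def)
        let ?f = "h + [:a:]"
        have fm: "?f \<in> monic_polys d" by (rule shift[OF hm(1) a])
        have "sesym (proots ?f) i = sesym (proots h) i" if "i < d" for i
          using that sesym_proots[OF fm, of i] sesym_proots[OF hm(1), of i]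
          by (simp add: coeff_pCons split: nat.split)
        then have "psum (proots ?f) d + of_nat d * sesym (proots ?f) d =
            psum (proots h) d + of_nat d * sesym (proots h) d"
          using d(1) by (rule psum_top_cong_sesym)
        then have "psum (proots ?f) d = psum (proots h) d + - of_nat d * a"
          using sesym_proots[OF fm, of d] sesym_proots[OF hm(1), of d] hm(2)
          by (simp add: eq_diff_eq[symmetric])
        moreover have "psum (proots h) d \<in> k" by (rule psum_in_k[OF proots_in_M[OF hm(1)]])
        moreover have "- of_nat d * a \<in> k" by (intro mult_in uminus_in of_nat_in a)
        ultimately have "\<psi> (psum (proots ?f) d) = \<psi> (psum (proots h) d) * \<psi> (- of_nat d * a)"
          by (simp only: psi_add)
        then show "F ?f = \<psi> (psum (proots h) d) * (\<nu> (((-1) ^ d * a) ^ d) * \<psi> (- of_nat d * a))"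
          using hm(2) by (simp add: F_def)
      qed
      also have "\<dots> = C * (\<Sum>a\<in>k. \<nu> (((-1) ^ d * a) ^ d) * \<psi> (- of_nat d * a))"
        by (simp add: C_def sum_product sum.cartesian_product)
      also have "(\<Sum>a\<in>k. \<nu> (((-1) ^ d * a) ^ d) * \<psi> (- of_nat d * a)) =
          inverse (\<nu> (of_nat d)) ^ d * gsum (char_pow \<nu> (int d))"
      proof -
        \<comment> \<open>The substitution \<open>a = t * u\<close> turns \<open>- d * a\<close> into \<open>u\<close>.
          The signs disappear because \<open>(d + 1) * d\<close> is even.\<close>
        define t where "t = - inverse (of_nat d :: 'c)"
        have dU: "of_nat d \<in> U" using d(3) of_nat_in by simp
        then have t: "t \<in> U" unfolding t_def by (intro U_uminus U_inverse)
        let ?f = "\<lambda>a. \<nu> (((-1) ^ d * a) ^ d) * \<psi> (- of_nat d * a)"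
        have "(\<Sum>a\<in>k. ?f a) = (\<Sum>a\<in>U. ?f a)"
          unfolding sum_U using char_zero[OF \<nu>, of 0] d(1) by (simp add: zero_power)
        also have "\<dots> = (\<Sum>u\<in>U. ?f (t * u))"
          by (rule sum.reindex_bij_betw[OF bij_betw_mult_U[OF t], symmetric])
        also have "\<dots> = (\<Sum>u\<in>U. inverse (\<nu> (of_nat d)) ^ d * (char_pow \<nu> (int d) u * \<psi> u))"
        proof (intro sum.cong refl)
          fix u assume u: "u \<in> U"
          have "((-1) ^ d * (-1)) ^ d = (-1 :: 'c) ^ ((d + 1) * d)"
            by (simp only: power_mult power_add power_one_right)
          also have "\<dots> = 1" by (rule uminus_power_if[THEN trans]) simp
          finally have "((-1) ^ d * (-1)) ^ d = (1 :: 'c)" .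
          moreover have "(-1) ^ d * (t * u) = ((-1) ^ d * (-1)) * (inverse (of_nat d) * u)"
            by (simp add: t_def)
          ultimately have "((-1) ^ d * (t * u)) ^ d = inverse (of_nat d) ^ d * u ^ d"
            by (simp only: power_mult_distrib) simp
          moreover have "- of_nat d * (t * u) = u" using d(3) by (simp add: t_def)
          moreover have "\<nu> (inverse (of_nat d) ^ d * u ^ d) = inverse (\<nu> (of_nat d)) ^ d * \<nu> u ^ d"
            using U_power[OF U_inverse[OF dU], of d] U_power[OF u, of d]
            by (simp add: char_mult[OF \<nu>] char_power[OF \<nu> U_inverse[OF dU]] char_power[OF \<nu> u]
                char_inverse[OF \<nu> dU])
          ultimately show "?f (t * u) = inverse (\<nu> (of_nat d)) ^ d * (char_pow \<nu> (int d) u * \<psi> u)"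
            using char_pow_apply[OF \<nu> u] by (simp add: mult.assoc)
        qed
        finally show ?thesis by (simp add: gsum_def sum_distrib_left)
      qed
      finally show ?thesis by simp
    qed
    ultimately show ?thesis by (simp add: G_def)
  qed
  then show ?thesis by blast
qed

end

section \<open>Reduced hypergeometric functions\<close>

context finite_subfield
begin

lemma char_times_eq_triv_iff:
  assumes "\<alpha> \<in> mult_chars k" "\<nu> \<in> mult_chars k"
  shows "char_times \<alpha> \<nu> = triv_char k \<longleftrightarrow> \<alpha> = char_pow \<nu> (-1)"
proof
  assume h: "char_times \<alpha> \<nu> = triv_char k"
  show "\<alpha> = char_pow \<nu> (-1)"
  proof (rule char_eqI[OF assms(1) char_pow_in[OF assms(2)]])
    fix x assume x: "x \<in> U"
    have "\<alpha> x * \<nu> x = 1" using fun_cong[OF h, of x] x by (simp add: char_times_def)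
    then show "\<alpha> x = char_pow \<nu> (-1) x"
      using char_pow_apply[OF assms(2) x] char_nonzero[OF assms(2) x]
      by (simp add: power_int_minus field_simps)
  qed
next
  assume "\<alpha> = char_pow \<nu> (-1)"
  then show "char_times \<alpha> \<nu> = triv_char k"
    using char_nonzero[OF assms(2)] char_pow_apply[OF assms(2)]
    by (intro char_eqI[OF char_times_in[OF assms] triv_char_in])
       (simp add: char_times_def power_int_minus)
qed

lemma char_pow_add:
  assumes "\<eta> \<in> mult_chars k"
  shows "char_times (char_pow \<eta> m) (char_pow \<eta> n) = char_pow \<eta> (m + n)"
  by (rule char_eqI)
     (simp_all add: assms char_times_in char_pow_in,
      simp add: char_times_def char_pow_apply[OF assms] power_int_add char_nonzero[OF assms])

end

text \<open>
  The last two assumptions say that \<open>\<theta>\<close> is a \<open>d\<close>th power residue character: it is trivial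
  exactly on the \<open>d\<close>th powers.
\<close>

locale residue_char = hasse_davenport q dummy k \<psi>
  for q :: nat and dummy :: "'c::alg_closed_field itself" and k :: "'c set" and \<psi> +
  fixes d :: nat and \<theta> :: "'c \<Rightarrow> complex"
  assumes card_k: "card k = q"
    and d_pos: "d > 0" and d_dvd: "d dvd q - 1" and d_nonzero: "of_nat d \<noteq> (0 :: 'c)"
    and theta: "\<theta> \<in> mult_chars k"
    and theta_pow_d: "\<And>u. u \<in> U \<Longrightarrow> \<theta> u ^ d = 1"
    and theta_eq_1: "\<And>u. u \<in> U \<Longrightarrow> \<theta> u = 1 \<Longrightarrow> u ^ ((q - 1) div d) = 1"
begin

abbreviation \<theta>p :: "int \<Rightarrow> 'c \<Rightarrow> complex" where "\<theta>p n \<equiv> char_pow \<theta> n"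

lemma theta_p_in: "\<theta>p n \<in> mult_chars k"
  by (rule char_pow_in[OF theta])

lemma theta_powi_mod: "u \<in> U \<Longrightarrow> \<theta> u powi n = \<theta> u powi (n mod int d)"
proof -
  assume u: "u \<in> U"
  have "\<theta> u powi n = \<theta> u powi (int d * (n div int d) + n mod int d)" by simp
  also have "\<dots> = (\<theta> u powi int d) powi (n div int d) * \<theta> u powi (n mod int d)"
    using char_nonzero[OF theta u] by (simp only: power_int_add power_int_mult simp_thms)
  finally show ?thesis using theta_pow_d[OF u] by simp
qed

lemma theta_p_cong:
  assumes "m mod int d = n mod int d" shows "\<theta>p m = \<theta>p n"
proof (rule char_eqI[OF theta_p_in theta_p_in])
  fix u assume u: "u \<in> U"
  show "\<theta>p m u = \<theta>p n u"
    using theta_powi_mod[OF u, of m] theta_powi_mod[OF u, of n] assms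
    unfolding char_pow_apply[OF theta u] by simp
qed

lemma theta_p_0: "\<theta>p 0 = triv_char k"
  by (rule char_eqI[OF theta_p_in triv_char_in]) (simp add: char_pow_apply[OF theta])

lemma theta_p_triv_iff: "\<theta>p n = triv_char k \<longleftrightarrow> int d dvd n"
proof
  assume "int d dvd n"
  then show "\<theta>p n = triv_char k" using theta_p_cong[of n 0] theta_p_0 by simp
next
  assume h: "\<theta>p n = triv_char k"
  define m where "m = nat (n mod int d)"
  have m: "int m = n mod int d" "m < d" using d_pos by (auto simp: m_def nat_less_iff)
  obtain g where g: "g \<in> U" "\<forall>x\<in>U. \<exists>i. x = g ^ i" using cyclic by blast
  have "\<theta> g powi n = 1"
    using fun_cong[OF h, of g] triv_char_apply[OF g(1)] unfolding char_pow_apply[OF theta g(1)] by simp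
  then have "\<theta> g powi (int m) = 1" unfolding m(1) theta_powi_mod[OF g(1), of n, symmetric] .
  then have "\<theta> (g ^ m) = 1" unfolding char_power[OF theta g(1)] by simp
  then have "(g ^ m) ^ ((q - 1) div d) = 1" using theta_eq_1[OF U_power[OF g(1)]] by blast
  then have "g ^ (m * ((q - 1) div d)) = g ^ 0" by (simp add: power_mult)
  then have "(m * ((q - 1) div d)) mod (q - 1) = 0"
    using generator_powers(2)[OF g, of "m * ((q - 1) div d)" 0] unfolding card_U card_k by simp
  moreover have "m * ((q - 1) div d) < q - 1 \<or> m = 0"
  proof (cases "m = 0")
    case False
    obtain e where e: "q - 1 = d * e" using d_dvd by (auto simp: dvd_def)
    have "e > 0" using e q_ge2 by (cases e) auto
    then show ?thesis using e m(2) d_pos by simp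
  qed simp
  ultimately have "m * ((q - 1) div d) = 0" by auto
  moreover have "(q - 1) div d > 0"
    using d_dvd q_ge2 d_pos by (simp add: div_greater_zero_iff dvd_imp_le)
  ultimately have "m = 0" by simp
  then show "int d dvd n" using m(1) by auto
qed

lemma theta_p_prod_one:
  assumes w: "int d dvd (\<Sum>i<d. w i)" and u: "u \<in> U"
  shows "(\<Prod>i<d. \<theta>p (w i) u) = 1"
proof -
  have "(\<Prod>i<d. \<theta>p (w i) u) = \<theta>p (\<Sum>i<d. w i) u"
    unfolding char_pow_apply[OF theta u] by (rule prod_power_int[OF char_nonzero[OF theta u]])
  then show ?thesis using iffD2[OF theta_p_triv_iff w] triv_char_apply[OF u] by simp
qed

lemma theta_p_inj: "\<theta>p m = \<theta>p n \<longleftrightarrow> m mod int d = n mod int d"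
proof
  assume h: "\<theta>p m = \<theta>p n"
  have "\<theta>p (m - n) = char_times (\<theta>p m) (\<theta>p (- n))" unfolding char_pow_add[OF theta] by simp
  also have "\<dots> = \<theta>p 0" unfolding h char_pow_add[OF theta] by simp
  finally have "int d dvd m - n" using theta_p_triv_iff theta_p_0 by simp
  then show "m mod int d = n mod int d" by (simp add: mod_eq_dvd_iff)
qed (rule theta_p_cong)

lemma inj_theta_p: "inj_on (\<lambda>j. \<theta>p (int j)) {..<d}"
  by (rule inj_onI) (simp add: theta_p_inj)

lemma theta_p_rep: obtains j where "j < d" "\<theta>p n = \<theta>p (int j)"
proof
  show "nat (n mod int d) < d" using d_pos by (simp add: nat_less_iff)
  show "\<theta>p n = \<theta>p (int (nat (n mod int d)))" using d_pos by (simp add: theta_p_inj)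
qed

lemma ex_theta_times_triv:
  assumes "\<nu> \<in> mult_chars k" "char_times (\<theta>p n) \<nu> = triv_char k"
  shows "\<exists>m<d. \<nu> = \<theta>p (int m)"
proof -
  have "char_times \<nu> (\<theta>p n) = triv_char k"
    using assms(2) by (simp add: char_times_def fun_eq_iff mult.commute)
  then have "\<nu> = char_pow (\<theta>p n) (-1)" using char_times_eq_triv_iff[OF assms(1) theta_p_in] by simp
  moreover have "char_pow (\<theta>p n) (-1) = \<theta>p (- n)"
    by (rule char_eqI[OF char_pow_in[OF theta_p_in] theta_p_in])
       (simp add: char_pow_apply[OF theta] char_pow_apply[OF theta_p_in] power_int_minus)
  moreover obtain l where "l < d" "\<theta>p (- n) = \<theta>p (int l)" by (rule theta_p_rep)
  ultimately show ?thesis by auto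
qed

text \<open>
  If \<open>\<nu> ^ d\<close> is trivial, \<open>\<nu>\<close> is trivial on the \<open>d\<close>th powers, which are the kernel of \<open>\<theta>\<close>.
  Summing \<open>\<theta> ^ j * \<nu>\<close> over \<open>j < d\<close> and over \<open>U\<close> then gives \<open>d\<close> times the order of this
  kernel. So one of the characters \<open>\<theta> ^ j * \<nu>\<close> has a nonzero sum, hence is trivial.
\<close>

lemma ex_theta_p_of_order:
  assumes \<nu>: "\<nu> \<in> mult_chars k" and triv: "char_pow \<nu> (int d) = triv_char k"
  shows "\<exists>j<d. \<nu> = \<theta>p (int j)"
proof -
  have \<nu>d: "\<nu> u ^ d = 1" if "u \<in> U" for u
    using fun_cong[OF triv, of u] that by (simp add: char_pow_apply[OF \<nu>])
  have "(\<Sum>j<d. \<Sum>x\<in>U. char_times (\<theta>p (int j)) \<nu> x) =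
      (\<Sum>x\<in>U. (\<Sum>j<d. \<theta> x ^ j) * \<nu> x)"
  proof -
    have "(\<Sum>j<d. \<Sum>x\<in>U. char_times (\<theta>p (int j)) \<nu> x) = (\<Sum>j<d. \<Sum>x\<in>U. \<theta> x ^ j * \<nu> x)"
      by (intro sum.cong refl) (simp add: char_times_def char_pow_apply[OF theta])
    also have "\<dots> = (\<Sum>x\<in>U. \<Sum>j<d. \<theta> x ^ j * \<nu> x)" by (rule sum.swap)
    finally show ?thesis unfolding sum_distrib_right .
  qed
  also have "\<dots> = (\<Sum>x\<in>U. if \<theta> x = 1 then of_nat d else 0)"
  proof (intro sum.cong refl)
    fix x assume x: "x \<in> U"
    show "(\<Sum>j<d. \<theta> x ^ j) * \<nu> x = (if \<theta> x = 1 then of_nat d else 0)"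
    proof (cases "\<theta> x = 1")
      case True
      obtain y where y: "y ^ d = x" using nth_root_exists[OF d_pos] by blast
      then have y0: "y \<noteq> 0" using x d_pos by (auto simp: zero_power)
      have "y ^ (q - 1) = (y ^ d) ^ ((q - 1) div d)" using d_dvd by (simp flip: power_mult)
      then have "y ^ (q - 1) = 1" using y theta_eq_1[OF x True] by simp
      then have "y ^ (q - 1) * y = y" by simp
      then have "fr y = y" using q_ge2 by (simp flip: power_Suc2)
      then have "y \<in> U" using y0 by (simp add: in_k_iff)
      then have "\<nu> x = 1" using \<nu>d[of y] char_power[OF \<nu>, of y d] y by simp
      then show ?thesis using True by simp
    next
      case False
      then show ?thesis using sum_gp_strict[of "\<theta> x" d] theta_pow_d[OF x] by simp
    qed
  qed
  also have "\<dots> = of_nat (d * card {x \<in> U. \<theta> x = 1})"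
    unfolding sum.inter_filter[OF finite_U, symmetric] by (simp add: mult.commute)
  also have "\<dots> \<noteq> 0"
  proof -
    have "1 \<in> {x \<in> U. \<theta> x = 1}" by (simp add: char_one[OF theta])
    moreover have "finite {x \<in> U. \<theta> x = 1}" by (rule finite_subset[OF _ finite_U]) blast
    ultimately have "card {x \<in> U. \<theta> x = 1} \<noteq> 0" by (subst card_0_eq) blast+
    then show ?thesis using d_pos by simp
  qed
  finally have "(\<Sum>j<d. \<Sum>x\<in>U. char_times (\<theta>p (int j)) \<nu> x) \<noteq> 0" .
  then have "\<exists>j\<in>{..<d}. (\<Sum>x\<in>U. char_times (\<theta>p (int j)) \<nu> x) \<noteq> 0"
    by (rule sum.not_neutral_contains_not_neutral) blast
  then obtain j where j: "j < d" "(\<Sum>x\<in>U. char_times (\<theta>p (int j)) \<nu> x) \<noteq> 0" by blast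
  then have "char_times (\<theta>p (int j)) \<nu> = triv_char k"
    using sum_char[OF char_times_in[OF theta_p_in \<nu>], of "int j"]
    by (cases "char_times (\<theta>p (int j)) \<nu> = triv_char k") simp_all
  then show ?thesis by (rule ex_theta_times_triv[OF \<nu>])
qed

lemma theta_p_order: "char_pow (\<theta>p n) (int d) = triv_char k"
proof (rule char_eqI[OF char_pow_in[OF theta_p_in] triv_char_in])
  fix x assume x: "x \<in> U"
  have "(\<theta> x powi n) powi int d = (\<theta> x powi int d) powi n"
    unfolding power_int_mult[symmetric] by (subst mult.commute) (rule refl)
  then show "char_pow (\<theta>p n) (int d) x = triv_char k x"
    unfolding char_pow_apply[OF theta_p_in x] char_pow_apply[OF theta x] triv_char_apply[OF x]
    using theta_pow_d[OF x] by simp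
qed

text \<open>
  The product formula contracts the Gauss sums, and the quotient by the same formula for the
  trivial character cancels the factor \<open>C\<close>. As to the powers of \<open>Q\<close> in \<^const>\<open>gauss_o\<close>: some
  \<open>\<theta> ^ j * \<nu>\<close> is trivial iff \<open>\<nu> ^ d\<close> is, and then for exactly one \<open>j < d\<close>.
\<close>

lemma prod_poch_o:
  assumes \<nu>: "\<nu> \<in> mult_chars k"
  shows "(\<Prod>j<d. poch_o k \<psi> (\<theta>p (int j)) \<nu>) =
    inverse (\<nu> (of_nat d)) ^ d * gauss_o k \<psi> (char_pow \<nu> (int d)) / Q"
proof -
  obtain C where C: "\<And>\<nu>. \<nu> \<in> mult_chars k \<Longrightarrow> (\<Prod>j<d. gsum (char_times (\<theta>p (int j)) \<nu>)) =
      C * inverse (\<nu> (of_nat d)) ^ d * gsum (char_pow \<nu> (int d))"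
    using hasse_davenport_product[OF theta d_pos d_dvd d_nonzero theta_pow_d theta_eq_1] by blast
  have dU: "of_nat d \<in> U" using d_nonzero of_nat_in by simp
  have tt: "char_times \<alpha> (triv_char k) = \<alpha>" if "\<alpha> \<in> mult_chars k" for \<alpha>
    by (rule char_eqI[OF char_times_in[OF that triv_char_in] that]) (simp add: char_times_def)
  have pt: "char_pow (triv_char k) (int d) = triv_char k"
    by (rule char_eqI[OF char_pow_in[OF triv_char_in] triv_char_in])
       (simp add: char_pow_apply[OF triv_char_in])
  have C1: "(\<Prod>j<d. gsum (\<theta>p (int j))) = - C"
    using C[OF triv_char_in] dU by (simp add: tt theta_p_in pt gsum_triv)
  have C0: "C \<noteq> 0" using C1 gsum_nonzero[OF theta_p_in] by auto
  have split: "(\<Prod>j<d. gauss_o k \<psi> (char_times (\<theta>p (int j)) \<nu>)) =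
      Q ^ char_delta k (char_pow \<nu> (int d)) * (- 1) ^ d * (\<Prod>j<d. gsum (char_times (\<theta>p (int j)) \<nu>))"
    if \<nu>: "\<nu> \<in> mult_chars k" for \<nu>
  proof -
    have "(\<Prod>j<d. Q ^ char_delta k (char_times (\<theta>p (int j)) \<nu>)) = Q ^ char_delta k (char_pow \<nu> (int d))"
    proof (cases "char_pow \<nu> (int d) = triv_char k")
      case True
      then have "char_pow (char_pow \<nu> (-1)) (int d) = triv_char k"
      proof (intro char_eqI[OF char_pow_in[OF char_pow_in[OF \<nu>]] triv_char_in])
        fix x assume x: "x \<in> U"
        have "\<nu> x ^ d = 1"
          using fun_cong[OF True, of x] triv_char_apply[OF x] unfolding char_pow_apply[OF \<nu> x] by simp
        then show "char_pow (char_pow \<nu> (-1)) (int d) x = triv_char k x"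
          unfolding char_pow_apply[OF char_pow_in[OF \<nu>] x] char_pow_apply[OF \<nu> x] triv_char_apply[OF x]
          by (simp add: power_int_minus power_inverse)
      qed
      then obtain l where l: "l < d" "char_pow \<nu> (-1) = \<theta>p (int l)"
        using ex_theta_p_of_order[OF char_pow_in[OF \<nu>]] by blast
      have "char_times (\<theta>p (int j)) \<nu> = triv_char k \<longleftrightarrow> j = l" if "j < d" for j
        using that l char_times_eq_triv_iff[OF theta_p_in \<nu>] inj_onD[OF inj_theta_p, of j l] by auto
      then have "(\<Prod>j<d. Q ^ char_delta k (char_times (\<theta>p (int j)) \<nu>)) = (\<Prod>j<d. if j = l then Q else 1)"
        by (intro prod.cong refl) (auto simp: char_delta_def)
      then show ?thesis using l(1) True by (simp add: char_delta_def)
    next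
      case False
      have "char_times (\<theta>p (int j)) \<nu> \<noteq> triv_char k" for j
      proof
        assume h: "char_times (\<theta>p (int j)) \<nu> = triv_char k"
        have "char_pow \<nu> (int d) = triv_char k"
        proof (rule char_eqI[OF char_pow_in[OF \<nu>] triv_char_in])
          fix x assume x: "x \<in> U"
          have "(\<theta> x ^ j * \<nu> x) ^ d = 1"
            using fun_cong[OF h, of x] x by (simp add: char_times_def char_pow_apply[OF theta])
          moreover have "(\<theta> x ^ j) ^ d = (\<theta> x ^ d) ^ j"
            unfolding power_mult[symmetric] by (subst mult.commute) (rule refl)
          then have "(\<theta> x ^ j) ^ d = 1" using theta_pow_d[OF x] by simp
          ultimately show "char_pow \<nu> (int d) x = triv_char k x"
            using x by (simp add: char_pow_apply[OF \<nu>] power_mult_distrib)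
        qed
        then show False using False by blast
      qed
      then show ?thesis using False by (simp add: char_delta_def)
    qed
    moreover have "(\<Prod>j<d. gauss k \<psi> (char_times (\<theta>p (int j)) \<nu>)) =
        (- 1) ^ d * (\<Prod>j<d. gsum (char_times (\<theta>p (int j)) \<nu>))"
    proof -
      have "(\<Prod>j<d. gauss k \<psi> (char_times (\<theta>p (int j)) \<nu>)) =
          (\<Prod>j<d. - 1 * gsum (char_times (\<theta>p (int j)) \<nu>))" by (simp add: gauss_eq)
      then show ?thesis by (simp only: prod.distrib prod_constant card_lessThan)
    qed
    ultimately show ?thesis unfolding gauss_o_def prod.distrib by (simp add: mult.assoc)
  qed
  have "(\<Prod>j<d. poch_o k \<psi> (\<theta>p (int j)) \<nu>) =
      (\<Prod>j<d. gauss_o k \<psi> (char_times (\<theta>p (int j)) \<nu>)) / (\<Prod>j<d. gauss_o k \<psi> (\<theta>p (int j)))"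
    by (simp add: poch_o_def prod_dividef)
  also have "(\<Prod>j<d. gauss_o k \<psi> (\<theta>p (int j))) = Q * (-1) ^ d * (- C)"
    using split[OF triv_char_in] C1 by (simp add: tt theta_p_in pt char_delta_def)
  also have "(\<Prod>j<d. gauss_o k \<psi> (char_times (\<theta>p (int j)) \<nu>)) / (Q * (-1) ^ d * (- C)) =
      inverse (\<nu> (of_nat d)) ^ d * gauss_o k \<psi> (char_pow \<nu> (int d)) / Q"
  proof -
    have go: "gauss_o k \<psi> (char_pow \<nu> (int d)) = - (Q ^ char_delta k (char_pow \<nu> (int d)) * gsum (char_pow \<nu> (int d)))"
      by (simp add: gauss_o_def gauss_eq)
    show ?thesis unfolding split[OF \<nu>] C[OF \<nu>] go using C0 by (simp add: divide_inverse mult_ac)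
  qed
  finally show ?thesis .
qed

text \<open>
  The lower parameters are distinct and contain all the upper ones, so exactly one copy of
  each upper parameter \<open>\<alpha>\<close> is cancelled. This multiplies the term of \<open>\<nu>\<close> by the quotient of
  the two Pochhammer symbols of \<open>\<alpha>\<close>. As \<open>\<alpha>\<close> is nontrivial, the quotient is \<open>Q\<close> if \<open>\<alpha> \<nu>\<close> is
  trivial and \<open>1\<close> otherwise. The lower Pochhammer symbols are then evaluated by the product
  formula.
\<close>

theorem hyp_F_red_eq:
  fixes w :: "nat \<Rightarrow> int"
  assumes w: "\<And>i. i < d \<Longrightarrow> \<not> int d dvd w i"
    and A: "A = {#\<theta>p (w i). i \<in># mset_set {..<d}#}"
    and B: "B = {#\<theta>p (int j). j \<in># mset_set {..<d}#}"
  shows "(\<Prod>i<d. gauss k \<psi> (\<theta>p (w i))) * hyp_F_red k \<psi> A B z =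
    Q / (1 - Q) * (\<Sum>\<nu>\<in>mult_chars k. (\<Prod>i<d. gauss k \<psi> (char_times (\<theta>p (w i)) \<nu>)) *
      \<nu> (of_nat d) ^ d / gauss_o k \<psi> (char_pow \<nu> (int d)) *
      (if \<exists>i<d. char_times (\<theta>p (w i)) \<nu> = triv_char k then Q else 1) * \<nu> z)"
proof -
  let ?g = "\<Prod>i<d. gauss k \<psi> (\<theta>p (w i))"
  have g0: "?g \<noteq> 0" using gsum_nonzero[OF theta_p_in] by (simp add: gauss_eq)
  have setA: "set_mset A = (\<lambda>i. \<theta>p (w i)) ` {..<d}" by (simp add: A)
  have Bset: "B = mset_set ((\<lambda>j. \<theta>p (int j)) ` {..<d})"
    unfolding B by (rule image_mset_mset_set[OF inj_theta_p])
  have sub: "set_mset A \<subseteq> (\<lambda>j. \<theta>p (int j)) ` {..<d}"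
    unfolding setA by (auto, metis theta_p_rep image_eqI lessThan_iff)
  \<comment> \<open>The cancelled parameters: each upper parameter once, as the lower parameters are distinct.\<close>
  define P where "P = mset_set (set_mset A)"
  have cP: "count P x = min (count A x) (count B x)" for x
  proof (cases "x \<in># A")
    case True
    then have "count B x = 1" using sub unfolding Bset by (subst count_mset_set(1)) auto
    moreover have "count P x = 1" using True by (simp add: P_def)
    moreover have "count A x \<ge> 1" using True by (simp add: Suc_le_eq)
    ultimately show ?thesis by simp
  next
    case False
    then have "count P x = 0" by (simp add: P_def)
    then show ?thesis using False by (simp add: not_in_iff)
  qed
  have PA: "A = (A - B) + P" and PB: "B = (B - A) + P"
    by (auto intro!: multiset_eqI simp: cP)
  have summand: "(\<Prod>\<alpha>\<in>#A - B. poch k \<psi> \<alpha> \<nu>) / (\<Prod>\<beta>\<in>#B - A. poch_o k \<psi> \<beta> \<nu>) =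
      Q / ?g * ((\<Prod>i<d. gauss k \<psi> (char_times (\<theta>p (w i)) \<nu>)) *
      \<nu> (of_nat d) ^ d / gauss_o k \<psi> (char_pow \<nu> (int d)) *
      (if \<exists>i<d. char_times (\<theta>p (w i)) \<nu> = triv_char k then Q else 1))"
    if \<nu>: "\<nu> \<in> mult_chars k" for \<nu>
  proof -
    let ?e = "if \<exists>i<d. char_times (\<theta>p (w i)) \<nu> = triv_char k then Q else 1"
    have in_mc: "\<alpha> \<in> mult_chars k" if "\<alpha> \<in># A" for \<alpha> using that setA theta_p_in by auto
    have pq0: "poch k \<psi> \<alpha> \<nu> \<noteq> 0" "poch_o k \<psi> \<alpha> \<nu> \<noteq> 0" if "\<alpha> \<in> mult_chars k" for \<alpha>
      using gsum_nonzero[OF that] gsum_nonzero[OF char_times_in[OF that \<nu>]]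
      by (auto simp: poch_def poch_o_def gauss_o_def gauss_eq)
    have P0: "(\<Prod>\<alpha>\<in>#P. poch k \<psi> \<alpha> \<nu>) \<noteq> 0"
      using pq0(1) in_mc by (auto simp: P_def prod_mset_zero_iff image_iff)
    have quot: "poch_o k \<psi> \<alpha> \<nu> = (if \<alpha> = char_pow \<nu> (-1) then Q else 1) * poch k \<psi> \<alpha> \<nu>" if "\<alpha> \<in># A" for \<alpha>
    proof -
      have "\<alpha> \<noteq> triv_char k" using that w theta_p_triv_iff by (auto simp: setA)
      then show ?thesis
        using char_times_eq_triv_iff[OF in_mc[OF that] \<nu>]
        by (simp add: poch_o_def poch_def gauss_o_def char_delta_def)
    qed
    have "(\<Prod>\<alpha>\<in>#P. poch_o k \<psi> \<alpha> \<nu>) =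
        (\<Prod>\<alpha>\<in>set_mset A. (if \<alpha> = char_pow \<nu> (-1) then Q else 1) * poch k \<psi> \<alpha> \<nu>)"
      unfolding P_def prod_unfold_prod_mset[symmetric] by (rule prod.cong[OF refl quot])
    also have "\<dots> = ?e * (\<Prod>\<alpha>\<in>#P. poch k \<psi> \<alpha> \<nu>)"
    proof -
      have "(\<exists>i<d. char_times (\<theta>p (w i)) \<nu> = triv_char k) \<longleftrightarrow> char_pow \<nu> (-1) \<in># A"
        unfolding char_times_eq_triv_iff[OF theta_p_in \<nu>] setA image_iff by (metis lessThan_iff)
      then show ?thesis
        unfolding P_def prod_unfold_prod_mset[symmetric] prod.distrib by simp
    qed
    finally have Po: "(\<Prod>\<alpha>\<in>#P. poch_o k \<psi> \<alpha> \<nu>) = ?e * (\<Prod>\<alpha>\<in>#P. poch k \<psi> \<alpha> \<nu>)" .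
    have e0: "?e \<noteq> 0" by simp
    have pA: "(\<Prod>\<alpha>\<in>#A. poch k \<psi> \<alpha> \<nu>) = (\<Prod>i<d. gauss k \<psi> (char_times (\<theta>p (w i)) \<nu>)) / ?g"
      by (simp add: A prod_unfold_prod_mset[symmetric] image_mset.compositionality comp_def poch_def
          prod_dividef)
    have pB: "(\<Prod>\<beta>\<in>#B. poch_o k \<psi> \<beta> \<nu>) = inverse (\<nu> (of_nat d)) ^ d * gauss_o k \<psi> (char_pow \<nu> (int d)) / Q"
      using prod_poch_o[OF \<nu>]
      by (simp add: B prod_unfold_prod_mset[symmetric] image_mset.compositionality comp_def)
    have A': "(\<Prod>\<alpha>\<in>#A. poch k \<psi> \<alpha> \<nu>) = (\<Prod>\<alpha>\<in>#A - B. poch k \<psi> \<alpha> \<nu>) * (\<Prod>\<alpha>\<in>#P. poch k \<psi> \<alpha> \<nu>)"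
      by (subst PA) simp
    have B': "(\<Prod>\<alpha>\<in>#B. poch_o k \<psi> \<alpha> \<nu>) = (\<Prod>\<alpha>\<in>#B - A. poch_o k \<psi> \<alpha> \<nu>) * (\<Prod>\<alpha>\<in>#P. poch_o k \<psi> \<alpha> \<nu>)"
      by (subst PB) simp
    have "(\<Prod>\<alpha>\<in>#A - B. poch k \<psi> \<alpha> \<nu>) / (\<Prod>\<beta>\<in>#B - A. poch_o k \<psi> \<beta> \<nu>) =
        (\<Prod>\<alpha>\<in>#A. poch k \<psi> \<alpha> \<nu>) / (\<Prod>\<alpha>\<in>#B. poch_o k \<psi> \<alpha> \<nu>) * ?e"
      unfolding A' B' Po using P0 e0 by (simp del: if_split)
    also have "\<dots> = Q / ?g * ((\<Prod>i<d. gauss k \<psi> (char_times (\<theta>p (w i)) \<nu>)) *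
      \<nu> (of_nat d) ^ d / gauss_o k \<psi> (char_pow \<nu> (int d)) * ?e)"
    proof -
      have cancel: "a / g / (inverse n ^ d * o' / Q) * e = Q / g * (a * n ^ d / o' * e)"
        for a g n o' e :: complex
        by (simp add: divide_inverse power_inverse mult_ac)
      show ?thesis unfolding pA pB by (rule cancel)
    qed
    finally show ?thesis .
  qed
  have "hyp_F_red k \<psi> A B z = 1 / (1 - Q) * (\<Sum>\<nu>\<in>mult_chars k. Q / ?g * ((\<Prod>i<d. gauss k \<psi> (char_times (\<theta>p (w i)) \<nu>)) *
      \<nu> (of_nat d) ^ d / gauss_o k \<psi> (char_pow \<nu> (int d)) *
      (if \<exists>i<d. char_times (\<theta>p (w i)) \<nu> = triv_char k then Q else 1)) * \<nu> z)"
    unfolding hyp_F_red_def hyp_F_def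
    by (intro arg_cong2[where f = "(*)"] refl sum.cong) (simp_all add: summand)
  also have "\<dots> = 1 / ?g * (Q / (1 - Q) * (\<Sum>\<nu>\<in>mult_chars k. (\<Prod>i<d. gauss k \<psi> (char_times (\<theta>p (w i)) \<nu>)) *
      \<nu> (of_nat d) ^ d / gauss_o k \<psi> (char_pow \<nu> (int d)) *
      (if \<exists>i<d. char_times (\<theta>p (w i)) \<nu> = triv_char k then Q else 1) * \<nu> z))"
    unfolding sum_distrib_left by (rule sum.cong[OF refl]) (simp add: mult_ac)
  finally show ?thesis using g0 by simp
qed

lemma sum_supported_on_theta_powers:
  fixes f :: "('c \<Rightarrow> complex) \<Rightarrow> complex"
  assumes "\<And>\<nu>. \<nu> \<in> mult_chars k \<Longrightarrow> (\<And>m. m < d \<Longrightarrow> \<nu> \<noteq> \<theta>p (int m)) \<Longrightarrow> f \<nu> = 0"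
  shows "(\<Sum>\<nu>\<in>mult_chars k. f \<nu>) = (\<Sum>m<d. f (\<theta>p (int m)))"
proof -
  have "(\<Sum>\<nu>\<in>mult_chars k. f \<nu>) = (\<Sum>\<nu>\<in>(\<lambda>m. \<theta>p (int m)) ` {..<d}. f \<nu>)"
    by (rule sum.mono_neutral_right) (use finite_mult_chars theta_p_in assms in auto)
  also have "\<dots> = (\<Sum>m<d. f (\<theta>p (int m)))"
    by (simp add: sum.reindex[OF inj_theta_p])
  finally show ?thesis .
qed

text \<open>
  The condition that the product of the coordinates is \<open>1\<close> is detected by all multiplicative
  characters \<open>\<nu>\<close>; for each of them a sum over a level set of the sum of the coordinates
  remains.
\<close>

lemma sum_prod_one_level:
  fixes w :: "nat \<Rightarrow> int"
  assumes w_sum: "int d dvd (\<Sum>i<d. w i)" and c: "c \<in> U"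
  shows "(Q - 1) * (\<Sum>t | t \<in> {..<d} \<rightarrow>\<^sub>E U \<and> (\<Sum>i<d. t i) = c \<and> (\<Prod>i<d. t i) = 1. \<Prod>i<d. \<theta>p (w i) (t i)) =
    (\<Sum>\<nu>\<in>mult_chars k. of_bool (\<forall>i<d. char_times (\<theta>p (w i)) \<nu> = triv_char k) * (Q - 1) ^ d / Q
      - \<nu> c ^ d * (\<Prod>i<d. gsum (char_times (\<theta>p (w i)) \<nu>)) / gauss_o k \<psi> (char_pow \<nu> (int d)))"
proof -
  let ?T = "{t \<in> {..<d} \<rightarrow>\<^sub>E U. (\<Sum>i<d. t i) = c}"
  have fin: "finite ?T" by (rule finite_subset[of _ "{..<d} \<rightarrow>\<^sub>E U"]) (auto intro!: finite_PiE simp: finite_k)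
  have tU: "t i \<in> U" if "t \<in> ?T" "i < d" for t i using that by (auto simp: PiE_iff)
  have "(Q - 1) * (\<Sum>t | t \<in> {..<d} \<rightarrow>\<^sub>E U \<and> (\<Sum>i<d. t i) = c \<and> (\<Prod>i<d. t i) = 1. \<Prod>i<d. \<theta>p (w i) (t i)) =
      (Q - 1) * (\<Sum>t | t \<in> ?T \<and> (\<Prod>i<d. t i) = 1. \<Prod>i<d. \<theta>p (w i) (t i))"
    by (intro arg_cong2[where f = "(*)"] refl sum.cong) auto
  also have "\<dots> = (\<Sum>t\<in>?T. if (\<Prod>i<d. t i) = 1 then (Q - 1) * (\<Prod>i<d. \<theta>p (w i) (t i)) else 0)"
    unfolding sum_distrib_left by (rule sum.inter_filter[OF fin])
  also have "\<dots> = (\<Sum>t\<in>?T. \<Sum>\<nu>\<in>mult_chars k. \<Prod>i<d. char_times (\<theta>p (w i)) \<nu> (t i))"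
  proof (intro sum.cong refl)
    fix t assume t: "t \<in> ?T"
    have P: "(\<Prod>i<d. t i) \<in> U" using tU[OF t] by (intro U_prod) auto
    have "(\<Sum>\<nu>\<in>mult_chars k. \<Prod>i<d. char_times (\<theta>p (w i)) \<nu> (t i)) =
        (\<Sum>\<nu>\<in>mult_chars k. (\<Prod>i<d. \<theta>p (w i) (t i)) * \<nu> (\<Prod>i<d. t i))"
    proof (intro sum.cong refl)
      fix \<nu> assume "\<nu> \<in> mult_chars k"
      then have "\<nu> (\<Prod>i<d. t i) = (\<Prod>i<d. \<nu> (t i))"
        using tU[OF t] by (intro char_prod) auto
      then show "(\<Prod>i<d. char_times (\<theta>p (w i)) \<nu> (t i)) = (\<Prod>i<d. \<theta>p (w i) (t i)) * \<nu> (\<Prod>i<d. t i)"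
        by (simp add: char_times_def prod.distrib)
    qed
    also have "\<dots> = (\<Prod>i<d. \<theta>p (w i) (t i)) * (\<Sum>\<nu>\<in>mult_chars k. \<nu> (\<Prod>i<d. t i))"
      by (simp add: sum_distrib_left)
    finally show "(if (\<Prod>i<d. t i) = 1 then (Q - 1) * (\<Prod>i<d. \<theta>p (w i) (t i)) else 0) =
        (\<Sum>\<nu>\<in>mult_chars k. \<Prod>i<d. char_times (\<theta>p (w i)) \<nu> (t i))"
      unfolding sum_mult_chars[OF P] by simp
  qed
  also have "\<dots> = (\<Sum>\<nu>\<in>mult_chars k. \<Sum>t\<in>?T. \<Prod>i<d. char_times (\<theta>p (w i)) \<nu> (t i))"
    by (rule sum.swap)
  also have "\<dots> = (\<Sum>\<nu>\<in>mult_chars k. of_bool (\<forall>i<d. char_times (\<theta>p (w i)) \<nu> = triv_char k) * (Q - 1) ^ d / Q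
      - \<nu> c ^ d * (\<Prod>i<d. gsum (char_times (\<theta>p (w i)) \<nu>)) / gauss_o k \<psi> (char_pow \<nu> (int d)))"
  proof (intro sum.cong refl)
    fix \<nu> assume \<nu>: "\<nu> \<in> mult_chars k"
    have E: "char_pow \<nu> (int d) x = (\<Prod>i<d. char_times (\<theta>p (w i)) \<nu> x)" if x: "x \<in> U" for x
    proof -
      show ?thesis
        using theta_p_prod_one[OF w_sum x]
        by (simp add: char_times_def prod.distrib char_pow_apply[OF \<nu> x])
    qed
    show "(\<Sum>t\<in>?T. \<Prod>i<d. char_times (\<theta>p (w i)) \<nu> (t i)) =
       of_bool (\<forall>i<d. char_times (\<theta>p (w i)) \<nu> = triv_char k) * (Q - 1) ^ d / Q
      - \<nu> c ^ d * (\<Prod>i<d. gsum (char_times (\<theta>p (w i)) \<nu>)) / gauss_o k \<psi> (char_pow \<nu> (int d))"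
      using sum_prod_char_level[of "{..<d}" "\<lambda>i. char_times (\<theta>p (w i)) \<nu>", OF _ _ char_pow_in[OF \<nu>] E c]
        char_times_in[OF theta_p_in \<nu>] char_pow_apply[OF \<nu> c, of "int d"]
      by (simp add: Ball_def)
  qed
  finally show ?thesis .
qed

text \<open>
  Both sides are sums over \<open>\<nu>\<close> with the same general term. They differ for two reasons: the
  reduced function has an additional factor \<open>Q\<close> where \<open>\<nu>\<close> is the inverse of an upper
  parameter, and the level sets have an additional term where all \<open>\<alpha> \<nu>\<close> are trivial. These
  \<open>\<nu>\<close> are powers \<open>\<theta> ^ m\<close>, and there \<open>\<nu> ^ d\<close> is trivial, which evaluates the terms.
\<close>

theorem torus_sum_eq_hyp_F_red:
  fixes w :: "nat \<Rightarrow> int"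
  assumes w: "\<And>i. i < d \<Longrightarrow> \<not> int d dvd w i" and w_sum: "int d dvd (\<Sum>i<d. w i)"
    and l: "l \<in> U"
    and A: "A = {#\<theta>p (w i). i \<in># mset_set {..<d}#}"
    and B: "B = {#\<theta>p (int j). j \<in># mset_set {..<d}#}"
  shows "(\<Sum>t | t \<in> {..<d} \<rightarrow>\<^sub>E U \<and> (\<Sum>i<d. t i) = of_nat d * l \<and> (\<Prod>i<d. t i) = 1. \<Prod>i<d. \<theta>p (w i) (t i)) =
    (-1) ^ d / Q * ((\<Prod>i<d. gauss k \<psi> (\<theta>p (w i))) * hyp_F_red k \<psi> A B (l ^ d))
    + (\<Sum>m<d. of_bool (\<forall>i<d. int d dvd w i + int m) * (Q - 1) ^ (d - 1) / Q
        + of_bool (\<exists>i<d. int d dvd w i + int m) * (\<Prod>i<d. gsum (\<theta>p (w i + int m))) / Q)"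
proof -
  have Q1: "Q - 1 \<noteq> 0" using Q_neq_1 by simp
  define c where "c = of_nat d * l"
  have dU: "of_nat d \<in> U" using d_nonzero of_nat_in by simp
  have c: "c \<in> U" unfolding c_def by (rule U_mult[OF dU l])
  define \<Gamma> where "\<Gamma> \<nu> = (\<Prod>i<d. gsum (char_times (\<theta>p (w i)) \<nu>))" for \<nu>
  define go where "go \<nu> = gauss_o k \<psi> (char_pow \<nu> (int d))" for \<nu>
  define alltriv where "alltriv \<nu> \<longleftrightarrow> (\<forall>i<d. char_times (\<theta>p (w i)) \<nu> = triv_char k)" for \<nu>
  define anytriv where "anytriv \<nu> \<longleftrightarrow> (\<exists>i<d. char_times (\<theta>p (w i)) \<nu> = triv_char k)" for \<nu>
  have all_any: "alltriv \<nu> \<Longrightarrow> anytriv \<nu>" for \<nu> using d_pos by (auto simp: alltriv_def anytriv_def)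
  have any_ex: "\<exists>m<d. \<nu> = \<theta>p (int m)" if "\<nu> \<in> mult_chars k" "anytriv \<nu>" for \<nu>
    using that ex_theta_times_triv unfolding anytriv_def by blast
  have g: "(\<Prod>i<d. gauss k \<psi> (char_times (\<theta>p (w i)) \<nu>)) = (-1) ^ d * \<Gamma> \<nu>" for \<nu>
  proof -
    have "(\<Prod>i<d. gauss k \<psi> (char_times (\<theta>p (w i)) \<nu>)) = (\<Prod>i<d. -1 * gsum (char_times (\<theta>p (w i)) \<nu>))"
      by (simp add: gauss_eq)
    then show ?thesis by (simp only: prod.distrib prod_constant card_lessThan \<Gamma>_def)
  qed
  let ?N = "\<Sum>t | t \<in> {..<d} \<rightarrow>\<^sub>E U \<and> (\<Sum>i<d. t i) = c \<and> (\<Prod>i<d. t i) = 1. \<Prod>i<d. \<theta>p (w i) (t i)"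
  let ?F = "(-1) ^ d / Q * ((\<Prod>i<d. gauss k \<psi> (\<theta>p (w i))) * hyp_F_red k \<psi> A B (l ^ d))"
  have N: "(Q - 1) * ?N = (\<Sum>\<nu>\<in>mult_chars k. of_bool (alltriv \<nu>) * (Q - 1) ^ d / Q - \<nu> c ^ d * \<Gamma> \<nu> / go \<nu>)"
    using sum_prod_one_level[OF w_sum c] by (simp only: \<Gamma>_def go_def alltriv_def)
  have F: "(Q - 1) * ?F = - (\<Sum>\<nu>\<in>mult_chars k. \<nu> c ^ d * \<Gamma> \<nu> / go \<nu> * (if anytriv \<nu> then Q else 1))"
  proof -
    note eq = hyp_F_red_eq[OF w A B, of "l ^ d"]
    have "?F = (-1) ^ d / Q * (Q / (1 - Q) * (\<Sum>\<nu>\<in>mult_chars k. (-1) ^ d * \<Gamma> \<nu> * \<nu> (of_nat d) ^ d / go \<nu> *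
      (if anytriv \<nu> then Q else 1) * \<nu> (l ^ d)))"
      using eq unfolding g go_def anytriv_def by (rule arg_cong)
    also have "(\<Sum>\<nu>\<in>mult_chars k. (-1) ^ d * \<Gamma> \<nu> * \<nu> (of_nat d) ^ d / go \<nu> * (if anytriv \<nu> then Q else 1) * \<nu> (l ^ d)) =
        (-1) ^ d * (\<Sum>\<nu>\<in>mult_chars k. \<nu> c ^ d * \<Gamma> \<nu> / go \<nu> * (if anytriv \<nu> then Q else 1))"
      unfolding sum_distrib_left
    proof (intro sum.cong refl)
      fix \<nu> assume \<nu>: "\<nu> \<in> mult_chars k"
      have "\<nu> c ^ d = \<nu> (of_nat d) ^ d * \<nu> (l ^ d)"
        using char_mult[OF \<nu>, of "of_nat d" l] char_power[OF \<nu> l, of d] dU l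
        by (simp add: c_def power_mult_distrib)
      then show "(-1) ^ d * \<Gamma> \<nu> * \<nu> (of_nat d) ^ d / go \<nu> * (if anytriv \<nu> then Q else 1) * \<nu> (l ^ d) =
        (-1) ^ d * (\<nu> c ^ d * \<Gamma> \<nu> / go \<nu> * (if anytriv \<nu> then Q else 1))" by simp
    qed
    also have "(-1) ^ d / Q * (Q / (1 - Q) * ((-1) ^ d * S)) = S / (1 - Q)" for S :: complex
      by (simp add: divide_inverse flip: mult.assoc power_add mult_2)
    finally have "?F = (\<Sum>\<nu>\<in>mult_chars k. \<nu> c ^ d * \<Gamma> \<nu> / go \<nu> * (if anytriv \<nu> then Q else 1)) / (1 - Q)" .
    moreover have "(Q - 1) * (S / (1 - Q)) = - S" for S :: complex
      using Q_neq_1 by (simp add: divide_eq_eq minus_mult_left[symmetric]) (simp add: algebra_simps)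
    ultimately show ?thesis by (simp only:)
  qed
  have "(Q - 1) * ?N - (Q - 1) * ?F = (\<Sum>\<nu>\<in>mult_chars k. of_bool (alltriv \<nu>) * (Q - 1) ^ d / Q
      + of_bool (anytriv \<nu>) * (Q - 1) * (\<nu> c ^ d * \<Gamma> \<nu> / go \<nu>))"
    unfolding N F diff_minus_eq_add sum.distrib[symmetric]
    by (intro sum.cong refl) (simp add: algebra_simps diff_divide_distrib)
  also have "\<dots> = (\<Sum>m<d. of_bool (alltriv (\<theta>p (int m))) * (Q - 1) ^ d / Q
      + of_bool (anytriv (\<theta>p (int m))) * (Q - 1) * (\<theta>p (int m) c ^ d * \<Gamma> (\<theta>p (int m)) / go (\<theta>p (int m))))"
  proof (rule sum_supported_on_theta_powers)
    fix \<nu> assume \<nu>: "\<nu> \<in> mult_chars k" and ne: "\<And>m. m < d \<Longrightarrow> \<nu> \<noteq> \<theta>p (int m)"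
    have "\<not> anytriv \<nu>" using any_ex[OF \<nu>] ne by blast
    moreover from this have "\<not> alltriv \<nu>" using all_any by blast
    ultimately show "of_bool (alltriv \<nu>) * (Q - 1) ^ d / Q
      + of_bool (anytriv \<nu>) * (Q - 1) * (\<nu> c ^ d * \<Gamma> \<nu> / go \<nu>) = 0" by simp
  qed
  also have "\<dots> = (\<Sum>m<d. of_bool (\<forall>i<d. int d dvd w i + int m) * (Q - 1) ^ d / Q
        + of_bool (\<exists>i<d. int d dvd w i + int m) * (Q - 1) * ((\<Prod>i<d. gsum (\<theta>p (w i + int m))) / Q))"
  proof (intro sum.cong refl)
    fix m
    have "\<theta>p (int m) c ^ d = 1"
      using fun_cong[OF theta_p_order[of "int m"], of c] triv_char_apply[OF c]
      unfolding char_pow_apply[OF theta_p_in c] by simp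
    moreover have "go (\<theta>p (int m)) = Q"
      unfolding go_def theta_p_order by (simp add: gauss_o_def gauss_eq gsum_triv char_delta_def)
    ultimately show "of_bool (alltriv (\<theta>p (int m))) * (Q - 1) ^ d / Q
      + of_bool (anytriv (\<theta>p (int m))) * (Q - 1) * (\<theta>p (int m) c ^ d * \<Gamma> (\<theta>p (int m)) / go (\<theta>p (int m))) =
      of_bool (\<forall>i<d. int d dvd w i + int m) * (Q - 1) ^ d / Q
        + of_bool (\<exists>i<d. int d dvd w i + int m) * (Q - 1) * ((\<Prod>i<d. gsum (\<theta>p (w i + int m))) / Q)"
      unfolding alltriv_def anytriv_def \<Gamma>_def char_pow_add[OF theta] theta_p_triv_iff by simp
  qed
  also have "\<dots> = (Q - 1) * (\<Sum>m<d. of_bool (\<forall>i<d. int d dvd w i + int m) * (Q - 1) ^ (d - 1) / Q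
        + of_bool (\<exists>i<d. int d dvd w i + int m) * (\<Prod>i<d. gsum (\<theta>p (w i + int m))) / Q)"
  proof -
    have p: "(Q - 1) ^ d = (Q - 1) * (Q - 1) ^ (d - 1)" using d_pos by (cases d) auto
    have "a * ((Q - 1) * p) / Q + b * (Q - 1) * (G / Q) = (Q - 1) * (a * p / Q + b * G / Q)"
      for a p b G :: complex by (simp add: divide_inverse distrib_left mult_ac)
    then show ?thesis unfolding sum_distrib_left p by (intro sum.cong refl)
  qed
  finally have "(Q - 1) * (?N - ?F) = (Q - 1) * (\<Sum>m<d. of_bool (\<forall>i<d. int d dvd w i + int m) * (Q - 1) ^ (d - 1) / Q
        + of_bool (\<exists>i<d. int d dvd w i + int m) * (\<Prod>i<d. gsum (\<theta>p (w i + int m))) / Q)"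
    by (simp only: right_diff_distrib)
  then have "?N - ?F = (\<Sum>m<d. of_bool (\<forall>i<d. int d dvd w i + int m) * (Q - 1) ^ (d - 1) / Q
        + of_bool (\<exists>i<d. int d dvd w i + int m) * (\<Prod>i<d. gsum (\<theta>p (w i + int m))) / Q)"
    using Q1 by (simp only: mult_cancel_left) simp
  then show ?thesis unfolding c_def[symmetric] by (simp only: diff_eq_eq add.commute)
qed

text \<open>
  Here the summand \<open>of_bool (int d dvd n i)\<close> is the value at \<open>0\<close> of the character \<open>\<theta>p (n i)\<close>
  if the trivial character is extended by \<open>1\<close>. With this extension the additive Fourier
  transform of the trivial character vanishes away from \<open>0\<close>. So for \<open>s \<noteq> 0\<close> the first
  product vanishes as soon as one character is trivial, and otherwise agrees with the second
  one.
\<close>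

lemma fourier_difference:
  fixes n :: "nat \<Rightarrow> int"
  assumes n_sum: "int d dvd (\<Sum>i<d. n i)"
  shows "(\<Sum>s\<in>k. \<Prod>i<d. (\<Sum>u\<in>U. \<theta>p (n i) u * \<psi> (s * u)) + of_bool (int d dvd n i)) -
      (\<Sum>s\<in>k. \<Prod>i<d. \<Sum>u\<in>U. \<theta>p (n i) u * \<psi> (s * u)) =
    of_bool (\<forall>i<d. int d dvd n i) * (Q ^ d - (Q - 1) ^ d)
      - of_bool (\<exists>i<d. int d dvd n i) * (Q - 1) * (\<Prod>i<d. gsum (\<theta>p (n i)))"
proof -
  let ?h = "\<lambda>s i. \<Sum>u\<in>U. \<theta>p (n i) u * \<psi> (s * u)"
  let ?G = "\<Prod>i<d. gsum (\<theta>p (n i))"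
  let ?f = "\<lambda>s. (\<Prod>i<d. ?h s i + of_bool (int d dvd n i)) - (\<Prod>i<d. ?h s i)"
  have h0: "?h 0 i = (if int d dvd n i then Q - 1 else 0)" for i
    using sum_char[OF theta_p_in, of "n i"] by (simp add: theta_p_triv_iff)
  have z: "?f 0 = of_bool (\<forall>i<d. int d dvd n i) * (Q ^ d - (Q - 1) ^ d)"
  proof -
    have 1: "(\<Prod>i<d. ?h 0 i + of_bool (int d dvd n i)) = (\<Prod>i<d. if int d dvd n i then Q else 0)"
      unfolding h0 by (intro prod.cong refl) simp
    have *: "(\<Prod>i<d. if int d dvd n i then x else 0) = of_bool (\<forall>i<d. int d dvd n i) * x ^ d" for x :: complex
    proof (cases "\<forall>i<d. int d dvd n i")
      case False
      then obtain i where "i < d" "\<not> int d dvd n i" by blast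
      then have "(\<Prod>i<d. if int d dvd n i then x else 0) = 0"
        by (intro prod_zero bexI[of _ i]) simp_all
      then show ?thesis using False by (simp only: of_bool_eq mult_zero_left)
    qed simp
    show ?thesis unfolding 1 unfolding h0 * by (simp only: right_diff_distrib)
  qed
  have nz: "?f s = - of_bool (\<exists>i<d. int d dvd n i) * ?G" if s: "s \<in> U" for s
  proof -
    have hs: "?h s i = inverse (\<theta>p (n i) s) * gsum (\<theta>p (n i))" for i by (rule gsum_twist[OF theta_p_in s])
    have "(\<Prod>i<d. \<theta>p (n i) s) = 1" by (rule theta_p_prod_one[OF n_sum s])
    then have 1: "(\<Prod>i<d. ?h s i) = ?G"
      unfolding hs prod.distrib prod_inversef[unfolded comp_def] by simp
    have 2: "(\<Prod>i<d. ?h s i + of_bool (int d dvd n i)) = of_bool (\<not> (\<exists>i<d. int d dvd n i)) * ?G"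
    proof (cases "\<exists>i<d. int d dvd n i")
      case True
      then obtain i where i: "i < d" "int d dvd n i" by blast
      then have "\<theta>p (n i) = triv_char k" by (simp add: theta_p_triv_iff)
      then have "?h s i + of_bool (int d dvd n i) = 0"
        unfolding hs using i s by (simp add: gsum_triv)
      then have "(\<Prod>i<d. ?h s i + of_bool (int d dvd n i)) = 0" using i(1)
        by (intro prod_zero finite_lessThan bexI[of _ i]) simp_all
      then show ?thesis using True by simp
    next
      case False
      then have "(\<Prod>i<d. ?h s i + of_bool (int d dvd n i)) = (\<Prod>i<d. ?h s i)" by (intro prod.cong refl) simp
      then show ?thesis unfolding 1 using False by simp
    qed
    show ?thesis unfolding 1 2 by simp
  qed
  have "(\<Sum>s\<in>k. ?f s) = ?f 0 + (\<Sum>s\<in>U. ?f s)" unfolding sum_U[of ?f] by simp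
  also have "\<dots> = of_bool (\<forall>i<d. int d dvd n i) * (Q ^ d - (Q - 1) ^ d) + (\<Sum>s\<in>U. - of_bool (\<exists>i<d. int d dvd n i) * ?G)"
    unfolding z by (intro arg_cong2[where f = "(+)"] refl sum.cong nz)
  also have "(\<Sum>s\<in>U. - of_bool (\<exists>i<d. int d dvd n i) * ?G) = - (of_bool (\<exists>i<d. int d dvd n i) * (Q - 1) * ?G)"
    by (simp only: sum_constant of_nat_card_U mult_minus_left mult_minus_right mult_ac)
  finally show ?thesis unfolding sum_subtractf by (simp only: diff_conv_add_uminus)
qed

end

section \<open>Finite subfields of the algebraic closure\<close>

lemma CARD_ge2: "CARD('a::{field,finite}) \<ge> 2"
  using card_mono[of UNIV "{0, 1 :: 'a}"] by simp

lemma eq_prime_power: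
  fixes n p :: nat
  assumes "n \<ge> 2" and only: "\<And>l. prime l \<Longrightarrow> l dvd n \<Longrightarrow> l = p"
  shows "n = p ^ multiplicity p n"
proof -
  obtain l where "prime l" "l dvd n" using prime_factor_nat[of n] assms(1) by auto
  then have "prime_factors n = {p}" using only assms(1) by (auto simp: in_prime_factors_iff)
  moreover have "(\<Prod>l\<in>prime_factors n. l ^ multiplicity l n) = n"
    using prod_prime_factors[of n] assms(1) by simp
  ultimately show ?thesis by simp
qed

text \<open>
  If a prime \<open>l\<close> divides the order of the additive group, there is a subgroup \<open>H\<close> of order
  \<open>l\<close>. Translating \<open>H\<close> by its element \<open>h \<noteq> 0\<close> shows \<open>l * h = 0\<close>, so \<open>l\<close> is the
  characteristic.
\<close>

lemma CARD_field_prime_power: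
  obtains n where "CARD('a::{field,finite}) = CHAR('a) ^ n" "prime CHAR('a)"
proof -
  let ?p = "CHAR('a)"
  have p: "prime ?p" using prime_CHAR_semidom[where ?'a = 'a] finite_imp_CHAR_pos[where ?'a = 'a] by simp
  have "l = ?p" if l: "prime l" "l dvd CARD('a)" for l
  proof -
    define G :: "'a monoid" where "G = \<lparr>carrier = UNIV, monoid.mult = (+), one = 0\<rparr>"
    have "group G"
    proof (rule groupI)
      fix x assume "x \<in> carrier G"
      show "\<exists>y\<in>carrier G. y \<otimes>\<^bsub>G\<^esub> x = \<one>\<^bsub>G\<^esub>"
        by (rule bexI[of _ "- x"]) (simp_all add: G_def)
    qed (simp_all add: G_def add.assoc)
    obtain m where m: "CARD('a) = l * m" using l(2) by (auto simp: dvd_def)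
    have "\<exists>H. subgroup H G \<and> card H = l ^ 1"
      by (rule sylow_thm[OF l(1) \<open>group G\<close>, of 1 m]) (simp_all add: G_def Coset.order_def m)
    then obtain H where H: "subgroup H G" "card H = l" by auto
    have "card H > 1" using H(2) l(1) prime_gt_1_nat by simp
    then have "\<not> H \<subseteq> {0}" using card_mono[of "{0}" H] by auto
    then obtain h where h: "h \<in> H" "h \<noteq> 0" by blast
    have cl: "x + y \<in> H" if "x \<in> H" "y \<in> H" for x y
      using subgroup.m_closed[OF H(1) that] by (simp add: G_def)
    have "inj_on (\<lambda>x. h + x) H" by (simp add: inj_on_def)
    moreover have "(\<lambda>x. h + x) ` H \<subseteq> H" using cl h(1) by auto
    ultimately have "bij_betw (\<lambda>x. h + x) H H"
      unfolding bij_betw_def using endo_inj_surj[OF finite] by blast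
    then have "(\<Sum>x\<in>H. h + x) = (\<Sum>x\<in>H. x)" by (rule sum.reindex_bij_betw)
    then have "of_nat l * h = 0" by (simp add: sum.distrib H(2))
    then have "?p dvd l" using h(2) by (simp add: of_nat_eq_0_iff_char_dvd)
    then show ?thesis using p l(1) primes_dvd_imp_eq by blast
  qed
  then have "CARD('a) = ?p ^ multiplicity ?p CARD('a)"
    by (rule eq_prime_power[OF CARD_ge2])
  then show ?thesis using that p by blast
qed

lemma frob_add_alg_closure:
  fixes x y :: "'a::{field,finite} alg_closure"
  shows "(x + y) ^ (CARD('a) ^ n) = x ^ (CARD('a) ^ n) + y ^ (CARD('a) ^ n)"
proof -
  obtain e where "CARD('a) = CHAR('a) ^ e" "prime CHAR('a)" by (rule CARD_field_prime_power)
  then show ?thesis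
    by (intro freshmans_dream'[where n = "e * n"]) (simp_all add: power_mult)
qed

lemma frobenius_power_CARD:
  assumes "n \<ge> 1"
  shows "frobenius_power TYPE('a::{field,finite} alg_closure) (CARD('a) ^ n)"
proof
  show "2 \<le> CARD('a) ^ n" using CARD_ge2[where ?'a = 'a] assms
    by (metis One_nat_def le_trans self_le_power zero_less_Suc less_eq_Suc_le numeral_2_eq_2 Suc_leD)
qed (rule frob_add_alg_closure)

lemma of_nat_CARD_alg_closure: "of_nat (CARD('a)) = (0 :: 'a::{field,finite} alg_closure)"
proof -
  obtain e where e: "CARD('a) = CHAR('a) ^ e" by (rule CARD_field_prime_power)
  have "e > 0" using e CARD_ge2[where ?'a = 'a] by (cases e) auto
  then show ?thesis by (simp add: e of_nat_eq_0_iff_char_dvd dvd_power)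
qed

lemma card_ext_field:
  assumes "n \<ge> 1"
  shows "card (ext_field n :: 'a::{field,finite} alg_closure set) = CARD('a) ^ n"
proof -
  interpret frobenius_power "CARD('a) ^ n" "TYPE('a alg_closure)"
    by (rule frobenius_power_CARD[OF assms])
  define p :: "'a alg_closure poly" where "p = monom 1 (CARD('a) ^ n) - monom 1 1"
  have "degree p = CARD('a) ^ n"
    unfolding p_def diff_conv_add_uminus using q_ge2
    by (subst degree_add_eq_left) (auto simp: degree_monom_eq)
  moreover have "card {a. poly p a = 0} = degree p"
  proof (rule card_roots_separable)
    show "p \<noteq> 0" using \<open>degree p = CARD('a) ^ n\<close> q_ge2 by auto
    show "poly (pderiv p) a \<noteq> 0" for a
      using assms by (simp add: p_def pderiv_diff pderiv_monom poly_monom of_nat_CARD_alg_closure zero_power)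
  qed
  moreover have "{a. poly p a = 0} = ext_field n"
    by (auto simp: p_def ext_field_def poly_monom)
  ultimately show ?thesis by simp
qed

lemma finite_subfield_ext_field:
  assumes "n \<ge> 1"
  shows "finite_subfield (ext_field n :: 'a::{field,finite} alg_closure set)"
proof -
  interpret frobenius_power "CARD('a) ^ n" "TYPE('a alg_closure)"
    by (rule frobenius_power_CARD[OF assms])
  show ?thesis
  proof
    show "finite (ext_field n :: 'a alg_closure set)"
      using card_ext_field[OF assms, where ?'a = 'a] by (intro card_ge_0_finite) simp
  qed (auto simp: ext_field_def frob_add frob_uminus power_mult_distrib power_inverse)
qed

lemma finite_subfield_UNIV: "finite_subfield (UNIV :: 'a::{field,finite} set)"
  by standard simp_all

lemma power_CARD_eq: "x ^ CARD('a) = (x :: 'a::{field,finite})"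
proof (cases "x = 0")
  case False
  interpret finite_subfield "UNIV :: 'a set" by (rule finite_subfield_UNIV)
  have "x ^ card (UNIV - {0 :: 'a}) = 1" by (rule U_power_card) (use False in simp)
  then have "x ^ (CARD('a) - 1) * x = x" by simp
  then show ?thesis by (simp flip: power_Suc2)
qed simp

text \<open>
  The base field is contained in \<open>ext_field 1\<close>, and both have the same number of elements.
\<close>

lemma range_to_ac: "range (to_ac :: 'a::{field,finite} \<Rightarrow> _) = ext_field 1"
proof (rule card_subset_eq)
  show "finite (ext_field 1 :: 'a alg_closure set)"
    by (rule finite_subfield.finite_k[OF finite_subfield_ext_field]) simp
  show "range (to_ac :: 'a \<Rightarrow> _) \<subseteq> ext_field 1"
    by (auto simp: ext_field_def power_CARD_eq simp flip: to_ac_power)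
  show "card (range (to_ac :: 'a \<Rightarrow> _)) = card (ext_field 1 :: 'a alg_closure set)"
    by (simp add: card_ext_field card_image inj_to_ac)
qed

lemma the_inv_to_ac [simp]: "the_inv to_ac (to_ac x) = x"
  by (rule the_inv_f_f[OF inj_to_ac])

lemma to_ac_the_inv: "y \<in> ext_field 1 \<Longrightarrow> to_ac (the_inv to_ac y) = (y :: 'a::{field,finite} alg_closure)"
  unfolding range_to_ac[symmetric] by (rule f_the_inv_into_f[OF inj_to_ac])

lemma to_ac_in_ext_field: "r \<ge> 1 \<Longrightarrow> to_ac (x :: 'a::{field,finite}) \<in> ext_field r"
proof (induction r rule: nat_induct_at_least)
  case base
  then show ?case using range_to_ac by blast
next
  case (Suc n)
  have "to_ac x ^ CARD('a) = to_ac x" by (simp add: power_CARD_eq flip: to_ac_power)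
  then show ?case using Suc by (simp add: ext_field_def power_mult)
qed

lemma to_ac_ext_norm:
  fixes x :: "'a::{field,finite} alg_closure"
  assumes "x \<in> ext_field r"
  shows "to_ac (ext_norm r x) = (\<Prod>i<r. x ^ (CARD('a) ^ i))"
proof -
  have "(\<Prod>i<r. x ^ (CARD('a) ^ i)) ^ CARD('a) = (\<Prod>i<r. x ^ (CARD('a) ^ Suc i))"
    by (simp add: prod_power_distrib mult.commute flip: power_mult)
  also have "\<dots> = (\<Prod>i<r. x ^ (CARD('a) ^ i))"
  proof (cases r)
    case (Suc n)
    have "x ^ (CARD('a) ^ Suc n) = x" using assms Suc by (simp add: ext_field_def)
    then show ?thesis
      unfolding Suc by (subst (2) prod.lessThan_Suc_shift) (simp add: mult.commute del: power_Suc)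
  qed simp
  finally show ?thesis
    unfolding ext_norm_def by (intro to_ac_the_inv) (simp add: ext_field_def)
qed

lemma ext_norm_nonzero:
  fixes x :: "'a::{field,finite} alg_closure"
  assumes "x \<in> ext_field r" "x \<noteq> 0" shows "ext_norm r x \<noteq> 0"
proof -
  have "to_ac (ext_norm r x) \<noteq> 0" unfolding to_ac_ext_norm[OF assms(1)] using assms(2) by simp
  then show ?thesis by simp
qed

lemma ext_norm_0: "r \<ge> 1 \<Longrightarrow> ext_norm r (0 :: 'a::{field,finite} alg_closure) = 0"
proof -
  assume r: "r \<ge> 1"
  have "(\<Prod>i<r. (0 :: 'a alg_closure) ^ (CARD('a) ^ i)) = 0"
    using r by (intro prod_zero bexI[of _ 0]) auto
  moreover have "(0 :: 'a alg_closure) \<in> ext_field r" by (simp add: ext_field_def)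
  ultimately have "to_ac (ext_norm r (0 :: 'a alg_closure)) = to_ac 0" by (simp add: to_ac_ext_norm)
  then show ?thesis by (simp only: to_ac_eq_iff)
qed

lemma ext_norm_mult:
  fixes x y :: "'a::{field,finite} alg_closure"
  assumes "r \<ge> 1" "x \<in> ext_field r" "y \<in> ext_field r"
  shows "ext_norm r (x * y) = ext_norm r x * ext_norm r y"
proof -
  have "x * y \<in> ext_field r" using finite_subfield.mult_in[OF finite_subfield_ext_field] assms by blast
  then have "to_ac (ext_norm r (x * y)) = to_ac (ext_norm r x * ext_norm r y)"
    using assms by (simp add: to_ac_ext_norm power_mult_distrib prod.distrib)
  then show ?thesis by (simp only: to_ac_eq_iff)
qed

lemma char_lift_in:
  fixes \<eta> :: "'a::{field,finite} \<Rightarrow> complex"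
  assumes r: "r \<ge> 1" and \<eta>: "\<eta> \<in> mult_chars UNIV"
  shows "char_lift r \<eta> \<in> mult_chars (ext_field r)"
proof -
  interpret k: finite_subfield "ext_field r :: 'a alg_closure set" by (rule finite_subfield_ext_field[OF r])
  interpret F: finite_subfield "UNIV :: 'a set" by (rule finite_subfield_UNIV)
  show ?thesis
  proof (rule k.mult_charI)
    fix x :: "'a alg_closure" assume "x \<notin> k.U"
    then show "char_lift r \<eta> x = 0"
      using ext_norm_0[OF r, where ?'a = 'a] F.char_zero[OF \<eta>, of 0] by (auto simp: char_lift_def)
  next
    fix x :: "'a alg_closure" assume "x \<in> k.U"
    then show "char_lift r \<eta> x \<noteq> 0"
      using F.char_nonzero[OF \<eta>, of "ext_norm r x"] ext_norm_nonzero[of x r] by (simp add: char_lift_def)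
  next
    fix x y :: "'a alg_closure" assume "x \<in> k.U" "y \<in> k.U"
    then show "char_lift r \<eta> (x * y) = char_lift r \<eta> x * char_lift r \<eta> y"
      using F.char_mult[OF \<eta>, of "ext_norm r x" "ext_norm r y"] ext_norm_mult[OF r, of x y] k.mult_in[of x y]
      by (simp add: char_lift_def)
  qed
qed

lemma char_lift_triv:
  assumes "r \<ge> 1"
  shows "char_lift r (triv_char (UNIV :: 'a::{field,finite} set)) = triv_char (ext_field r)"
  using ext_norm_0[OF assms, where ?'a = 'a]
  by (auto simp: char_lift_def triv_char_def fun_eq_iff dest: ext_norm_nonzero)

lemma char_lift_pow:
  assumes "r \<ge> 1" "\<eta> \<in> mult_chars (UNIV :: 'a::{field,finite} set)"
  shows "char_pow (char_lift r \<eta>) n = char_lift r (char_pow \<eta> n)"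
  by (auto simp: char_lift_def char_pow_def fun_eq_iff)

section \<open>Jacobi sums over an extension\<close>

lemma (in gauss_setup) jacobi_type_sum:
  assumes I: "finite I" and \<eta>: "\<And>i. i \<in> I \<Longrightarrow> \<eta> i \<in> mult_chars k"
    and triv: "\<And>x. x \<in> U \<Longrightarrow> (\<Prod>i\<in>I. \<eta> i x) = 1"
    and ne: "i \<in> I" "\<eta> i \<noteq> triv_char k"
  shows "(\<Sum>t | t \<in> I \<rightarrow>\<^sub>E U \<and> (\<Sum>i\<in>I. t i) = 1. \<Prod>i\<in>I. \<eta> i (t i)) = - (\<Prod>i\<in>I. gsum (\<eta> i)) / Q"
proof -
  have "gauss_o k \<psi> (triv_char k) = Q"
    by (simp add: gauss_o_def gauss_eq gsum_triv char_delta_def)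
  moreover have "\<not> (\<forall>i\<in>I. \<eta> i = triv_char k)" using ne by blast
  ultimately show ?thesis
    using sum_prod_char_level[OF I \<eta> triv_char_in, where c = 1] triv by simp
qed

text \<open>
  By the formula for level sets, a Jacobi sum of characters with trivial product, not all of
  them trivial, is a product of Gauss sums divided by the order of the field, up to sign. So
  the product of the Gauss sums over the extension is the same for all nontrivial additive
  characters. For an additive character that factors through the trace, each Gauss sum of a
  lifted character is up to sign the \<open>r\<close>th power of one over the base field by Hasse and
  Davenport.
\<close>

theorem prod_gauss_lift_eq_jacobi:
  fixes \<eta> :: "nat \<Rightarrow> 'a::{field,finite} \<Rightarrow> complex"
  assumes r: "r \<ge> 1" and d: "d \<ge> 1"
    and \<psi>: "nontrivial_add_char (ext_field r) \<psi>"
    and \<eta>: "\<And>i. i < d \<Longrightarrow> \<eta> i \<in> mult_chars UNIV"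
    and triv: "\<And>x. x \<noteq> 0 \<Longrightarrow> (\<Prod>i<d. \<eta> i x) = 1"
    and ne: "i < d" "char_lift r (\<eta> i) \<noteq> triv_char (ext_field r)"
  shows "(\<Prod>i<d. gauss (ext_field r) \<psi> (char_lift r (\<eta> i))) = of_nat (CARD('a) ^ r) * jacobi d \<eta> ^ r"
proof -
  let ?k = "ext_field r :: 'a alg_closure set" and ?k1 = "ext_field 1 :: 'a alg_closure set"
  interpret k: gauss_setup ?k \<psi>
    using finite_subfield_ext_field[OF r] \<psi> by (simp add: gauss_setup_def gauss_setup_axioms_def)
  interpret F: finite_subfield "UNIV :: 'a set" by (rule finite_subfield_UNIV)
  obtain a where a: "a \<in> ?k" "\<psi> a \<noteq> 1" using \<psi> by (auto simp: nontrivial_add_char_def)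
  \<comment> \<open>An additive character of the base field: by the choice of \<open>a\<close> it is nontrivial at \<open>1\<close>.\<close>
  define \<psi>0 where "\<psi>0 x = \<psi> (a * x)" for x
  have k1k: "x \<in> ?k" if "x \<in> ?k1" for x
    using that to_ac_in_ext_field[OF r] unfolding range_to_ac[symmetric] by blast
  interpret k1: finite_subfield ?k1 by (rule finite_subfield_ext_field) simp
  have \<psi>0: "nontrivial_add_char ?k1 \<psi>0"
    unfolding nontrivial_add_char_def
  proof (intro conjI ballI bexI)
    show "\<psi>0 x \<in> Qbar - {0}" if "x \<in> ?k1" for x
      using that \<psi> k.mult_in[OF a(1) k1k] by (simp add: \<psi>0_def nontrivial_add_char_def)
    show "\<psi>0 (x + y) = \<psi>0 x * \<psi>0 y" if "x \<in> ?k1" "y \<in> ?k1" for x y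
      using that k.psi_add k.mult_in[OF a(1) k1k] by (simp add: \<psi>0_def distrib_left)
    show "\<psi>0 1 \<noteq> 1" using a(2) by (simp add: \<psi>0_def)
  qed (rule k1.one_in)
  interpret fp: frobenius_power "CARD('a)" "TYPE('a alg_closure)"
    using frobenius_power_CARD[of 1, where ?'a = 'a] by simp
  have Keq: "fp.K n = ext_field n" for n by (simp add: fp.K_def ext_field_def)
  interpret hd: hasse_davenport "CARD('a)" "TYPE('a alg_closure)" ?k1 \<psi>0
    by unfold_locales (use \<psi>0 in \<open>simp_all add: Keq\<close>)
  define \<psi>1 where "\<psi>1 x = \<psi>0 (hd.trace r x)" for x
  have tr_in: "hd.trace r x \<in> ?k1" if "x \<in> ?k" for x
    using hd.trace_in_k[of x r] that by (simp add: Keq)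
  have norm_in: "hd.norm r x \<in> ?k1" if "x \<in> ?k" for x
    using hd.norm_in_k[of x r] that by (simp add: Keq)
  have lift1: "char_lift 1 \<chi> (to_ac x) = \<chi> x" for \<chi> :: "'a \<Rightarrow> complex" and x
    using range_to_ac by (auto simp: char_lift_def ext_norm_def)
  have lift: "char_lift r \<chi> x = char_lift 1 \<chi> (hd.norm r x)" if "x \<in> ?k" for \<chi> :: "'a \<Rightarrow> complex" and x
    using that norm_in[OF that] by (simp add: char_lift_def ext_norm_def hd.norm_def)
  have lifting: "(\<Sum>x\<in>k.U. char_lift r \<chi> x * \<psi>1 x) = (-1) ^ (r - 1) * hd.gsum (char_lift 1 \<chi>) ^ r"
    if \<chi>: "\<chi> \<in> mult_chars UNIV" for \<chi> :: "'a \<Rightarrow> complex"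
  proof -
    have "(\<Sum>x\<in>k.U. char_lift r \<chi> x * \<psi>1 x) = (\<Sum>x\<in>?k. char_lift r \<chi> x * \<psi>1 x)"
      unfolding k.sum_U using k.char_zero[OF char_lift_in[OF r \<chi>], of 0] by simp
    also have "\<dots> = (\<Sum>x\<in>?k. char_lift 1 \<chi> (hd.norm r x) * \<psi>0 (hd.trace r x))"
      by (intro sum.cong refl) (simp add: lift \<psi>1_def)
    also have "\<dots> = (-1) ^ (r - 1) * hd.gsum (char_lift 1 \<chi>) ^ r"
      using hd.hasse_davenport_lifting[OF char_lift_in[OF order_refl \<chi>] r] by (simp add: Keq)
    finally show ?thesis .
  qed
  have \<psi>1: "nontrivial_add_char ?k \<psi>1"
    unfolding nontrivial_add_char_def
  proof (intro conjI ballI)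
    show "\<psi>1 x \<in> Qbar - {0}" if "x \<in> ?k" for x
      using tr_in[OF that] \<psi>0 by (simp add: \<psi>1_def nontrivial_add_char_def)
    show "\<psi>1 (x + y) = \<psi>1 x * \<psi>1 y" if "x \<in> ?k" "y \<in> ?k" for x y
    proof -
      have "hd.trace r (x + y) = hd.trace r x + hd.trace r y"
        by (simp add: hd.trace_def fp.frob_pow_add sum.distrib)
      then show ?thesis using hd.psi_add[OF tr_in[OF that(1)] tr_in[OF that(2)]] by (simp add: \<psi>1_def)
    qed
    \<comment> \<open>By the lifting theorem for the trivial character, the sum of \<open>\<psi>1\<close> over the units is \<open>- 1\<close>;
      a trivial \<open>\<psi>1\<close> would give the number of units.\<close>
    show "\<exists>x\<in>?k. \<psi>1 x \<noteq> 1"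
    proof (rule ccontr)
      assume "\<not> (\<exists>x\<in>?k. \<psi>1 x \<noteq> 1)"
      then have "(\<Sum>x\<in>k.U. char_lift r (triv_char UNIV) x * \<psi>1 x) = (\<Sum>x\<in>k.U. 1)"
        unfolding char_lift_triv[OF r] by (intro sum.cong refl) simp
      moreover have "(\<Sum>x\<in>k.U. 1) = k.Q - 1" by (simp only: sum_constant k.of_nat_card_U mult_1_right)
      moreover have "hd.gsum (char_lift 1 (triv_char UNIV)) = -1"
        by (simp only: char_lift_triv[OF order_refl] hd.gsum_triv)
      ultimately have "k.Q - 1 = (-1) ^ (r - 1) * (-1) ^ r"
        using lifting[OF F.triv_char_in] by (simp only:)
      also have "\<dots> = -1" using r by (cases r) (simp_all flip: power_add mult_2)
      finally show False by simp
    qed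
  qed
  interpret k': gauss_setup ?k \<psi>1
    using k.finite_subfield_axioms \<psi>1 by (simp add: gauss_setup_def gauss_setup_axioms_def)
  let ?\<eta> = "\<lambda>i. char_lift r (\<eta> i)" and ?\<eta>1 = "\<lambda>i. char_lift 1 (\<eta> i)"
  have Qr: "k.Q = of_nat (CARD('a) ^ r)" using card_ext_field[OF r, where ?'a = 'a] by simp
  have Q1: "k1.Q = of_nat CARD('a)" using card_ext_field[of 1, where ?'a = 'a] by simp
  have triv_r: "(\<Prod>i<d. ?\<eta> i x) = 1" if "x \<in> k.U" for x
    using that triv[OF ext_norm_nonzero[of x r]] by (simp add: char_lift_def)
  have triv_1: "(\<Prod>i<d. ?\<eta>1 i x) = 1" if "x \<in> k1.U" for x
    using that triv[OF ext_norm_nonzero[of x 1]] by (simp add: char_lift_def)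
  have ne1: "?\<eta>1 i \<noteq> triv_char ?k1"
  proof
    assume "?\<eta>1 i = triv_char ?k1"
    then have "\<eta> i x = triv_char UNIV x" for x
      using lift1[of "\<eta> i" x] to_ac_in_ext_field[OF order_refl, of x] by (simp add: triv_char_def)
    then have "\<eta> i = triv_char UNIV" by blast
    then show False using ne(2) char_lift_triv[OF r] by metis
  qed
  have "- (\<Prod>i<d. k.gsum (?\<eta> i)) / k.Q = - (\<Prod>i<d. k'.gsum (?\<eta> i)) / k.Q"
    using k.jacobi_type_sum[of "{..<d}" ?\<eta> i] k'.jacobi_type_sum[of "{..<d}" ?\<eta> i] triv_r ne
      char_lift_in[OF r \<eta>] by simp
  then have indep: "(\<Prod>i<d. k.gsum (?\<eta> i)) = (\<Prod>i<d. k'.gsum (?\<eta> i))" by simp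
  have gs: "k'.gsum (?\<eta> i) = (-1) ^ (r - 1) * hd.gsum (?\<eta>1 i) ^ r" if "i < d" for i
    unfolding k'.gsum_def by (rule lifting[OF \<eta>[OF that]])
  have jac: "jacobi d \<eta> = (-1) ^ d * (\<Prod>i<d. hd.gsum (?\<eta>1 i)) / of_nat CARD('a)"
  proof -
    have "(\<Sum>x\<in>{x \<in> {..<d} \<rightarrow>\<^sub>E (UNIV - {0}). (\<Sum>i<d. x i) = 1}. \<Prod>i<d. \<eta> i (x i)) =
        (\<Sum>t | t \<in> {..<d} \<rightarrow>\<^sub>E k1.U \<and> (\<Sum>i<d. t i) = 1. \<Prod>i<d. ?\<eta>1 i (t i))"
    proof (rule sum.reindex_bij_witness[of _ "\<lambda>t. \<lambda>i\<in>{..<d}. the_inv to_ac (t i)" "\<lambda>x. \<lambda>i\<in>{..<d}. to_ac (x i)"])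
      fix x assume x: "x \<in> {x \<in> {..<d} \<rightarrow>\<^sub>E (UNIV - {0 :: 'a}). (\<Sum>i<d. x i) = 1}"
      show "(\<lambda>i\<in>{..<d}. the_inv to_ac ((\<lambda>i\<in>{..<d}. to_ac (x i)) i)) = x"
        using x by (auto simp: PiE_iff extensional_def fun_eq_iff)
      have "(\<Sum>i<d. to_ac (x i)) = 1" using x by (simp flip: to_ac_sum)
      then show "(\<lambda>i\<in>{..<d}. to_ac (x i)) \<in> {t. t \<in> {..<d} \<rightarrow>\<^sub>E k1.U \<and> (\<Sum>i<d. t i) = 1}"
        using x range_to_ac[where ?'a = 'a] by (auto simp: PiE_iff)
      show "(\<Prod>i<d. ?\<eta>1 i ((\<lambda>i\<in>{..<d}. to_ac (x i)) i)) = (\<Prod>i<d. \<eta> i (x i))"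
        by (intro prod.cong refl) (simp only: restrict_apply' lift1)
    next
      fix t assume t: "t \<in> {t. t \<in> {..<d} \<rightarrow>\<^sub>E k1.U \<and> (\<Sum>i<d. t i) = 1}"
      then have ti: "to_ac (the_inv to_ac (t i)) = t i" "t i \<noteq> 0" if "i < d" for i
        using that to_ac_the_inv[of "t i"] by (auto simp: PiE_iff)
      show "(\<lambda>i\<in>{..<d}. to_ac ((\<lambda>i\<in>{..<d}. the_inv to_ac (t i)) i)) = t"
        using t ti(1) by (auto simp: PiE_iff extensional_def fun_eq_iff)
      have "to_ac (\<Sum>i<d. the_inv to_ac (t i)) = to_ac 1"
        using t ti(1) by (simp add: to_ac_sum)
      then have "(\<Sum>i<d. the_inv to_ac (t i)) = (1 :: 'a)" by (simp only: to_ac_eq_iff)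
      moreover have "the_inv to_ac (t i) \<noteq> (0 :: 'a)" if "i < d" for i
        using ti[OF that] to_ac_0 by metis
      ultimately show "(\<lambda>i\<in>{..<d}. the_inv to_ac (t i)) \<in> {x \<in> {..<d} \<rightarrow>\<^sub>E (UNIV - {0 :: 'a}). (\<Sum>i<d. x i) = 1}"
        by auto
    qed
    also have "\<dots> = - (\<Prod>i<d. hd.gsum (?\<eta>1 i)) / k1.Q"
      using hd.jacobi_type_sum[of "{..<d}" ?\<eta>1 i] triv_1 ne(1) ne1 char_lift_in[OF order_refl \<eta>] by simp
    finally show ?thesis
      unfolding jacobi_def Q1 using d by (cases d) simp_all
  qed
  have "(\<Prod>i<d. gauss ?k \<psi> (?\<eta> i)) = (\<Prod>i<d. -1 * k.gsum (?\<eta> i))" by (simp add: k.gauss_eq)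
  also have "\<dots> = (-1) ^ d * (\<Prod>i<d. k'.gsum (?\<eta> i))"
    by (simp only: prod.distrib prod_constant card_lessThan indep)
  also have "(\<Prod>i<d. k'.gsum (?\<eta> i)) = (\<Prod>i<d. (-1) ^ (r - 1) * hd.gsum (?\<eta>1 i) ^ r)"
    by (intro prod.cong refl gs) simp
  also have "\<dots> = ((-1) ^ (r - 1)) ^ d * (\<Prod>i<d. hd.gsum (?\<eta>1 i)) ^ r"
    by (simp only: prod.distrib prod_constant card_lessThan prod_power_distrib)
  also have "(-1) ^ d * (((-1) ^ (r - 1)) ^ d * G) = ((-1) ^ d) ^ r * G" for G :: complex
    using r by (cases r) (simp_all add: power_mult[symmetric] power_add[symmetric] mult.assoc[symmetric] mult.commute)
  also have "((-1) ^ d) ^ r * (\<Prod>i<d. hd.gsum (?\<eta>1 i)) ^ r = of_nat (CARD('a) ^ r) * jacobi d \<eta> ^ r"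
    unfolding jac by (simp add: power_divide power_mult_distrib)
  finally show ?thesis .
qed

section \<open>Counting points on the cone\<close>

text \<open>
  The number \<open>q\<close> is the order of the extension \<open>ext_field r\<close>, over which the counting takes
  place.
\<close>

locale dwork_setting =
  fixes d r q :: nat and \<phi> :: "'a::{field,finite} \<Rightarrow> complex" and \<psi> :: "'a alg_closure \<Rightarrow> complex"
  assumes q_eq: "q = CARD('a) ^ r" and d_ge2: "d \<ge> 2" and d_dvd_q: "d dvd CARD('a) - 1"
    and gen: "generates_mult_chars UNIV \<phi>" and r_ge1: "r \<ge> 1"
    and psi: "nontrivial_add_char (ext_field r) \<psi>"
begin

interpretation F: finite_subfield "UNIV :: 'a set" by (rule finite_subfield_UNIV)

definition \<phi>\<^sub>d :: "'a \<Rightarrow> complex" where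
  "\<phi>\<^sub>d = char_pow \<phi> (int ((CARD('a) - 1) div d))"

abbreviation \<theta> :: "'a alg_closure \<Rightarrow> complex" where "\<theta> \<equiv> char_lift r \<phi>\<^sub>d"

definition \<mu> :: "'a set" where "\<mu> = {x. x ^ d = 1}"

lemma phi_in: "\<phi> \<in> mult_chars UNIV"
  using gen by (simp add: generates_mult_chars_def)

text \<open>
  A faithful character is a power of the generator \<open>\<phi>\<close>, so \<open>\<phi>\<close> is faithful itself.
\<close>

lemma phi_eq_1: assumes "x \<noteq> 0" "\<phi> x = 1" shows "x = 1"
proof -
  obtain \<omega> where \<omega>: "\<omega> \<in> mult_chars (UNIV :: 'a set)" "\<And>x. x \<in> F.U \<Longrightarrow> \<omega> x = 1 \<Longrightarrow> x = 1"
    using F.faithful_char by metis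
  obtain n where "\<omega> = char_pow \<phi> n" using gen \<omega>(1) by (auto simp: generates_mult_chars_def)
  then have "\<omega> x = 1" using assms F.char_pow_apply[OF phi_in, of x n] by simp
  then show ?thesis using \<omega>(2) assms(1) by simp
qed

lemma phi_nonzero: "x \<noteq> 0 \<Longrightarrow> \<phi> x \<noteq> 0"
  using F.char_nonzero[OF phi_in] by simp

lemma phi_power: "x \<noteq> 0 \<Longrightarrow> \<phi> (x ^ n) = \<phi> x ^ n"
  using F.char_power[OF phi_in, of x n] by simp

lemma phi_d_in: "\<phi>\<^sub>d \<in> mult_chars UNIV"
  unfolding \<phi>\<^sub>d_def by (rule F.char_pow_in[OF phi_in])

lemma geometric_sum_CARD: "(\<Sum>i<r. CARD('a) ^ i) * (CARD('a) - 1) = q - 1"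
  unfolding q_eq by (rule geometric_sum_mult) simp

lemma ext_norm_power:
  fixes u :: "'a alg_closure"
  assumes u: "u \<in> ext_field r"
  shows "to_ac (ext_norm r u ^ ((CARD('a) - 1) div d)) = u ^ ((q - 1) div d)"
proof -
  have "u ^ (\<Sum>i<r. CARD('a) ^ i) = to_ac (ext_norm r u)"
    unfolding to_ac_ext_norm[OF u] by (rule power_sum)
  moreover have "(\<Sum>i<r. CARD('a) ^ i) * ((CARD('a) - 1) div d) = (q - 1) div d"
    unfolding geometric_sum_CARD[symmetric] by (rule div_mult_swap[OF d_dvd_q])
  ultimately show ?thesis by (metis power_mult to_ac_power)
qed

text \<open>
  The lifted character of \<open>u\<close> is the value of \<open>\<phi>\<close> at a root of unity in the base field,
  namely \<open>ext_norm r u ^ ((CARD('a) - 1) div d) = u ^ ((q - 1) div d)\<close>.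
\<close>

lemma theta_eq:
  assumes u: "u \<in> ext_field r" "u \<noteq> 0" and \<zeta>: "to_ac \<zeta> = u ^ ((q - 1) div d)"
  shows "\<theta> u = \<phi> \<zeta>"
proof -
  have n0: "ext_norm r u \<noteq> 0" by (rule ext_norm_nonzero[OF u])
  have "\<zeta> = ext_norm r u ^ ((CARD('a) - 1) div d)"
    using \<zeta> ext_norm_power[OF u(1)] by (metis to_ac_eq_iff)
  then show ?thesis
    using u(1) F.char_pow_apply[OF phi_in, of "ext_norm r u"] n0 phi_power[OF n0]
    by (simp add: char_lift_def \<phi>\<^sub>d_def)
qed

lemma of_nat_d_nonzero: "of_nat d \<noteq> (0 :: 'a alg_closure)"
proof
  assume d0: "of_nat d = (0 :: 'a alg_closure)"
  obtain e where "CARD('a) - 1 = d * e" using d_dvd_q by (auto simp: dvd_def)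
  then have "of_nat (CARD('a) - 1) = (0 :: 'a alg_closure)" using d0 by simp
  then have "of_nat (Suc (CARD('a) - 1)) = (1 :: 'a alg_closure)" by simp
  moreover have "Suc (CARD('a) - 1) = CARD('a)" using CARD_ge2[where ?'a = 'a] by simp
  ultimately show False using of_nat_CARD_alg_closure[where ?'a = 'a] by simp
qed

sublocale residue_char "q" "TYPE('a alg_closure)" "ext_field r" \<psi> d \<theta>
proof -
  interpret fp: frobenius_power q "TYPE('a alg_closure)"
    unfolding q_eq by (rule frobenius_power_CARD[OF r_ge1])
  interpret k: gauss_setup "ext_field r" \<psi>
    using finite_subfield_ext_field[OF r_ge1] psi by (simp add: gauss_setup_def gauss_setup_axioms_def)
  show "residue_char q (ext_field r) \<psi> d \<theta>"
  proof
    show "ext_field r = fp.K 1" unfolding fp.K_def ext_field_def q_eq[symmetric] by simp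
    show "card (ext_field r :: 'a alg_closure set) = q" unfolding q_eq by (rule card_ext_field[OF r_ge1])
    show "0 < d" using d_ge2 by simp
    show "d dvd q - 1" unfolding geometric_sum_CARD[symmetric] using d_dvd_q by (rule dvd_mult)
    show "of_nat d \<noteq> (0 :: 'a alg_closure)" by (rule of_nat_d_nonzero)
    show "\<theta> \<in> mult_chars (ext_field r)" by (rule char_lift_in[OF r_ge1 phi_d_in])
    fix u :: "'a alg_closure" assume u: "u \<in> ext_field r - {0}"
    define \<zeta> where "\<zeta> = ext_norm r u ^ ((CARD('a) - 1) div d)"
    have \<zeta>: "to_ac \<zeta> = u ^ ((q - 1) div d)" unfolding \<zeta>_def using u by (intro ext_norm_power) simp
    have \<theta>\<zeta>: "\<theta> u = \<phi> \<zeta>" using theta_eq[of u \<zeta>] u \<zeta> by simp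
    have \<zeta>0: "\<zeta> \<noteq> 0" using ext_norm_nonzero[of u r] u by (simp add: \<zeta>_def)
    have "\<zeta> ^ d = 1"
    proof -
      have "\<zeta> ^ d = ext_norm r u ^ (CARD('a) - 1)"
        unfolding \<zeta>_def using d_dvd_q by (simp flip: power_mult)
      also have "\<dots> = 1" using F.U_power_card[of "ext_norm r u"] ext_norm_nonzero[of u r] u by simp
      finally show ?thesis .
    qed
    then show "\<theta> u ^ d = 1" unfolding \<theta>\<zeta> using phi_power[OF \<zeta>0, of d] F.char_one[OF phi_in] by simp
    assume "\<theta> u = 1"
    then have "\<zeta> = 1" using \<theta>\<zeta> phi_eq_1[OF \<zeta>0] by simp
    then show "u ^ ((q - 1) div d) = 1" using \<zeta> by simp
  qed
qed

lemma mu_nonzero: "x \<in> \<mu> \<Longrightarrow> x \<noteq> 0"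
  using d_pos by (auto simp: \<mu>_def zero_power)

lemma root_of_unity_in_range:
  fixes y :: "'a alg_closure"
  assumes "y ^ d = 1" shows "\<exists>x\<in>\<mu>. to_ac x = y"
proof -
  obtain e where e: "CARD('a) - 1 = d * e" using d_dvd_q by (auto simp: dvd_def)
  have "y ^ (CARD('a) - 1) = 1" unfolding e power_mult assms by simp
  then have "y ^ (CARD('a) - 1) * y = y" by simp
  then have "y ^ CARD('a) = y" by (simp flip: power_Suc2)
  then obtain x where x: "y = to_ac x" using range_to_ac[where ?'a = 'a] by (auto simp: ext_field_def)
  then have "to_ac (x ^ d) = to_ac 1" using assms by simp
  then have "x ^ d = 1" by (simp only: to_ac_eq_iff)
  then show ?thesis using x by (auto simp: \<mu>_def)
qed

text \<open>
  The possible coordinates of a vector that Frobenius multiplies by \<open>\<xi>\<close> in this coordinate.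
\<close>

definition twisted :: "'a \<Rightarrow> 'a alg_closure set" where
  "twisted \<xi> = {v. v ^ q = to_ac \<xi> * v}"

definition V :: "'a alg_closure set" where "V = {v. v ^ d \<in> U}"

text \<open>
  For \<open>v \<in> V\<close> this is the \<open>\<xi> \<in> \<mu>\<close> with \<open>v \<in> twisted \<xi>\<close>.
\<close>

definition frob_quot :: "'a alg_closure \<Rightarrow> 'a" where "frob_quot v = the_inv to_ac (v ^ (q - 1))"

lemma pow_q: "v ^ q = v ^ (q - 1) * (v :: 'a alg_closure)"
proof -
  have "v ^ q = v ^ Suc (q - 1)" using q_ge2 by simp
  then show ?thesis by (simp only: power_Suc2)
qed

lemma pow_q_minus_1: "v ^ (q - 1) = (v ^ d) ^ ((q - 1) div d)" for v :: "'a alg_closure"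
  unfolding power_mult[symmetric] dvd_mult_div_cancel[OF d_dvd] by (rule refl)

lemma V_nonzero: "v \<in> V \<Longrightarrow> v \<noteq> 0"
  using d_pos by (auto simp: V_def zero_power)

lemma frob_quot_V:
  assumes v: "v \<in> V"
  shows "frob_quot v \<in> \<mu>" "to_ac (frob_quot v) = v ^ (q - 1)" "\<theta> (v ^ d) = \<phi> (frob_quot v)"
proof -
  have u: "v ^ d \<in> U" using v by (simp add: V_def)
  have "(v ^ (q - 1)) ^ d = (v ^ d) ^ (q - 1)" by (simp add: mult.commute flip: power_mult)
  also have "\<dots> = 1" using U_power_card[OF u] unfolding card_U card_k .
  finally obtain x where x: "x \<in> \<mu>" "to_ac x = v ^ (q - 1)" using root_of_unity_in_range by blast
  then have "frob_quot v = x" unfolding frob_quot_def by (metis the_inv_to_ac)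
  then show *: "frob_quot v \<in> \<mu>" "to_ac (frob_quot v) = v ^ (q - 1)" using x by auto
  show "\<theta> (v ^ d) = \<phi> (frob_quot v)"
    using u *(2) pow_q_minus_1[of v] by (intro theta_eq) auto
qed

lemma twisted_nonzero: "\<xi> \<in> \<mu> \<Longrightarrow> twisted \<xi> - {0} = {v \<in> V. frob_quot v = \<xi>}"
proof (intro equalityI subsetI)
  fix v assume \<xi>: "\<xi> \<in> \<mu>" and v: "v \<in> twisted \<xi> - {0}"
  have eq: "v ^ (q - 1) = to_ac \<xi>" using v unfolding twisted_def pow_q by auto
  have "(v ^ d) ^ q = v ^ d"
  proof -
    have "(v ^ d) ^ q = (v ^ q) ^ d" by (simp add: mult.commute flip: power_mult)
    also have "\<dots> = to_ac (\<xi> ^ d) * v ^ d" using v by (simp add: twisted_def power_mult_distrib)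
    also have "to_ac (\<xi> ^ d) = 1" using \<xi> by (simp add: \<mu>_def del: to_ac_power)
    finally show ?thesis by simp
  qed
  then have "v \<in> V" using v by (simp add: V_def in_k_iff)
  moreover have "frob_quot v = \<xi>" unfolding frob_quot_def eq by simp
  ultimately show "v \<in> {v \<in> V. frob_quot v = \<xi>}" by simp
next
  fix v assume v: "v \<in> {v \<in> V. frob_quot v = \<xi>}"
  then have "v ^ q = to_ac \<xi> * v" unfolding pow_q using frob_quot_V(2)[of v] by auto
  then show "v \<in> twisted \<xi> - {0}" using V_nonzero v by (auto simp: twisted_def)
qed

lemma finite_V: "finite V"
proof -
  have eq: "V = (\<Union>u\<in>U. {v. v ^ d = u})" by (auto simp: V_def)
  have fin: "finite {v. v ^ d = u}" if "u \<in> U" for u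
    using card_nth_roots[of u d] that d_pos d_nonzero by (intro card_ge_0_finite) simp
  show ?thesis unfolding eq by (rule finite_UN_I[OF finite_U fin])
qed

lemma finite_twisted: "\<xi> \<in> \<mu> \<Longrightarrow> finite (twisted \<xi>)"
  using twisted_nonzero[of \<xi>] finite_V by (metis (no_types, lifting) finite_Diff2 finite.emptyI finite_insert
      finite_subset mem_Collect_eq subsetI)

lemma zero_twisted [simp]: "0 \<in> twisted \<xi>"
  using q_ge2 by (simp add: twisted_def zero_power)

lemma twisted_pow_in: "\<xi> \<in> \<mu> \<Longrightarrow> v \<in> twisted \<xi> \<Longrightarrow> v ^ d \<in> ext_field r"
  using twisted_nonzero[of \<xi>] d_pos by (cases "v = 0") (auto simp: V_def zero_power)

text \<open>
  The nonzero \<open>v\<close> in all the sets \<open>twisted \<xi>\<close> together are the \<open>v\<close> with \<open>v ^ d \<in> U\<close>, and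
  \<open>\<phi> \<xi> = \<theta> (v ^ d)\<close>. Each \<open>u \<in> U\<close> has \<open>d\<close> roots \<open>v\<close>. Thus twisting Frobenius by \<open>\<mu>\<close> converts
  the covering \<open>v \<mapsto> v ^ d\<close> into a character sum over \<open>U\<close>.
\<close>

lemma coord_sum:
  "(\<Sum>\<xi>\<in>\<mu>. \<phi> \<xi> powi n * (\<Sum>v\<in>twisted \<xi> - {0}. \<psi> (s * v ^ d))) =
    of_nat d * (\<Sum>u\<in>U. \<theta>p n u * \<psi> (s * u))"
proof -
  let ?h = "\<lambda>v. \<theta>p n (v ^ d) * \<psi> (s * v ^ d)"
  have "(\<Sum>\<xi>\<in>\<mu>. \<phi> \<xi> powi n * (\<Sum>v\<in>twisted \<xi> - {0}. \<psi> (s * v ^ d))) =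
      (\<Sum>\<xi>\<in>\<mu>. \<Sum>v | v \<in> V \<and> frob_quot v = \<xi>. ?h v)"
  proof (intro sum.cong refl)
    fix \<xi> assume \<xi>: "\<xi> \<in> \<mu>"
    have "\<phi> \<xi> powi n * (\<Sum>v | v \<in> V \<and> frob_quot v = \<xi>. \<psi> (s * v ^ d)) =
        (\<Sum>v | v \<in> V \<and> frob_quot v = \<xi>. ?h v)"
      unfolding sum_distrib_left
    proof (intro sum.cong refl)
      fix v assume v: "v \<in> {v. v \<in> V \<and> frob_quot v = \<xi>}"
      then have "v ^ d \<in> U" by (simp add: V_def)
      then have "\<theta>p n (v ^ d) = \<phi> \<xi> powi n"
        using char_pow_apply[OF theta, of "v ^ d" n] frob_quot_V(3)[of v] v by simp
      then show "\<phi> \<xi> powi n * \<psi> (s * v ^ d) = ?h v" by simp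
    qed
    then show "\<phi> \<xi> powi n * (\<Sum>v\<in>twisted \<xi> - {0}. \<psi> (s * v ^ d)) = (\<Sum>v | v \<in> V \<and> frob_quot v = \<xi>. ?h v)"
      unfolding twisted_nonzero[OF \<xi>] .
  qed
  also have "\<dots> = (\<Sum>v\<in>V. ?h v)"
    by (rule sum.group) (use finite_V frob_quot_V(1) in auto)
  also have "\<dots> = (\<Sum>u\<in>U. \<Sum>v | v \<in> V \<and> v ^ d = u. ?h v)"
    by (rule sum.group[symmetric]) (use finite_V finite_U in \<open>auto simp: V_def\<close>)
  also have "\<dots> = (\<Sum>u\<in>U. of_nat d * (\<theta>p n u * \<psi> (s * u)))"
  proof (intro sum.cong refl)
    fix u assume u: "u \<in> U"
    have "{v. v \<in> V \<and> v ^ d = u} = {v. v ^ d = u}" using u by (auto simp: V_def)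
    then have "(\<Sum>v | v \<in> V \<and> v ^ d = u. ?h v) = (\<Sum>v | v ^ d = u. \<theta>p n u * \<psi> (s * u))"
      by (intro sum.cong) auto
    also have "\<dots> = of_nat d * (\<theta>p n u * \<psi> (s * u))"
      using card_nth_roots[of u d] u d_pos d_nonzero by simp
    finally show "(\<Sum>v | v \<in> V \<and> v ^ d = u. ?h v) = of_nat d * (\<theta>p n u * \<psi> (s * u))" .
  qed
  finally show ?thesis by (simp add: sum_distrib_left)
qed

text \<open>
  In the preceding identity for \<open>s = 0\<close> all inner sums on the left equal \<open>q - 1\<close>, and on the
  right there is the sum of a power of \<open>\<theta>\<close> over \<open>U\<close>.
\<close>

lemma mu_sum: "(\<Sum>\<xi>\<in>\<mu>. \<phi> \<xi> powi n) = of_nat d * of_bool (int d dvd n)"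
proof -
  have Q1: "Q - 1 \<noteq> 0" using Q_neq_1 by simp
  have cardT: "of_nat (card (twisted \<xi> - {0})) = Q - 1" if \<xi>: "\<xi> \<in> \<mu>" for \<xi>
  proof -
    have "twisted \<xi> - {0} = {v. v ^ (q - 1) = to_ac \<xi>}"
      unfolding twisted_def pow_q using mu_nonzero[OF \<xi>] q_ge2 by (auto simp: zero_power)
    moreover have "of_nat (q - 1) \<noteq> (0 :: 'a alg_closure)"
    proof
      assume "of_nat (q - 1) = (0 :: 'a alg_closure)"
      then have "of_nat (Suc (q - 1)) = (1 :: 'a alg_closure)" by simp
      moreover have "Suc (q - 1) = q" using q_ge2 by simp
      moreover have "of_nat q = (0 :: 'a alg_closure)"
        using r_ge1 by (simp add: q_eq of_nat_CARD_alg_closure zero_power)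
      ultimately show False by simp
    qed
    ultimately have "card (twisted \<xi> - {0}) = q - 1"
      using card_nth_roots[of "to_ac \<xi>" "q - 1"] mu_nonzero[OF \<xi>] q_ge2 by simp
    then show ?thesis using of_nat_card_U unfolding card_U card_k by simp
  qed
  have "(\<Sum>\<xi>\<in>\<mu>. \<phi> \<xi> powi n) * (Q - 1) = (\<Sum>\<xi>\<in>\<mu>. \<phi> \<xi> powi n * (\<Sum>v\<in>twisted \<xi> - {0}. \<psi> (0 * v ^ d)))"
    unfolding sum_distrib_right
  proof (intro sum.cong refl)
    fix \<xi> assume "\<xi> \<in> \<mu>"
    moreover have "(\<Sum>v\<in>twisted \<xi> - {0}. \<psi> (0 * v ^ d)) = of_nat (card (twisted \<xi> - {0}))" by simp
    ultimately show "\<phi> \<xi> powi n * (Q - 1) = \<phi> \<xi> powi n * (\<Sum>v\<in>twisted \<xi> - {0}. \<psi> (0 * v ^ d))"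
      by (simp only: cardT)
  qed
  also have "\<dots> = of_nat d * (\<Sum>u\<in>U. \<theta>p n u)" unfolding coord_sum by simp
  also have "\<dots> = of_nat d * of_bool (int d dvd n) * (Q - 1)"
    using sum_char[OF theta_p_in, of n] by (simp add: theta_p_triv_iff)
  finally show ?thesis using Q1 by simp
qed

lemma coord_sum_zero:
  "(\<Sum>\<xi>\<in>\<mu>. \<phi> \<xi> powi n * (\<Sum>v\<in>twisted \<xi>. \<psi> (s * v ^ d))) =
    of_nat d * ((\<Sum>u\<in>U. \<theta>p n u * \<psi> (s * u)) + of_bool (int d dvd n))"
proof -
  have "(\<Sum>v\<in>twisted \<xi>. \<psi> (s * v ^ d)) = 1 + (\<Sum>v\<in>twisted \<xi> - {0}. \<psi> (s * v ^ d))" if "\<xi> \<in> \<mu>" for \<xi>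
    using sum.remove[OF finite_twisted[OF that] zero_twisted, of "\<lambda>v. \<psi> (s * v ^ d)"] d_pos
    by (simp add: zero_power)
  then have "(\<Sum>\<xi>\<in>\<mu>. \<phi> \<xi> powi n * (\<Sum>v\<in>twisted \<xi>. \<psi> (s * v ^ d))) =
      (\<Sum>\<xi>\<in>\<mu>. \<phi> \<xi> powi n) + (\<Sum>\<xi>\<in>\<mu>. \<phi> \<xi> powi n * (\<Sum>v\<in>twisted \<xi> - {0}. \<psi> (s * v ^ d)))"
    unfolding sum.distrib[symmetric] by (intro sum.cong refl) (simp add: distrib_left)
  then show ?thesis unfolding mu_sum coord_sum by (simp add: distrib_left)
qed

definition Gt :: "(nat \<Rightarrow> 'a) set" where
  "Gt = {\<xi> \<in> {..<d} \<rightarrow>\<^sub>E \<mu>. (\<Prod>i<d. \<xi> i) = 1}"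

lemma Gt_eq: "carrier (Gtilde d) = Gt"
  by (simp add: Gtilde_def Gt_def \<mu>_def)

lemma Gt_mu: "\<xi> \<in> Gt \<Longrightarrow> i < d \<Longrightarrow> \<xi> i \<in> \<mu>"
  by (auto simp: Gt_def)

lemma finite_Gt: "finite Gt"
  unfolding Gt_def by (rule finite_subset[OF _ finite_PiE[of "{..<d}" "\<lambda>_. \<mu>"]]) auto

text \<open>
  The condition that the product of the \<open>\<xi> i\<close> is \<open>1\<close> is detected by the \<open>d\<close> characters
  \<open>\<xi> \<mapsto> \<phi> \<xi> ^ m\<close> of \<open>\<mu>\<close>, after which the sum is a product over the coordinates.
\<close>

lemma Gt_sum:
  fixes f :: "nat \<Rightarrow> 'a \<Rightarrow> complex"
  shows "of_nat d * (\<Sum>\<xi>\<in>Gt. \<Prod>i<d. f i (\<xi> i)) = (\<Sum>m<d. \<Prod>i<d. \<Sum>\<xi>\<in>\<mu>. \<phi> \<xi> ^ m * f i \<xi>)"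
proof -
  let ?P = "{..<d} \<rightarrow>\<^sub>E \<mu>"
  have fin: "finite ?P" by (rule finite_PiE) auto
  have "(\<Sum>m<d. \<Prod>i<d. \<Sum>\<xi>\<in>\<mu>. \<phi> \<xi> ^ m * f i \<xi>) = (\<Sum>m<d. \<Sum>\<xi>\<in>?P. \<Prod>i<d. \<phi> (\<xi> i) ^ m * f i (\<xi> i))"
    by (intro sum.cong refl prod_sum_PiE) auto
  also have "\<dots> = (\<Sum>\<xi>\<in>?P. \<Sum>m<d. \<Prod>i<d. \<phi> (\<xi> i) ^ m * f i (\<xi> i))" by (rule sum.swap)
  also have "\<dots> = (\<Sum>\<xi>\<in>?P. if (\<Prod>i<d. \<xi> i) = 1 then of_nat d * (\<Prod>i<d. f i (\<xi> i)) else 0)"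
  proof (intro sum.cong refl)
    fix \<xi> assume \<xi>: "\<xi> \<in> ?P"
    define p where "p = (\<Prod>i<d. \<xi> i)"
    have \<xi>0: "\<xi> i \<noteq> 0" "\<xi> i ^ d = 1" if "i < d" for i
      using \<xi> that mu_nonzero[of "\<xi> i"] by (auto simp: PiE_iff \<mu>_def)
    have p0: "p \<noteq> 0" using \<xi>0(1) by (simp add: p_def)
    have pd: "p ^ d = 1" using \<xi>0(2) by (simp add: p_def prod_power_distrib)
    have "\<phi> p = (\<Prod>i<d. \<phi> (\<xi> i))" unfolding p_def using \<xi>0(1) by (intro F.char_prod[OF phi_in]) auto
    then have "(\<Sum>m<d. \<Prod>i<d. \<phi> (\<xi> i) ^ m * f i (\<xi> i)) = (\<Sum>m<d. \<phi> p ^ m) * (\<Prod>i<d. f i (\<xi> i))"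
      by (simp add: prod.distrib sum_distrib_right prod_power_distrib)
    moreover have "(\<Sum>m<d. \<phi> p ^ m) = (if p = 1 then of_nat d else 0)"
    proof (cases "p = 1")
      case False
      then have "\<phi> p \<noteq> 1" using phi_eq_1[OF p0] by blast
      moreover have "\<phi> p ^ d = 1" using phi_power[OF p0, of d] pd F.char_one[OF phi_in] by simp
      ultimately show ?thesis using sum_gp_strict[of "\<phi> p" d] False by simp
    qed (simp add: F.char_one[OF phi_in])
    ultimately show "(\<Sum>m<d. \<Prod>i<d. \<phi> (\<xi> i) ^ m * f i (\<xi> i)) =
        (if (\<Prod>i<d. \<xi> i) = 1 then of_nat d * (\<Prod>i<d. f i (\<xi> i)) else 0)"
      by (simp add: p_def)
  qed
  also have "\<dots> = (\<Sum>\<xi>\<in>Gt. of_nat d * (\<Prod>i<d. f i (\<xi> i)))"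
    unfolding Gt_def by (rule sum.inter_filter[OF fin, symmetric])
  finally show ?thesis by (simp add: sum_distrib_left)
qed

lemma card_Gt: "of_nat (card Gt) = (of_nat d ^ (d - 1) :: complex)"
proof -
  have "of_nat d * of_nat (card Gt) = (\<Sum>m<d. \<Prod>i<d. \<Sum>\<xi>\<in>\<mu>. \<phi> \<xi> powi int m)"
    using Gt_sum[of "\<lambda>_ _. 1"] by simp
  also have "\<dots> = (\<Sum>m<d. if m = 0 then of_nat d ^ d else 0)"
    unfolding mu_sum using d_pos by (intro sum.cong refl) (auto dest: dvd_imp_le)
  also have "\<dots> = of_nat d * of_nat d ^ (d - 1)"
    using d_pos by (cases d) simp_all
  finally show ?thesis using d_pos by simp
qed

lemma phi_powi_shift: "\<xi> \<in> \<mu> \<Longrightarrow> \<phi> \<xi> ^ m * (\<phi> \<xi> powi n * x) = \<phi> \<xi> powi (n + int m) * x"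
  using phi_nonzero[OF mu_nonzero[of \<xi>]] by (simp add: power_int_add)

lemma Gt_char_sum:
  "(\<Sum>\<xi>\<in>Gt. \<Prod>i<d. \<phi> (\<xi> i) powi w i) =
    of_nat (card Gt) * (\<Sum>m<d. of_bool (\<forall>i<d. int d dvd w i + int m))"
proof -
  have "of_nat d * (\<Sum>\<xi>\<in>Gt. \<Prod>i<d. \<phi> (\<xi> i) powi w i) =
      (\<Sum>m<d. \<Prod>i<d. \<Sum>\<xi>\<in>\<mu>. \<phi> \<xi> ^ m * \<phi> \<xi> powi w i)"
    by (rule Gt_sum)
  also have "\<dots> = (\<Sum>m<d. \<Prod>i<d. of_nat d * of_bool (int d dvd w i + int m))"
    unfolding mu_sum[symmetric]
    by (intro sum.cong prod.cong refl) (use phi_powi_shift[where x = 1] in simp)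
  also have "\<dots> = (\<Sum>m<d. of_nat d ^ d * of_bool (\<forall>i<d. int d dvd w i + int m))"
  proof (intro sum.cong refl)
    fix m
    have "(\<Prod>i<d. of_bool (int d dvd w i + int m)) = (of_bool (\<forall>i<d. int d dvd w i + int m) :: complex)"
    proof (cases "\<forall>i<d. int d dvd w i + int m")
      case False
      then obtain i where "i < d" "\<not> int d dvd w i + int m" by blast
      then have "(\<Prod>i<d. of_bool (int d dvd w i + int m)) = (0 :: complex)"
        by (intro prod_zero finite_lessThan bexI[of _ i]) simp_all
      then show ?thesis using False by simp
    qed simp
    then show "(\<Prod>i<d. of_nat d * of_bool (int d dvd w i + int m)) =
        (of_nat d ^ d * of_bool (\<forall>i<d. int d dvd w i + int m) :: complex)"
      by (simp only: prod.distrib prod_constant card_lessThan)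
  qed
  also have "\<dots> = of_nat d * (of_nat d ^ (d - 1) * (\<Sum>m<d. of_bool (\<forall>i<d. int d dvd w i + int m)))"
  proof -
    have "(of_nat d ^ d :: complex) = of_nat d * of_nat d ^ (d - 1)"
      using d_pos by (cases d) simp_all
    then show ?thesis by (simp only: sum_distrib_left mult.assoc)
  qed
  finally show ?thesis unfolding card_Gt using d_pos by simp
qed

text \<open>
  The equation \<open>\<Sum>i<d. v i ^ d = 0\<close> is detected by additive characters. The coordinates then
  separate. The set \<open>T\<close> leaves open whether the coordinate \<open>0\<close> is admitted.
\<close>

lemma fermat_fourier:
  fixes T :: "'a \<Rightarrow> 'a alg_closure set" and w :: "nat \<Rightarrow> int"
  assumes T: "\<And>\<xi>. \<xi> \<in> \<mu> \<Longrightarrow> T \<xi> \<subseteq> twisted \<xi>"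
  shows "of_nat d * Q * (\<Sum>\<xi>\<in>Gt. (\<Prod>i<d. \<phi> (\<xi> i) powi w i) *
      of_nat (card {v \<in> (\<Pi>\<^sub>E i\<in>{..<d}. T (\<xi> i)). (\<Sum>i<d. v i ^ d) = 0})) =
    (\<Sum>m<d. \<Sum>s\<in>ext_field r. \<Prod>i<d. \<Sum>\<xi>\<in>\<mu>. \<phi> \<xi> powi (w i + int m) * (\<Sum>v\<in>T \<xi>. \<psi> (s * v ^ d)))"
proof -
  let ?g = "\<lambda>s i \<xi>. \<phi> \<xi> powi w i * (\<Sum>v\<in>T \<xi>. \<psi> (s * v ^ d))"
  have finT: "finite (T \<xi>)" if "\<xi> \<in> \<mu>" for \<xi>
    using finite_subset[OF T[OF that] finite_twisted[OF that]] .
  have cnt: "Q * ((\<Prod>i<d. \<phi> (\<xi> i) powi w i) * of_nat (card {v \<in> (\<Pi>\<^sub>E i\<in>{..<d}. T (\<xi> i)). (\<Sum>i<d. v i ^ d) = 0})) =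
      (\<Sum>s\<in>ext_field r. \<Prod>i<d. ?g s i (\<xi> i))" if \<xi>: "\<xi> \<in> Gt" for \<xi>
  proof -
    let ?\<Omega> = "\<Pi>\<^sub>E i\<in>{..<d}. T (\<xi> i)"
    have fin: "finite ?\<Omega>" by (rule finite_PiE) (use finT Gt_mu[OF \<xi>] in auto)
    have vk: "v i ^ d \<in> ext_field r" if "v \<in> ?\<Omega>" "i < d" for v i
      using that T[OF Gt_mu[OF \<xi> that(2)]] twisted_pow_in[OF Gt_mu[OF \<xi> that(2)]] by (auto simp: PiE_iff)
    have in_k: "(\<Sum>i<d. v i ^ d) \<in> ext_field r" if "v \<in> ?\<Omega>" for v
      using vk[OF that] by (intro sum_in) auto
    have "of_nat (card {v \<in> ?\<Omega>. (\<Sum>i<d. v i ^ d) = 0}) = (\<Sum>v | v \<in> ?\<Omega> \<and> (\<Sum>i<d. v i ^ d) = 0. 1 :: complex)"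
      by simp
    also have "\<dots> = 1 / Q * (\<Sum>s\<in>ext_field r. \<Sum>v\<in>?\<Omega>. 1 * \<psi> (s * (\<Sum>i<d. v i ^ d)))"
      by (rule sum_restrict_zero[OF fin in_k])
    also have "(\<Sum>s\<in>ext_field r. \<Sum>v\<in>?\<Omega>. 1 * \<psi> (s * (\<Sum>i<d. v i ^ d))) =
        (\<Sum>s\<in>ext_field r. \<Prod>i<d. \<Sum>v\<in>T (\<xi> i). \<psi> (s * v ^ d))"
    proof (intro sum.cong refl)
      fix s :: "'a alg_closure" assume s: "s \<in> ext_field r"
      have "(\<Sum>v\<in>?\<Omega>. 1 * \<psi> (s * (\<Sum>i<d. v i ^ d))) = (\<Sum>v\<in>?\<Omega>. \<Prod>i<d. \<psi> (s * v i ^ d))"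
      proof (intro sum.cong refl)
        fix v assume v: "v \<in> ?\<Omega>"
        have "\<psi> (\<Sum>i<d. s * v i ^ d) = (\<Prod>i<d. \<psi> (s * v i ^ d))"
          by (rule psi_sum) (rule mult_in[OF s vk[OF v]], simp)
        then show "1 * \<psi> (s * (\<Sum>i<d. v i ^ d)) = (\<Prod>i<d. \<psi> (s * v i ^ d))"
          by (simp only: sum_distrib_left mult_1_left)
      qed
      also have "\<dots> = (\<Prod>i<d. \<Sum>v\<in>T (\<xi> i). \<psi> (s * v ^ d))"
        by (rule prod_sum_PiE[symmetric]) (use finT Gt_mu[OF \<xi>] in auto)
      finally show "(\<Sum>v\<in>?\<Omega>. 1 * \<psi> (s * (\<Sum>i<d. v i ^ d))) = (\<Prod>i<d. \<Sum>v\<in>T (\<xi> i). \<psi> (s * v ^ d))" .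
    qed
    finally have "Q * of_nat (card {v \<in> ?\<Omega>. (\<Sum>i<d. v i ^ d) = 0}) =
        (\<Sum>s\<in>ext_field r. \<Prod>i<d. \<Sum>v\<in>T (\<xi> i). \<psi> (s * v ^ d))" by simp
    then show ?thesis
      by (simp only: prod.distrib sum_distrib_left[symmetric] mult.left_commute[of Q])
  qed
  have "of_nat d * Q * (\<Sum>\<xi>\<in>Gt. (\<Prod>i<d. \<phi> (\<xi> i) powi w i) *
      of_nat (card {v \<in> (\<Pi>\<^sub>E i\<in>{..<d}. T (\<xi> i)). (\<Sum>i<d. v i ^ d) = 0})) =
      of_nat d * (\<Sum>\<xi>\<in>Gt. \<Sum>s\<in>ext_field r. \<Prod>i<d. ?g s i (\<xi> i))"
    unfolding mult.assoc sum_distrib_left[of Q] by (intro arg_cong2[where f = "(*)"] refl sum.cong cnt)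
  also have "\<dots> = (\<Sum>s\<in>ext_field r. of_nat d * (\<Sum>\<xi>\<in>Gt. \<Prod>i<d. ?g s i (\<xi> i)))"
    by (subst sum.swap[of _ "ext_field r" Gt]) (rule sum_distrib_left)
  also have "\<dots> = (\<Sum>s\<in>ext_field r. \<Sum>m<d. \<Prod>i<d. \<Sum>\<xi>\<in>\<mu>. \<phi> \<xi> ^ m * ?g s i \<xi>)"
    by (intro sum.cong refl Gt_sum)
  also have "\<dots> = (\<Sum>m<d. \<Sum>s\<in>ext_field r. \<Prod>i<d. \<Sum>\<xi>\<in>\<mu>. \<phi> \<xi> ^ m * ?g s i \<xi>)" by (rule sum.swap)
  also have "\<dots> = (\<Sum>m<d. \<Sum>s\<in>ext_field r. \<Prod>i<d. \<Sum>\<xi>\<in>\<mu>. \<phi> \<xi> powi (w i + int m) * (\<Sum>v\<in>T \<xi>. \<psi> (s * v ^ d)))"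
    by (intro sum.cong prod.cong refl phi_powi_shift)
  finally show ?thesis .
qed

text \<open>
  Where a coordinate vanishes, the equation of the Dwork hypersurface is that of the Fermat
  hypersurface. So the Dwork cone is obtained from the Fermat cone by exchanging the parts
  with nonzero coordinates.
\<close>

definition fermat :: "(nat \<Rightarrow> 'a) \<Rightarrow> (nat \<Rightarrow> 'a alg_closure) set" where
  "fermat \<xi> = {v \<in> (\<Pi>\<^sub>E i\<in>{..<d}. twisted (\<xi> i)). (\<Sum>i<d. v i ^ d) = 0}"

definition fermat_torus :: "(nat \<Rightarrow> 'a) \<Rightarrow> (nat \<Rightarrow> 'a alg_closure) set" where
  "fermat_torus \<xi> = {v \<in> (\<Pi>\<^sub>E i\<in>{..<d}. twisted (\<xi> i) - {0}). (\<Sum>i<d. v i ^ d) = 0}"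

definition dwork_torus :: "'a \<Rightarrow> (nat \<Rightarrow> 'a) \<Rightarrow> (nat \<Rightarrow> 'a alg_closure) set" where
  "dwork_torus lam \<xi> = {v \<in> (\<Pi>\<^sub>E i\<in>{..<d}. twisted (\<xi> i) - {0}).
     (\<Sum>i<d. v i ^ d) = of_nat d * to_ac lam * (\<Prod>i<d. v i)}"

definition dwork_cone :: "'a \<Rightarrow> (nat \<Rightarrow> 'a) \<Rightarrow> (nat \<Rightarrow> 'a alg_closure) set" where
  "dwork_cone lam \<xi> = {v \<in> (\<Pi>\<^sub>E i\<in>{..<d}. twisted (\<xi> i)).
     (\<exists>i<d. v i \<noteq> 0) \<and> (\<Sum>i<d. v i ^ d) = of_nat d * to_ac lam * (\<Prod>i<d. v i)}"

lemma finite_PiE_twisted: "\<xi> \<in> Gt \<Longrightarrow> finite (\<Pi>\<^sub>E i\<in>{..<d}. twisted (\<xi> i))"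
  by (rule finite_PiE) (auto intro: finite_twisted Gt_mu)

text \<open>
  The summand \<open>1\<close> counts the zero vector, which belongs to the Fermat cone, but is not a
  representative of a projective point.
\<close>

lemma card_dwork_cone:
  assumes \<xi>: "\<xi> \<in> Gt"
  shows "card (dwork_cone lam \<xi>) + 1 + card (fermat_torus \<xi>) = card (fermat \<xi>) + card (dwork_torus lam \<xi>)"
proof -
  let ?W = "\<Pi>\<^sub>E i\<in>{..<d}. twisted (\<xi> i)"
  \<comment> \<open>The vectors with a zero coordinate, for which both equations agree. The zero vector is one of them.\<close>
  define Z where "Z = {v \<in> ?W. (\<exists>i<d. v i = 0) \<and> (\<Sum>i<d. v i ^ d) = 0}"
  define o' where "o' = (\<lambda>i\<in>{..<d}. 0 :: 'a alg_closure)"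
  note fin = finite_subset[OF _ finite_PiE_twisted[OF \<xi>]]
  have tor: "v \<in> (\<Pi>\<^sub>E i\<in>{..<d}. twisted (\<xi> i) - {0}) \<longleftrightarrow> v \<in> ?W \<and> (\<forall>i<d. v i \<noteq> 0)" for v
    by (auto simp: PiE_iff)
  have p0: "(\<Prod>i<d. v i) = 0 \<longleftrightarrow> (\<exists>i<d. v i = 0)" for v :: "nat \<Rightarrow> 'a alg_closure" by auto
  have 1: "fermat \<xi> = Z \<union> fermat_torus \<xi>" "Z \<inter> fermat_torus \<xi> = {}"
    by (auto simp: fermat_def fermat_torus_def tor Z_def)
  have o'W: "o' \<in> ?W" by (auto simp: o'_def)
  have s0: "(\<Sum>i<d. o' i ^ d) = 0" using d_pos by (simp add: o'_def zero_power)
  have oz: "v = o'" if "v \<in> ?W" "\<forall>i<d. v i = 0" for v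
    using that by (auto simp: o'_def PiE_iff extensional_def fun_eq_iff)
  have 2: "insert o' (dwork_cone lam \<xi>) = Z \<union> dwork_torus lam \<xi>"
  proof (intro equalityI subsetI)
    fix v assume v: "v \<in> insert o' (dwork_cone lam \<xi>)"
    show "v \<in> Z \<union> dwork_torus lam \<xi>"
    proof (cases "v = o'")
      case True
      then show ?thesis using o'W s0 d_pos by (auto simp: Z_def o'_def)
    next
      case False
      then have c: "v \<in> ?W" "(\<Sum>i<d. v i ^ d) = of_nat d * to_ac lam * (\<Prod>i<d. v i)"
        using v by (auto simp: dwork_cone_def)
      show ?thesis
      proof (cases "\<exists>i<d. v i = 0")
        case True
        then have "(\<Sum>i<d. v i ^ d) = 0" using c(2) p0[of v] by simp
        then show ?thesis using c(1) True by (simp add: Z_def)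
      next
        case False
        then show ?thesis using c by (simp add: dwork_torus_def tor)
      qed
    qed
  next
    fix v assume "v \<in> Z \<union> dwork_torus lam \<xi>"
    then show "v \<in> insert o' (dwork_cone lam \<xi>)"
    proof
      assume v: "v \<in> Z"
      then have "(\<Sum>i<d. v i ^ d) = of_nat d * to_ac lam * (\<Prod>i<d. v i)" using p0[of v] by (auto simp: Z_def)
      then show ?thesis using v oz[of v] by (auto simp: Z_def dwork_cone_def)
    next
      assume "v \<in> dwork_torus lam \<xi>"
      then show ?thesis using d_pos by (auto simp: dwork_torus_def tor dwork_cone_def)
    qed
  qed
  have 3: "Z \<inter> dwork_torus lam \<xi> = {}" by (auto simp: Z_def dwork_torus_def tor)
  have f: "finite Z" "finite (fermat_torus \<xi>)" "finite (dwork_torus lam \<xi>)" "finite (dwork_cone lam \<xi>)"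
    by (rule fin, auto simp: Z_def fermat_torus_def dwork_torus_def dwork_cone_def tor)+
  have "o' \<notin> dwork_cone lam \<xi>" by (auto simp: dwork_cone_def o'_def)
  then have "card (dwork_cone lam \<xi>) + 1 = card Z + card (dwork_torus lam \<xi>)"
    using card_Un_disjoint[OF f(1,3) 3] f(4) unfolding 2[symmetric] by simp
  moreover have "card (fermat \<xi>) = card Z + card (fermat_torus \<xi>)"
    unfolding 1(1) by (rule card_Un_disjoint[OF f(1,2) 1(2)])
  ultimately show ?thesis by simp
qed

text \<open>
  The Fourier expansions with and without the coordinate \<open>0\<close> differ in each coordinate by
  the value that the trivial character takes at \<open>0\<close>.
\<close>

lemma fermat_minus_torus:
  assumes w_sum: "int d dvd (\<Sum>i<d. w i)"
  shows "(\<Sum>\<xi>\<in>Gt. (\<Prod>i<d. \<phi> (\<xi> i) powi w i) * (of_nat (card (fermat \<xi>)) - of_nat (card (fermat_torus \<xi>)))) =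
    of_nat (card Gt) / Q * (\<Sum>m<d. of_bool (\<forall>i<d. int d dvd w i + int m) * (Q ^ d - (Q - 1) ^ d)
      - of_bool (\<exists>i<d. int d dvd w i + int m) * (Q - 1) * (\<Prod>i<d. gsum (\<theta>p (w i + int m))))"
    (is "?S = of_nat (card Gt) / Q * ?R")
proof -
  let ?h = "\<lambda>s i m. \<Sum>u\<in>U. \<theta>p (w i + int m) u * \<psi> (s * u)"
  let ?b = "\<lambda>i m. of_bool (int d dvd w i + int m) :: complex"
  have pull: "(\<Prod>i<d. of_nat d * f i) = of_nat d ^ d * (\<Prod>i<d. f i)" for f :: "nat \<Rightarrow> complex"
    by (simp only: prod.distrib prod_constant card_lessThan)
  let ?E1 = "\<Sum>\<xi>\<in>Gt. (\<Prod>i<d. \<phi> (\<xi> i) powi w i) * of_nat (card (fermat \<xi>))"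
  let ?E2 = "\<Sum>\<xi>\<in>Gt. (\<Prod>i<d. \<phi> (\<xi> i) powi w i) * of_nat (card (fermat_torus \<xi>))"
  have E1: "of_nat d * Q * ?E1 = (\<Sum>m<d. \<Sum>s\<in>ext_field r. \<Prod>i<d. of_nat d * (?h s i m + ?b i m))"
    using fermat_fourier[of twisted w, OF subset_refl] unfolding coord_sum_zero fermat_def[symmetric] .
  have E2: "of_nat d * Q * ?E2 = (\<Sum>m<d. \<Sum>s\<in>ext_field r. \<Prod>i<d. of_nat d * ?h s i m)"
    using fermat_fourier[of "\<lambda>\<xi>. twisted \<xi> - {0}" w, OF Diff_subset]
    unfolding coord_sum fermat_torus_def[symmetric] .
  have "?S = ?E1 - ?E2" by (simp only: right_diff_distrib sum_subtractf)
  then have "of_nat d * Q * ?S = of_nat d * Q * ?E1 - of_nat d * Q * ?E2"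
    by (simp only: right_diff_distrib)
  also have "\<dots> = (\<Sum>m<d. \<Sum>s\<in>ext_field r. \<Prod>i<d. of_nat d * (?h s i m + ?b i m)) -
      (\<Sum>m<d. \<Sum>s\<in>ext_field r. \<Prod>i<d. of_nat d * ?h s i m)"
    by (simp only: E1 E2)
  also have "\<dots> = of_nat d ^ d * (\<Sum>m<d. (\<Sum>s\<in>ext_field r. \<Prod>i<d. ?h s i m + ?b i m) -
      (\<Sum>s\<in>ext_field r. \<Prod>i<d. ?h s i m))"
    unfolding pull by (simp only: sum_distrib_left sum_subtractf right_diff_distrib)
  also have "(\<Sum>m<d. (\<Sum>s\<in>ext_field r. \<Prod>i<d. ?h s i m + ?b i m) -
      (\<Sum>s\<in>ext_field r. \<Prod>i<d. ?h s i m)) = ?R"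
  proof (intro sum.cong refl)
    fix m
    have "int d dvd (\<Sum>i<d. w i + int m)" using w_sum by (simp add: sum.distrib)
    then show "(\<Sum>s\<in>ext_field r. \<Prod>i<d. ?h s i m + ?b i m) - (\<Sum>s\<in>ext_field r. \<Prod>i<d. ?h s i m) =
      of_bool (\<forall>i<d. int d dvd w i + int m) * (Q ^ d - (Q - 1) ^ d)
      - of_bool (\<exists>i<d. int d dvd w i + int m) * (Q - 1) * (\<Prod>i<d. gsum (\<theta>p (w i + int m)))"
      by (rule fourier_difference)
  qed
  also have "of_nat d ^ d * ?R = of_nat d * (of_nat (card Gt) * ?R)"
  proof -
    have "(of_nat d ^ d :: complex) = of_nat d * of_nat d ^ (d - 1)"
      using d_pos by (cases d) simp_all
    then show ?thesis unfolding card_Gt by (simp only: mult.assoc)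
  qed
  finally have "of_nat d * (Q * ?S) = of_nat d * (of_nat (card Gt) * ?R)" by (simp only: mult.assoc)
  then have "Q * ?S = of_nat (card Gt) * ?R" using d_pos by (simp only: mult_cancel_left) simp
  then have "?S = of_nat (card Gt) * ?R / Q" by (subst nonzero_eq_divide_eq[OF Q_nonzero]) (simp only: mult.commute)
  then show ?thesis by (simp only: times_divide_eq_left)
qed

text \<open>
  Arbitrary \<open>d\<close>th roots of the \<open>p * t i\<close> have a product whose \<open>d\<close>th power is \<open>p ^ d\<close>, so
  changing one of them by a root of unity \<open>e\<close> gives the product \<open>p\<close>.
\<close>

lemma ex_root_vector:
  assumes p: "p \<in> U" and t: "t \<in> {..<d} \<rightarrow>\<^sub>E U" "(\<Prod>i<d. t i) = 1"
  shows "\<exists>\<rho>. (\<forall>i<d. \<rho> i ^ d = p * t i) \<and> (\<Prod>i<d. \<rho> i) = p"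
proof -
  have "\<exists>y. y ^ d = p * t i" for i by (rule nth_root_exists[OF d_pos])
  then obtain s where s: "\<And>i. s i ^ d = p * t i" by metis
  have s0: "s i \<noteq> 0" if "i < d" for i
  proof
    assume "s i = 0"
    then have "p * t i = 0" using s[of i] d_pos by (simp add: zero_power)
    then show False using p t(1) that by (auto simp: PiE_iff)
  qed
  \<comment> \<open>The correction is put into the coordinate \<open>0\<close>.\<close>
  define e where "e = p / (\<Prod>i<d. s i)"
  have "(\<Prod>i<d. s i) ^ d = (\<Prod>i<d. p * t i)" by (simp only: prod_power_distrib s)
  also have "\<dots> = p ^ d" by (simp add: prod.distrib t(2))
  finally have ed: "e ^ d = 1" using p by (simp add: e_def power_divide)
  define \<rho> where "\<rho> i = (if i = 0 then e else 1) * s i" for i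
  have "(\<Prod>i<d. \<rho> i) = e * (\<Prod>i<d. s i)"
    unfolding \<rho>_def prod.distrib using d_pos by simp
  also have "\<dots> = p" using s0 by (simp add: e_def)
  finally have "(\<Prod>i<d. \<rho> i) = p" .
  moreover have "\<rho> i ^ d = p * t i" for i by (simp add: \<rho>_def power_mult_distrib ed s)
  ultimately show ?thesis by blast
qed

text \<open>
  A vector \<open>v\<close> with nonzero coordinates is encoded by \<open>p = (\<Prod>i<d. v i)\<close> and
  \<open>t i = v i ^ d / p\<close>. Division by \<open>p\<close> makes the equation of the Dwork hypersurface
  independent of \<open>p\<close>: it becomes \<open>(\<Sum>i<d. t i) = d * lam\<close>, together with \<open>(\<Prod>i<d. t i) = 1\<close>.
  The vectors with given \<open>p\<close> and \<open>t\<close> are the multiples of one of them by the elements of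
  \<open>Gt\<close>, and \<open>p\<close> does not affect the character value, since the product of the characters is
  trivial.
\<close>

lemma dwork_torus_sum:
  fixes w :: "nat \<Rightarrow> int"
  assumes w_sum: "int d dvd (\<Sum>i<d. w i)"
  shows "(\<Sum>\<xi>\<in>Gt. (\<Prod>i<d. \<phi> (\<xi> i) powi w i) * of_nat (card (dwork_torus lam \<xi>))) =
    of_nat (card Gt) * (Q - 1) *
    (\<Sum>t | t \<in> {..<d} \<rightarrow>\<^sub>E U \<and> (\<Sum>i<d. t i) = of_nat d * to_ac lam \<and> (\<Prod>i<d. t i) = 1. \<Prod>i<d. \<theta>p (w i) (t i))"
proof -
  define c where "c = of_nat d * to_ac lam"
  define T where "T = {t. t \<in> {..<d} \<rightarrow>\<^sub>E U \<and> (\<Sum>i<d. t i) = c \<and> (\<Prod>i<d. t i) = 1}"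
  define g where "g t = (\<Prod>i<d. \<theta>p (w i) (t i))" for t
  define \<rho> where "\<rho> p t = (SOME \<rho>. (\<forall>i<d. \<rho> i ^ d = p * t i) \<and> (\<Prod>i<d. \<rho> i) = p)"
    for p and t :: "nat \<Rightarrow> 'a alg_closure"
  have \<rho>_spec: "(\<forall>i<d. \<rho> p t i ^ d = p * t i) \<and> (\<Prod>i<d. \<rho> p t i) = p" if "p \<in> U" "t \<in> T" for p t
    unfolding \<rho>_def using that by (intro someI_ex[OF ex_root_vector]) (simp_all add: T_def)
  have \<rho>: "\<rho> p t i ^ d = p * t i" if "p \<in> U" "t \<in> T" "i < d" for p t i
    using \<rho>_spec[OF that(1,2)] that(3) by blast
  have \<rho>p: "(\<Prod>i<d. \<rho> p t i) = p" if "p \<in> U" "t \<in> T" for p t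
    using \<rho>_spec[OF that] by blast
  have TU: "t i \<in> U" if "t \<in> T" "i < d" for t i using that by (auto simp: T_def PiE_iff)
  have finT: "finite T"
    unfolding T_def by (rule finite_subset[of _ "{..<d} \<rightarrow>\<^sub>E U"]) (auto intro!: finite_PiE simp: finite_k)
  have fin: "finite (dwork_torus lam \<xi>)" if "\<xi> \<in> Gt" for \<xi>
  proof -
    have "(\<Pi>\<^sub>E i\<in>{..<d}. twisted (\<xi> i) - {0}) \<subseteq> (\<Pi>\<^sub>E i\<in>{..<d}. twisted (\<xi> i))"
      by (rule PiE_mono) auto
    then show ?thesis
      unfolding dwork_torus_def by (intro finite_subset[OF _ finite_PiE_twisted[OF that]]) blast
  qed
  have \<rho>0: "\<rho> p t i \<noteq> 0" if "p \<in> U" "t \<in> T" "i < d" for p t i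
    using \<rho>[OF that] TU[OF that(2,3)] that(1) d_pos by (auto simp: zero_power)
  have \<mu>d: "to_ac \<zeta> ^ d = 1" if "\<zeta> \<in> \<mu>" for \<zeta> using that by (simp add: \<mu>_def flip: to_ac_power)
  have Sig: "(\<Sum>\<xi>\<in>Gt. (\<Prod>i<d. \<phi> (\<xi> i) powi w i) * of_nat (card (dwork_torus lam \<xi>))) =
      (\<Sum>(\<xi>, v)\<in>Sigma Gt (dwork_torus lam). \<Prod>i<d. \<phi> (\<xi> i) powi w i)"
  proof -
    have "(\<Sum>\<xi>\<in>Gt. \<Sum>v\<in>dwork_torus lam \<xi>. \<Prod>i<d. \<phi> (\<xi> i) powi w i) =
        (\<Sum>(\<xi>, v)\<in>Sigma Gt (dwork_torus lam). \<Prod>i<d. \<phi> (\<xi> i) powi w i)"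
      by (rule sum.Sigma[OF finite_Gt]) (use fin in blast)
    then show ?thesis by (simp only: sum_constant mult.commute)
  qed
  have mem: "(\<xi>, v) \<in> Sigma Gt (dwork_torus lam) \<longleftrightarrow>
      \<xi> \<in> {..<d} \<rightarrow>\<^sub>E \<mu> \<and> (\<Prod>i<d. \<xi> i) = 1 \<and> v \<in> extensional {..<d} \<and>
      (\<forall>i<d. v i \<in> V \<and> frob_quot (v i) = \<xi> i) \<and> (\<Sum>i<d. v i ^ d) = c * (\<Prod>i<d. v i)" for \<xi> v
  proof -
    have "v i \<in> twisted (\<xi> i) - {0} \<longleftrightarrow> v i \<in> V \<and> frob_quot (v i) = \<xi> i" if "\<xi> \<in> {..<d} \<rightarrow>\<^sub>E \<mu>" "i < d" for i
      using twisted_nonzero[of "\<xi> i"] that by (auto simp: PiE_iff)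
    then show ?thesis unfolding dwork_torus_def Gt_def c_def by (auto simp: PiE_iff)
  qed
  \<comment> \<open>The bijection \<open>(\<xi>, v) \<leftrightarrow> (\<zeta>, p, t)\<close>, where \<open>\<zeta>\<close> compares \<open>v\<close> with the chosen vector \<open>\<rho> p t\<close>.\<close>
  define to_v where "to_v z = (case z of (\<zeta>, p, t) \<Rightarrow> \<lambda>i\<in>{..<d}. to_ac (\<zeta> i) * \<rho> p t i)"
    for z :: "(nat \<Rightarrow> 'a) \<times> 'a alg_closure \<times> (nat \<Rightarrow> 'a alg_closure)"
  define bwd where "bwd z = ((\<lambda>i\<in>{..<d}. frob_quot (to_v z i)), to_v z)" for z
  define tv where "tv v = (\<lambda>i\<in>{..<d}. v i ^ d / (\<Prod>i<d. v i))" for v :: "nat \<Rightarrow> 'a alg_closure"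
  define fwd where "fwd y = (case y of (\<xi> :: nat \<Rightarrow> 'a, v) \<Rightarrow>
      ((\<lambda>i\<in>{..<d}. the_inv to_ac (v i / \<rho> (\<Prod>i<d. v i) (tv v) i)), (\<Prod>i<d. v i), tv v))" for y
  have "(\<Sum>(\<xi>, v)\<in>Sigma Gt (dwork_torus lam). \<Prod>i<d. \<phi> (\<xi> i) powi w i) =
      (\<Sum>(\<zeta>, p, t)\<in>Gt \<times> U \<times> T. g t)"
  proof (rule sum.reindex_bij_witness[of _ bwd fwd])
    fix y assume "y \<in> Sigma Gt (dwork_torus lam)"
    then obtain \<xi> v where y: "y = (\<xi>, v)" and yS: "(\<xi>, v) \<in> Sigma Gt (dwork_torus lam)" by (cases y) auto
    note m = yS[unfolded mem]
    have vV: "v i \<in> V" "frob_quot (v i) = \<xi> i" if "i < d" for i using m that by auto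
    define p where "p = (\<Prod>i<d. v i)"
    have p0: "p \<noteq> 0" using V_nonzero vV(1) by (simp add: p_def)
    have "p ^ (q - 1) = (\<Prod>i<d. to_ac (\<xi> i))"
      unfolding p_def prod_power_distrib
    proof (intro prod.cong refl)
      fix i assume "i \<in> {..<d}"
      then have i: "i < d" by simp
      show "v i ^ (q - 1) = to_ac (\<xi> i)"
        using frob_quot_V(2)[OF vV(1)[OF i]] unfolding vV(2)[OF i] by (rule sym)
    qed
    also have "\<dots> = to_ac (\<Prod>i<d. \<xi> i)" by (simp add: to_ac_prod)
    finally have "p ^ (q - 1) = 1" using m by simp
    then have pU: "p \<in> U" using p0 by (simp add: in_k_iff pow_q)
    have tT: "tv v \<in> T"
    proof -
      have "v i ^ d / p \<in> U" if "i < d" for i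
        using U_mult[OF _ U_inverse[OF pU], of "v i ^ d"] vV(1)[OF that] by (simp add: V_def divide_inverse)
      moreover have "(\<Sum>i<d. v i ^ d / p) = c"
        using m p0 by (simp add: p_def[symmetric] flip: sum_divide_distrib)
      moreover have "(\<Prod>i<d. v i ^ d / p) = 1"
        using p0 by (simp add: prod_dividef p_def[symmetric] flip: prod_power_distrib)
      ultimately show ?thesis by (auto simp: T_def tv_def p_def[symmetric])
    qed
    note \<rho>' = \<rho>[OF pU tT] and \<rho>p' = \<rho>p[OF pU tT] and \<rho>0' = \<rho>0[OF pU tT]
    have tvi: "tv v i = v i ^ d / p" if "i < d" for i using that by (simp add: tv_def p_def)
    have ex: "\<exists>x\<in>\<mu>. to_ac x = v i / \<rho> p (tv v) i" if "i < d" for i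
      using \<rho>'[OF that] tvi[OF that] p0 V_nonzero[OF vV(1)[OF that]]
      by (intro root_of_unity_in_range) (simp add: power_divide)
    define \<zeta> where "\<zeta> i = the_inv to_ac (v i / \<rho> p (tv v) i)" for i
    have \<zeta>: "\<zeta> i \<in> \<mu>" "to_ac (\<zeta> i) = v i / \<rho> p (tv v) i" if "i < d" for i
      using ex[OF that] unfolding \<zeta>_def by (metis the_inv_to_ac)+
    have fy: "fwd y = ((\<lambda>i\<in>{..<d}. \<zeta> i), p, tv v)" by (simp add: fwd_def y \<zeta>_def p_def)
    have "to_ac (\<Prod>i<d. \<zeta> i) = to_ac 1"
      using \<zeta>(2) \<rho>p' p0 by (simp add: to_ac_prod prod_dividef p_def[symmetric])
    then have "(\<Prod>i<d. \<zeta> i) = 1" by (simp only: to_ac_eq_iff)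
    then have "(\<lambda>i\<in>{..<d}. \<zeta> i) \<in> Gt" using \<zeta>(1) by (auto simp: Gt_def)
    then show "fwd y \<in> Gt \<times> U \<times> T" unfolding fy using pU tT by blast
    have tovy: "to_v (fwd y) = v"
      using m \<zeta>(2) \<rho>0' unfolding fy to_v_def by (auto simp: fun_eq_iff extensional_def)
    show "bwd (fwd y) = y"
      unfolding bwd_def tovy unfolding y using vV(2) m by (auto simp: fun_eq_iff PiE_iff extensional_def)
    have "g (tv v) = (\<Prod>i<d. \<theta>p (w i) p) * g (tv v)"
      by (simp only: theta_p_prod_one[OF w_sum pU] mult_1_left)
    also have "\<dots> = (\<Prod>i<d. \<theta>p (w i) (p * tv v i))"
      unfolding g_def prod.distrib[symmetric]
      using pU TU[OF tT] by (intro prod.cong refl char_mult[OF theta_p_in, symmetric]) auto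
    also have "\<dots> = (\<Prod>i<d. \<phi> (\<xi> i) powi w i)"
    proof (intro prod.cong refl)
      fix i assume "i \<in> {..<d}"
      then have i: "i < d" by simp
      have "p * tv v i = v i ^ d" using tvi[OF i] p0 by simp
      then show "\<theta>p (w i) (p * tv v i) = \<phi> (\<xi> i) powi w i"
        using char_pow_apply[OF theta, of "v i ^ d" "w i"] vV[OF i] frob_quot_V(3)[OF vV(1)[OF i]]
        by (simp add: V_def)
    qed
    finally show "(case fwd y of (\<zeta>, p, t) \<Rightarrow> g t) = (case y of (\<xi>, v) \<Rightarrow> \<Prod>i<d. \<phi> (\<xi> i) powi w i)"
      unfolding fy unfolding y by simp
  next
    fix z assume "z \<in> Gt \<times> U \<times> T"
    then obtain \<zeta> p t where z: "z = (\<zeta>, p, t)" and \<zeta>: "\<zeta> \<in> Gt" and pU: "p \<in> U" and tT: "t \<in> T" by auto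
    note \<rho>' = \<rho>[OF pU tT] and \<rho>p' = \<rho>p[OF pU tT] and \<rho>0' = \<rho>0[OF pU tT]
    define v where "v = to_v z"
    have vi: "v i = to_ac (\<zeta> i) * \<rho> p t i" if "i < d" for i using that by (simp add: v_def to_v_def z)
    have vd: "v i ^ d = p * t i" if "i < d" for i
      using vi[OF that] \<mu>d[OF Gt_mu[OF \<zeta> that]] \<rho>'[OF that] by (simp add: power_mult_distrib)
    have vV: "v i \<in> V" if "i < d" for i
      using U_mult[OF pU TU[OF tT that]] unfolding V_def mem_Collect_eq vd[OF that] .
    have "(\<Prod>i<d. v i) = (\<Prod>i<d. to_ac (\<zeta> i) * \<rho> p t i)" using vi by (intro prod.cong refl) simp
    also have "\<dots> = to_ac (\<Prod>i<d. \<zeta> i) * p" by (simp add: prod.distrib \<rho>p' to_ac_prod)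
    also have "\<dots> = p" using \<zeta> by (simp add: Gt_def)
    finally have vp: "(\<Prod>i<d. v i) = p" .
    have tvt: "tv v = t"
      using vd vp pU tT by (auto simp: tv_def fun_eq_iff T_def PiE_iff extensional_def)
    have bz: "bwd z = ((\<lambda>i\<in>{..<d}. frob_quot (v i)), v)" by (simp add: bwd_def v_def)
    have fq: "(\<Prod>i<d. frob_quot (v i)) = 1"
    proof -
      have "to_ac (\<Prod>i<d. frob_quot (v i)) = (\<Prod>i<d. v i ^ (q - 1))"
        unfolding to_ac_prod using frob_quot_V(2)[OF vV] by (intro prod.cong refl) simp
      also have "\<dots> = p ^ (q - 1)" by (simp only: vp flip: prod_power_distrib)
      also have "\<dots> = to_ac 1" using U_power_card[OF pU] unfolding card_U card_k by simp
      finally show ?thesis by (simp only: to_ac_eq_iff)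
    qed
    have "(\<Sum>i<d. v i ^ d) = p * (\<Sum>i<d. t i)" using vd by (simp add: sum_distrib_left)
    then have eq: "(\<Sum>i<d. v i ^ d) = c * (\<Prod>i<d. v i)" using tT vp by (simp add: T_def mult.commute)
    have "v \<in> extensional {..<d}" by (auto simp: v_def to_v_def z)
    then show "bwd z \<in> Sigma Gt (dwork_torus lam)"
      unfolding bz mem using vV frob_quot_V(1) fq eq by auto
    show "fwd (bwd z) = z"
    proof -
      have "the_inv to_ac (v i / \<rho> p t i) = \<zeta> i" if "i < d" for i
        using vi[OF that] \<rho>0'[OF that] by simp
      then have "(\<lambda>i\<in>{..<d}. the_inv to_ac (v i / \<rho> p t i)) = \<zeta>"
        using \<zeta> by (auto simp: fun_eq_iff Gt_def PiE_iff extensional_def)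
      then show ?thesis unfolding bz fwd_def by (simp add: vp tvt z)
    qed
  qed
  also have "\<dots> = (\<Sum>\<zeta>\<in>Gt. \<Sum>p\<in>U. \<Sum>t\<in>T. g t)"
    by (simp only: sum.cartesian_product)
  also have "\<dots> = of_nat (card Gt) * (Q - 1) * (\<Sum>t\<in>T. g t)"
    unfolding sum_constant of_nat_card_U by (simp only: mult.assoc)
  finally show ?thesis unfolding Sig T_def g_def c_def .
qed

end

section \<open>The group action and its fixed points\<close>

lemma proj_pointI: "c \<noteq> 0 \<Longrightarrow> u = (\<lambda>i\<in>{..<d}. c * v i) \<Longrightarrow> u \<in> proj_point d v"
  unfolding proj_point_def by blast

lemma proj_pointE:
  assumes "u \<in> proj_point d v"
  obtains c where "c \<noteq> 0" "u = (\<lambda>i\<in>{..<d}. c * v i)"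
  using assms unfolding proj_point_def by blast

lemma proj_point_subset:
  fixes u v :: "nat \<Rightarrow> 'k::field"
  assumes c: "c \<noteq> 0" "\<And>i. i < d \<Longrightarrow> u i = c * v i"
  shows "proj_point d u \<subseteq> proj_point d v"
proof
  fix x assume "x \<in> proj_point d u"
  then obtain a where a: "a \<noteq> 0" "x = (\<lambda>i\<in>{..<d}. a * u i)" by (rule proj_pointE)
  show "x \<in> proj_point d v"
  proof (rule proj_pointI)
    show "a * c \<noteq> 0" using a(1) c(1) by simp
    show "x = (\<lambda>i\<in>{..<d}. (a * c) * v i)" unfolding a(2) by (rule restrict_ext) (simp add: c(2))
  qed
qed

lemma proj_point_eq_iff:
  fixes u v :: "nat \<Rightarrow> 'k::field"
  shows "proj_point d u = proj_point d v \<longleftrightarrow> (\<exists>c. c \<noteq> 0 \<and> (\<forall>i<d. u i = c * v i))"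
proof
  assume "proj_point d u = proj_point d v"
  moreover have "(\<lambda>i\<in>{..<d}. 1 * u i) \<in> proj_point d u" by (rule proj_pointI[OF _ refl]) simp
  ultimately have "(\<lambda>i\<in>{..<d}. 1 * u i) \<in> proj_point d v" by simp
  then obtain c where c: "c \<noteq> 0" "(\<lambda>i\<in>{..<d}. 1 * u i) = (\<lambda>i\<in>{..<d}. c * v i)" by (rule proj_pointE)
  have "u i = c * v i" if "i < d" for i using fun_cong[OF c(2), of i] that by simp
  then show "\<exists>c. c \<noteq> 0 \<and> (\<forall>i<d. u i = c * v i)" using c(1) by blast
next
  assume "\<exists>c. c \<noteq> 0 \<and> (\<forall>i<d. u i = c * v i)"
  then obtain c where c: "c \<noteq> 0" "\<And>i. i < d \<Longrightarrow> u i = c * v i" by blast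
  have "v i = inverse c * u i" if "i < d" for i using c that by simp
  then show "proj_point d u = proj_point d v"
    using proj_point_subset[of c d u v, OF c] proj_point_subset[of "inverse c" d v u] c(1) by simp
qed

text \<open>
  Every scalar is a power with exponent \<open>CARD('a)\<close>, so the image of a line is again a line.
\<close>

lemma frob_proj_point:
  "frob d (proj_point d v) = proj_point d (\<lambda>i. v i ^ CARD('a))"
  for v :: "nat \<Rightarrow> 'a::{field,finite} alg_closure"
proof (intro equalityI subsetI)
  fix u assume "u \<in> frob d (proj_point d v)"
  then obtain x where x: "x \<in> proj_point d v" "u = (\<lambda>i\<in>{..<d}. x i ^ CARD('a))"
    unfolding frob_def by (elim imageE) simp
  from x(1) obtain c where c: "c \<noteq> 0" "x = (\<lambda>i\<in>{..<d}. c * v i)" by (rule proj_pointE)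
  show "u \<in> proj_point d (\<lambda>i. v i ^ CARD('a))"
  proof (rule proj_pointI)
    show "c ^ CARD('a) \<noteq> 0" using c(1) by simp
    show "u = (\<lambda>i\<in>{..<d}. c ^ CARD('a) * v i ^ CARD('a))"
      unfolding x(2) c(2) by (rule restrict_ext) (simp add: power_mult_distrib)
  qed
next
  fix u assume "u \<in> proj_point d (\<lambda>i. v i ^ CARD('a))"
  then obtain c where c: "c \<noteq> 0" "u = (\<lambda>i\<in>{..<d}. c * v i ^ CARD('a))" by (rule proj_pointE)
  have C: "CARD('a) > 0" by simp
  obtain b where b: "b ^ CARD('a) = c" using nth_root_exists[OF C] by blast
  then have b0: "b \<noteq> 0" using c(1) by (auto simp: zero_power)
  show "u \<in> frob d (proj_point d v)"
    unfolding frob_def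
  proof (rule image_eqI)
    show "(\<lambda>i\<in>{..<d}. b * v i) \<in> proj_point d v" by (rule proj_pointI[OF b0 refl])
    show "u = (\<lambda>i\<in>{..<d}. (\<lambda>i\<in>{..<d}. b * v i) i ^ CARD('a))"
      unfolding c(2) by (rule restrict_ext) (simp add: power_mult_distrib b)
  qed
qed

lemma frob_pow_proj_point:
  "(frob d ^^ n) (proj_point d v) = proj_point d (\<lambda>i. v i ^ (CARD('a) ^ n))"
  for v :: "nat \<Rightarrow> 'a::{field,finite} alg_closure"
proof (induction n)
  case (Suc n)
  then show ?case by (simp add: frob_proj_point mult.commute flip: power_mult)
qed simp

context dwork_setting
begin

interpretation F: finite_subfield "UNIV :: 'a set" by (rule finite_subfield_UNIV)

definition vec_times :: "(nat \<Rightarrow> 'a) \<Rightarrow> (nat \<Rightarrow> 'a) \<Rightarrow> nat \<Rightarrow> 'a" where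
  "vec_times \<xi> \<zeta> = (\<lambda>i\<in>{..<d}. \<xi> i * \<zeta> i)"

lemma mu_mult: "x \<in> \<mu> \<Longrightarrow> y \<in> \<mu> \<Longrightarrow> x * y \<in> \<mu>"
  by (simp add: \<mu>_def power_mult_distrib)

lemma mu_inverse: "x \<in> \<mu> \<Longrightarrow> inverse x \<in> \<mu>"
  by (simp add: \<mu>_def power_inverse)

lemma one_mu: "1 \<in> \<mu>" by (simp add: \<mu>_def)

lemma Gt_ext: "\<xi> \<in> Gt \<Longrightarrow> \<zeta> \<in> Gt \<Longrightarrow> (\<And>i. i < d \<Longrightarrow> \<xi> i = \<zeta> i) \<Longrightarrow> \<xi> = \<zeta>"
  by (rule PiE_ext[of _ "{..<d}" "\<lambda>_. \<mu>"]) (auto simp: Gt_def)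

lemma Gt_mult: "\<xi> \<in> Gt \<Longrightarrow> \<zeta> \<in> Gt \<Longrightarrow> vec_times \<xi> \<zeta> \<in> Gt"
  by (auto simp: Gt_def vec_times_def mu_mult PiE_iff prod.distrib)

lemma Gt_one: "(\<lambda>i\<in>{..<d}. 1) \<in> Gt"
  by (auto simp: Gt_def one_mu)

lemma Gt_inverse: "\<xi> \<in> Gt \<Longrightarrow> (\<lambda>i\<in>{..<d}. inverse (\<xi> i)) \<in> Gt"
  by (auto simp: Gt_def mu_inverse PiE_iff prod_inversef[unfolded comp_def])

lemma Gt_diag: "c \<in> \<mu> \<Longrightarrow> (\<lambda>i\<in>{..<d}. c) \<in> Gt"
  by (auto simp: Gt_def \<mu>_def)

lemma Gtilde_simps:
  "carrier (Gtilde d) = Gt" "\<xi> \<otimes>\<^bsub>Gtilde d\<^esub> \<zeta> = vec_times \<xi> \<zeta>" "\<one>\<^bsub>Gtilde d\<^esub> = (\<lambda>i\<in>{..<d}. 1 :: 'a)"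
  by (simp_all add: Gt_eq) (simp_all add: Gtilde_def vec_times_def)

lemma comm_group_Gtilde: "comm_group (Gtilde d :: (nat \<Rightarrow> 'a) monoid)"
proof (rule comm_groupI, unfold Gtilde_simps)
  show "\<exists>y\<in>Gt. vec_times y \<xi> = (\<lambda>i\<in>{..<d}. 1)" if "\<xi> \<in> Gt" for \<xi>
    using Gt_inverse[OF that] mu_nonzero Gt_mu[OF that]
    by (intro bexI[of _ "\<lambda>i\<in>{..<d}. inverse (\<xi> i)"]) (auto simp: vec_times_def intro!: restrict_ext)
  show "vec_times (\<lambda>i\<in>{..<d}. 1) \<xi> = \<xi>" if "\<xi> \<in> Gt" for \<xi>
    by (rule Gt_ext[OF Gt_mult[OF Gt_one that] that]) (simp add: vec_times_def)
  show "vec_times \<xi> \<zeta> \<in> Gt" if "\<xi> \<in> Gt" "\<zeta> \<in> Gt" for \<xi> \<zeta> by (rule Gt_mult[OF that])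
  show "vec_times (vec_times x y) z = vec_times x (vec_times y z)" for x y z
    unfolding vec_times_def by (rule restrict_ext) (simp add: mult_ac)
  show "vec_times x y = vec_times y x" for x y
    unfolding vec_times_def by (rule restrict_ext) (simp add: mult_ac)
qed (rule Gt_one)

lemma Gdiag_eq: "Gdiag d = (\<lambda>c. \<lambda>i\<in>{..<d}. c) ` \<mu>"
  by (auto simp: Gdiag_def \<mu>_def)

lemma normal_Gdiag: "Gdiag d \<lhd> (Gtilde d :: (nat \<Rightarrow> 'a) monoid)"
proof -
  interpret G: comm_group "Gtilde d :: (nat \<Rightarrow> 'a) monoid" by (rule comm_group_Gtilde)
  have "subgroup (Gdiag d) (Gtilde d :: (nat \<Rightarrow> 'a) monoid)"
  proof (rule G.subgroupI)
    show "Gdiag d \<subseteq> carrier (Gtilde d :: (nat \<Rightarrow> 'a) monoid)"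
      unfolding Gdiag_eq Gtilde_simps using Gt_diag by blast
    show "Gdiag d \<noteq> ({} :: (nat \<Rightarrow> 'a) set)" unfolding Gdiag_eq using one_mu by blast
    fix a assume "a \<in> (Gdiag d :: (nat \<Rightarrow> 'a) set)"
    then obtain c where c: "c \<in> \<mu>" "a = (\<lambda>i\<in>{..<d}. c)" unfolding Gdiag_eq by blast
    have "inv\<^bsub>Gtilde d\<^esub> a = (\<lambda>i\<in>{..<d}. inverse c)"
      using c mu_nonzero[OF c(1)]
      by (intro G.inv_equality)
         (auto simp: Gtilde_simps vec_times_def Gt_diag mu_inverse intro!: restrict_ext)
    then show "inv\<^bsub>Gtilde d\<^esub> a \<in> Gdiag d" unfolding Gdiag_eq using mu_inverse[OF c(1)] by blast
    fix b assume "b \<in> (Gdiag d :: (nat \<Rightarrow> 'a) set)"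
    then obtain e where e: "e \<in> \<mu>" "b = (\<lambda>i\<in>{..<d}. e)" unfolding Gdiag_eq by blast
    have "a \<otimes>\<^bsub>Gtilde d\<^esub> b = (\<lambda>i\<in>{..<d}. c * e)"
      unfolding c e Gtilde_simps vec_times_def by (rule restrict_ext) simp
    then show "a \<otimes>\<^bsub>Gtilde d\<^esub> b \<in> Gdiag d" unfolding Gdiag_eq using mu_mult[OF c(1) e(1)] by blast
  qed
  then show ?thesis by (rule G.subgroup_imp_normal)
qed

text \<open>
  The coset of \<open>\<xi>\<close> modulo the diagonal subgroup.
\<close>

definition gcoset :: "(nat \<Rightarrow> 'a) \<Rightarrow> (nat \<Rightarrow> 'a) set" where
  "gcoset \<xi> = (\<lambda>c. \<lambda>i\<in>{..<d}. c * \<xi> i) ` \<mu>"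

lemma r_coset_Gdiag: "Gdiag d #>\<^bsub>Gtilde d\<^esub> \<xi> = gcoset \<xi>"
proof -
  have "vec_times (\<lambda>i\<in>{..<d}. c) \<xi> = (\<lambda>i\<in>{..<d}. c * \<xi> i)" for c
    unfolding vec_times_def by (rule restrict_ext) simp
  then show ?thesis unfolding r_coset_def Gdiag_eq gcoset_def Gtilde_simps by auto
qed

lemma carrier_dwork_group: "carrier (dwork_group d) = gcoset ` Gt"
  unfolding dwork_group_def FactGroup_def RCOSETS_def by (auto simp: r_coset_Gdiag Gtilde_simps)

lemma inv_dwork_group:
  assumes \<xi>: "\<xi> \<in> Gt"
  shows "inv\<^bsub>dwork_group d\<^esub> (gcoset \<xi>) = gcoset (\<lambda>i\<in>{..<d}. inverse (\<xi> i))"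
proof -
  interpret N: normal "Gdiag d" "Gtilde d :: (nat \<Rightarrow> 'a) monoid" by (rule normal_Gdiag)
  interpret FG: group "dwork_group d :: (nat \<Rightarrow> 'a) set monoid"
    unfolding dwork_group_def by (rule N.factorgroup_is_group)
  let ?i = "\<lambda>i\<in>{..<d}. inverse (\<xi> i)"
  have i: "?i \<in> Gt" by (rule Gt_inverse[OF \<xi>])
  have one: "vec_times ?i \<xi> = (\<lambda>i\<in>{..<d}. 1)"
    unfolding vec_times_def using mu_nonzero Gt_mu[OF \<xi>] by (auto intro!: restrict_ext)
  have "gcoset ?i \<otimes>\<^bsub>dwork_group d\<^esub> gcoset \<xi> = \<one>\<^bsub>dwork_group d\<^esub>"
  proof -
    have "gcoset ?i \<otimes>\<^bsub>dwork_group d\<^esub> gcoset \<xi> = gcoset (vec_times ?i \<xi>)"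
      unfolding dwork_group_def FactGroup_def
      using N.rcos_sum[of ?i \<xi>] i \<xi> by (simp add: r_coset_Gdiag Gtilde_simps)
    also have "\<dots> = Gdiag d"
      unfolding one gcoset_def Gdiag_eq by (intro image_cong refl restrict_ext) simp
    finally show ?thesis by (simp add: dwork_group_def FactGroup_def)
  qed
  then show ?thesis
    by (rule FG.inv_equality) (use i \<xi> in \<open>auto simp: carrier_dwork_group\<close>)
qed

lemma gcoset_subset: "\<xi> \<in> Gt \<Longrightarrow> gcoset \<xi> \<subseteq> Gt"
  using Gt_mult[OF Gt_diag] unfolding gcoset_def vec_times_def
  by (auto simp: image_subset_iff Gt_def PiE_iff prod.distrib mu_mult)

lemma gcoset_self: "\<xi> \<in> Gt \<Longrightarrow> \<xi> \<in> gcoset \<xi>"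
  unfolding gcoset_def using one_mu
  by (intro image_eqI[of _ _ 1]) (auto simp: fun_eq_iff Gt_def PiE_iff extensional_def)

lemma gcoset_eq:
  assumes \<xi>: "\<xi> \<in> Gt" and \<zeta>: "\<zeta> \<in> gcoset \<xi>" shows "gcoset \<zeta> = gcoset \<xi>"
proof -
  interpret N: normal "Gdiag d" "Gtilde d :: (nat \<Rightarrow> 'a) monoid" by (rule normal_Gdiag)
  show ?thesis
    using N.repr_independence[OF _ _ N.subgroup_axioms, of \<zeta> \<xi>] assms
    unfolding r_coset_Gdiag Gtilde_simps by simp
qed

lemma card_dwork_group: "card (carrier (dwork_group d :: (nat \<Rightarrow> 'a) set monoid)) * card \<mu> = card Gt"
  and card_gcoset: "\<xi> \<in> Gt \<Longrightarrow> card (gcoset \<xi>) = card \<mu>"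
proof -
  interpret N: normal "Gdiag d" "Gtilde d :: (nat \<Rightarrow> 'a) monoid" by (rule normal_Gdiag)
  have inj: "inj_on (\<lambda>c. \<lambda>i\<in>{..<d}. c * \<xi> i) \<mu>" if "\<xi> \<in> Gt" for \<xi>
  proof (rule inj_onI)
    fix a b assume "(\<lambda>i\<in>{..<d}. a * \<xi> i) = (\<lambda>i\<in>{..<d}. b * \<xi> i)"
    then have "a * \<xi> 0 = b * \<xi> 0" using d_pos by (metis lessThan_iff restrict_apply')
    then show "a = b" using mu_nonzero[OF Gt_mu[OF that d_pos]] by simp
  qed
  then show "card (gcoset \<xi>) = card \<mu>" if "\<xi> \<in> Gt"
    unfolding gcoset_def using that by (intro card_image)
  have "card (Gdiag d :: (nat \<Rightarrow> 'a) set) = card \<mu>"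
    unfolding Gdiag_eq
    by (intro card_image inj_onI) (metis d_pos lessThan_iff restrict_apply')
  moreover have "carrier (dwork_group d) = rcosets\<^bsub>Gtilde d\<^esub> (Gdiag d :: (nat \<Rightarrow> 'a) set)"
    by (simp add: dwork_group_def FactGroup_def)
  ultimately show "card (carrier (dwork_group d :: (nat \<Rightarrow> 'a) set monoid)) * card \<mu> = card Gt"
    using N.lagrange[OF N.subgroup_axioms] by (simp add: Coset.order_def Gtilde_simps)
qed

lemma sum_over_cosets:
  fixes f :: "(nat \<Rightarrow> 'a) \<Rightarrow> complex"
  assumes h: "\<And>\<xi>. \<xi> \<in> Gt \<Longrightarrow> f \<xi> = h (gcoset \<xi>)"
  shows "(\<Sum>\<xi>\<in>Gt. f \<xi>) = of_nat (card \<mu>) * (\<Sum>g\<in>carrier (dwork_group d). h g)"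
proof -
  have "(\<Sum>\<xi>\<in>Gt. f \<xi>) = (\<Sum>\<xi>\<in>Gt. h (gcoset \<xi>))" using h by (rule sum.cong[OF refl])
  also have "\<dots> = (\<Sum>g\<in>gcoset ` Gt. \<Sum>\<xi> | \<xi> \<in> Gt \<and> gcoset \<xi> = g. h (gcoset \<xi>))"
    by (rule sum.image_gen[OF finite_Gt])
  also have "\<dots> = (\<Sum>g\<in>gcoset ` Gt. of_nat (card \<mu>) * h g)"
  proof (intro sum.cong refl)
    fix g assume "g \<in> gcoset ` Gt"
    then obtain \<xi> where \<xi>: "\<xi> \<in> Gt" "g = gcoset \<xi>" by blast
    have "{\<zeta> \<in> Gt. gcoset \<zeta> = g} = gcoset \<xi>"
      unfolding \<xi>(2) using gcoset_eq[OF \<xi>(1)] gcoset_self gcoset_subset[OF \<xi>(1)] by blast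
    then have "(\<Sum>\<zeta> | \<zeta> \<in> Gt \<and> gcoset \<zeta> = g. h (gcoset \<zeta>)) = (\<Sum>\<zeta>\<in>gcoset \<xi>. h g)"
      by (intro sum.cong) auto
    then show "(\<Sum>\<zeta> | \<zeta> \<in> Gt \<and> gcoset \<zeta> = g. h (gcoset \<zeta>)) = of_nat (card \<mu>) * h g"
      using card_gcoset[OF \<xi>(1)] by simp
  qed
  finally show ?thesis unfolding carrier_dwork_group by (simp only: sum_distrib_left)
qed

lemma Gact_proj_point: "Gact d (gcoset \<zeta>) (proj_point d u) = proj_point d (\<lambda>i. to_ac (\<zeta> i) * u i)"
proof (intro equalityI subsetI)
  fix x assume "x \<in> Gact d (gcoset \<zeta>) (proj_point d u)"
  then obtain \<xi> y where y: "\<xi> \<in> gcoset \<zeta>" "y \<in> proj_point d u" "x = (\<lambda>i\<in>{..<d}. to_ac (\<xi> i) * y i)"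
    unfolding Gact_def by blast
  from y(1) obtain a where a: "a \<in> \<mu>" "\<xi> = (\<lambda>i\<in>{..<d}. a * \<zeta> i)" unfolding gcoset_def by blast
  from y(2) obtain c where c: "c \<noteq> 0" "y = (\<lambda>i\<in>{..<d}. c * u i)" by (rule proj_pointE)
  show "x \<in> proj_point d (\<lambda>i. to_ac (\<zeta> i) * u i)"
  proof (rule proj_pointI)
    show "to_ac a * c \<noteq> 0" using a(1) c(1) mu_nonzero by simp
    show "x = (\<lambda>i\<in>{..<d}. (to_ac a * c) * (to_ac (\<zeta> i) * u i))"
      unfolding y(3) a(2) c(2) by (rule restrict_ext) simp
  qed
next
  fix x assume "x \<in> proj_point d (\<lambda>i. to_ac (\<zeta> i) * u i)"
  then obtain c where c: "c \<noteq> 0" "x = (\<lambda>i\<in>{..<d}. c * (to_ac (\<zeta> i) * u i))" by (rule proj_pointE)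
  have x: "x = (\<lambda>i\<in>{..<d}. to_ac ((\<lambda>i\<in>{..<d}. 1 * \<zeta> i) i) * (\<lambda>i\<in>{..<d}. c * u i) i)"
    unfolding c(2) by (rule restrict_ext) simp
  have "(\<lambda>i\<in>{..<d}. 1 * \<zeta> i) \<in> gcoset \<zeta>" unfolding gcoset_def using one_mu by (rule imageI)
  moreover have "(\<lambda>i\<in>{..<d}. c * u i) \<in> proj_point d u" by (rule proj_pointI[OF c(1) refl])
  ultimately show "x \<in> Gact d (gcoset \<zeta>) (proj_point d u)"
    unfolding Gact_def mem_Collect_eq using x by (intro exI conjI)
qed

lemma fixed_iff:
  assumes \<xi>: "\<xi> \<in> Gt"
  shows "Gact d (inv\<^bsub>dwork_group d\<^esub> (gcoset \<xi>)) ((frob d ^^ r) (proj_point d v)) = proj_point d v \<longleftrightarrow>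
    (\<exists>c. c \<noteq> 0 \<and> (\<forall>i<d. v i ^ q = c * (to_ac (\<xi> i) * v i)))"
proof -
  have "to_ac ((\<lambda>i\<in>{..<d}. inverse (\<xi> i)) i) * v i ^ q = c * v i \<longleftrightarrow> v i ^ q = c * (to_ac (\<xi> i) * v i)"
    if "i < d" for i c
    using mu_nonzero[OF Gt_mu[OF \<xi> that]] that by (auto simp: field_simps)
  then show ?thesis
    unfolding frob_pow_proj_point inv_dwork_group[OF \<xi>] Gact_proj_point proj_point_eq_iff
    unfolding q_eq[symmetric] by auto
qed

text \<open>
  A point is fixed iff some representative \<open>v\<close> satisfies \<open>v i ^ q = c * (\<xi> i * v i)\<close> with a
  scalar \<open>c\<close>. Rescaling by \<open>a\<close> with \<open>a ^ (q - 1) = inverse c\<close> achieves \<open>c = 1\<close>. The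
  representatives with \<open>c = 1\<close> form a torsor under the nonzero scalars with \<open>a ^ q = a\<close>, of
  which there are \<open>q - 1\<close>.
\<close>

lemma card_fixed_points:
  assumes \<xi>: "\<xi> \<in> Gt"
  shows "card (dwork_cone lam \<xi>) =
    card {P \<in> dwork d lam. Gact d (inv\<^bsub>dwork_group d\<^esub> (gcoset \<xi>)) ((frob d ^^ r) P) = P} * (q - 1)"
    (is "_ = card ?P * _")
proof -
  let ?C = "dwork_cone lam \<xi>"
  have fin: "finite ?C"
    unfolding dwork_cone_def by (rule finite_subset[OF _ finite_PiE_twisted[OF \<xi>]]) blast
  have mem: "v \<in> ?C \<longleftrightarrow> v \<in> extensional {..<d} \<and> (\<forall>i<d. v i ^ q = to_ac (\<xi> i) * v i) \<and>
      (\<exists>i<d. v i \<noteq> 0) \<and> (\<Sum>i<d. v i ^ d) = of_nat d * to_ac lam * (\<Prod>i<d. v i)" for v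
    by (auto simp: dwork_cone_def twisted_def PiE_iff)
  \<comment> \<open>Both sides of the equation are homogeneous of degree \<open>d\<close>.\<close>
  have scale_eq: "(\<Sum>i<d. u i ^ d) = of_nat d * to_ac lam * (\<Prod>i<d. u i)"
    if "\<And>i. i < d \<Longrightarrow> u i = c * v i" "(\<Sum>i<d. v i ^ d) = of_nat d * to_ac lam * (\<Prod>i<d. v i)"
    for u v :: "nat \<Rightarrow> 'a alg_closure" and c
  proof -
    have "(\<Sum>i<d. u i ^ d) = c ^ d * (\<Sum>i<d. v i ^ d)"
      using that(1) by (simp add: sum_distrib_left power_mult_distrib)
    moreover have "(\<Prod>i<d. u i) = c ^ d * (\<Prod>i<d. v i)" using that(1) by (simp add: prod.distrib)
    ultimately show ?thesis using that(2) by simp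
  qed
  have img: "proj_point d ` ?C = ?P"
  proof (intro equalityI subsetI)
    fix P assume "P \<in> proj_point d ` ?C"
    then obtain v where v: "v \<in> ?C" "P = proj_point d v" by blast
    have "P \<in> dwork d lam"
      unfolding dwork_def v(2) using v(1) unfolding mem by (intro imageI) (auto simp: PiE_iff)
    moreover have "\<exists>c. c \<noteq> 0 \<and> (\<forall>i<d. v i ^ q = c * (to_ac (\<xi> i) * v i))"
      using v(1) unfolding mem by (intro exI[of _ 1]) simp
    ultimately show "P \<in> ?P" using fixed_iff[OF \<xi>, of v] v(2) by simp
  next
    fix P assume P: "P \<in> ?P"
    then obtain v where v: "P = proj_point d v" "\<exists>i<d. v i \<noteq> 0"
      "(\<Sum>i<d. v i ^ d) = of_nat d * to_ac lam * (\<Prod>i<d. v i)"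
      unfolding dwork_def by blast
    obtain c where c: "c \<noteq> 0" "\<And>i. i < d \<Longrightarrow> v i ^ q = c * (to_ac (\<xi> i) * v i)"
      using P fixed_iff[OF \<xi>, of v] unfolding v(1) by auto
    have q1: "q - 1 > 0" using q_ge2 by simp
    obtain a where a: "a ^ (q - 1) = inverse c" using nth_root_exists[OF q1] by blast
    have a0: "a \<noteq> 0" using a c(1) q1 by (auto simp: zero_power)
    define u where "u = (\<lambda>i\<in>{..<d}. a * v i)"
    have ui: "u i = a * v i" if "i < d" for i using that by (simp add: u_def)
    have aq: "a ^ q = inverse c * a" unfolding pow_q a ..
    have uq: "u i ^ q = to_ac (\<xi> i) * u i" if "i < d" for i
      unfolding ui[OF that] power_mult_distrib aq c(2)[OF that] using c(1) by simp
    have "\<exists>i<d. u i \<noteq> 0" using v(2) ui a0 by auto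
    moreover have "u \<in> extensional {..<d}" by (simp add: u_def)
    ultimately have "u \<in> ?C" unfolding mem using uq scale_eq[OF ui v(3)] by blast
    moreover have "P = proj_point d u"
      unfolding v(1) using proj_point_eq_iff[of d u v] ui a0 by blast
    ultimately show "P \<in> proj_point d ` ?C" by blast
  qed
  have fibre: "card {u \<in> ?C. proj_point d u = P} = q - 1" if "P \<in> proj_point d ` ?C" for P
  proof -
    obtain v where v: "v \<in> ?C" "P = proj_point d v" using \<open>P \<in> _\<close> by blast
    obtain j where j: "j < d" "v j \<noteq> 0" using v(1) unfolding mem by blast
    have "{u \<in> ?C. proj_point d u = P} = (\<lambda>c. \<lambda>i\<in>{..<d}. c * v i) ` U"
    proof (intro equalityI subsetI)
      fix u assume u: "u \<in> {u \<in> ?C. proj_point d u = P}"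
      then obtain c where c: "c \<noteq> 0" "\<And>i. i < d \<Longrightarrow> u i = c * v i"
        using proj_point_eq_iff[of d u v] v(2) by auto
      have "u j ^ q = to_ac (\<xi> j) * u j" "v j ^ q = to_ac (\<xi> j) * v j"
        using u v(1) j(1) unfolding mem_Collect_eq mem by blast+
      then have "c ^ q * (to_ac (\<xi> j) * v j) = c * (to_ac (\<xi> j) * v j)"
        unfolding c(2)[OF j(1)] power_mult_distrib by (simp add: mult_ac)
      moreover have "to_ac (\<xi> j) * v j \<noteq> 0" using j mu_nonzero[OF Gt_mu[OF \<xi> j(1)]] by simp
      ultimately have "c ^ q = c" by (simp only: mult_cancel_right) simp
      then have "c \<in> U" using c(1) by (simp add: in_k_iff)
      moreover have "u = (\<lambda>i\<in>{..<d}. c * v i)"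
      proof (rule extensionalityI)
        show "u \<in> extensional {..<d}" using u unfolding mem_Collect_eq mem by blast
      qed (simp_all add: c(2))
      ultimately show "u \<in> (\<lambda>c. \<lambda>i\<in>{..<d}. c * v i) ` U" by blast
    next
      fix u assume "u \<in> (\<lambda>c. \<lambda>i\<in>{..<d}. c * v i) ` U"
      then obtain c where c: "c \<in> U" "u = (\<lambda>i\<in>{..<d}. c * v i)" by blast
      have ui: "u i = c * v i" if "i < d" for i using that by (simp add: c(2))
      have cq: "c ^ q = c" "c \<noteq> 0" using c(1) by (auto simp: in_k_iff)
      have vq: "v i ^ q = to_ac (\<xi> i) * v i" if "i < d" for i using v(1) that unfolding mem by blast
      have veq: "(\<Sum>i<d. v i ^ d) = of_nat d * to_ac lam * (\<Prod>i<d. v i)" using v(1) unfolding mem by blast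
      have 1: "\<forall>i<d. u i ^ q = to_ac (\<xi> i) * u i"
        by (intro allI impI) (simp add: ui vq power_mult_distrib cq(1))
      have 2: "\<exists>i<d. u i \<noteq> 0" using j cq(2) ui by (intro exI[of _ j]) simp
      have 3: "u \<in> extensional {..<d}" by (simp add: c(2))
      have 4: "(\<Sum>i<d. u i ^ d) = of_nat d * to_ac lam * (\<Prod>i<d. u i)" by (rule scale_eq[OF ui veq])
      have "u \<in> ?C" unfolding mem by (intro conjI 1 2 3 4)
      moreover have "proj_point d u = P"
        unfolding v(2) by (rule iffD2[OF proj_point_eq_iff]) (intro exI[of _ c] conjI allI impI cq(2) ui)
      ultimately show "u \<in> {u \<in> ?C. proj_point d u = P}" by blast
    qed
    moreover have "inj_on (\<lambda>c. \<lambda>i\<in>{..<d}. c * v i) U"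
    proof (rule inj_onI)
      fix a b assume "(\<lambda>i\<in>{..<d}. a * v i) = (\<lambda>i\<in>{..<d}. b * v i)"
      from fun_cong[OF this, of j] have "a * v j = b * v j" using j(1) by simp
      then show "a = b" using j(2) by simp
    qed
    ultimately have "card {u \<in> ?C. proj_point d u = P} = card U" by (simp only: card_image)
    then show ?thesis unfolding card_U card_k .
  qed
  have "card ?C = (\<Sum>P\<in>proj_point d ` ?C. \<Sum>u | u \<in> ?C \<and> proj_point d u = P. 1)"
    using sum.image_gen[OF fin, of "\<lambda>_. 1 :: nat" "proj_point d"] by simp
  also have "\<dots> = (\<Sum>P\<in>proj_point d ` ?C. q - 1)"
    using fibre by (intro sum.cong refl) simp
  finally show ?thesis unfolding img by simp
qed

lemma phi_powi: "x \<noteq> 0 \<Longrightarrow> \<phi> (x powi n) = \<phi> x powi n"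
  using F.char_power[OF phi_in, of x] F.char_inverse[OF phi_in, of x] F.char_power[OF phi_in, of "inverse x"]
  by (simp add: power_int_def)

lemma Gchar_gcoset:
  assumes w_sum: "int d dvd (\<Sum>i<d. w i)" and \<xi>: "\<xi> \<in> Gt"
  shows "Gchar \<phi> d w (gcoset \<xi>) = (\<Prod>i<d. \<phi> (\<xi> i) powi w i)"
proof -
  have val: "\<phi> (\<Prod>i<d. \<zeta> i powi w i) = (\<Prod>i<d. \<phi> (\<zeta> i) powi w i)" if "\<zeta> \<in> Gt" for \<zeta>
  proof -
    have "\<zeta> i \<noteq> 0" if "i < d" for i using mu_nonzero[OF Gt_mu[OF \<open>\<zeta> \<in> Gt\<close> that]] .
    then show ?thesis
      using F.char_prod[OF phi_in, of "{..<d}" "\<lambda>i. \<zeta> i powi w i"] by (simp add: phi_powi power_int_eq_0_iff)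
  qed
  have const: "\<phi> (\<Prod>i<d. \<zeta> i powi w i) = (\<Prod>i<d. \<phi> (\<xi> i) powi w i)" if \<zeta>: "\<zeta> \<in> gcoset \<xi>" for \<zeta>
  proof -
    obtain c where c: "c \<in> \<mu>" "\<zeta> = (\<lambda>i\<in>{..<d}. c * \<xi> i)" using \<zeta> unfolding gcoset_def by blast
    obtain e where e: "(\<Sum>i<d. w i) = int d * e" using w_sum by (auto simp: dvd_def)
    have "(\<Prod>i<d. c powi w i) = c powi (int d * e)"
      unfolding e[symmetric] by (rule prod_power_int[OF mu_nonzero[OF c(1)]])
    also have "\<dots> = 1" using c(1) by (simp add: power_int_mult \<mu>_def)
    finally have "(\<Prod>i<d. \<zeta> i powi w i) = (\<Prod>i<d. \<xi> i powi w i)"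
      by (simp add: c(2) power_int_mult_distrib prod.distrib)
    then show ?thesis using val[OF \<xi>] by simp
  qed
  have "(\<lambda>\<zeta>. \<phi> (\<Prod>i<d. \<zeta> i powi w i)) ` gcoset \<xi> = {\<Prod>i<d. \<phi> (\<xi> i) powi w i}"
  proof (intro equalityI subsetI)
    fix x assume "x \<in> {\<Prod>i<d. \<phi> (\<xi> i) powi w i}"
    then have "x = \<phi> (\<Prod>i<d. \<xi> i powi w i)" using const[OF gcoset_self[OF \<xi>]] by simp
    then show "x \<in> (\<lambda>\<zeta>. \<phi> (\<Prod>i<d. \<zeta> i powi w i)) ` gcoset \<xi>" using gcoset_self[OF \<xi>] by (rule image_eqI)
  qed (use const in auto)
  moreover have "gcoset \<xi> \<in> carrier (dwork_group d)" unfolding carrier_dwork_group using \<xi> by blast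
  ultimately show ?thesis by (simp add: Gchar_def)
qed

text \<open>
  By Fourier inversion on \<open>Gt\<close>, the left-hand side is the mean value of the character, and
  this is \<open>1\<close> if the character is trivial. Conversely, if all \<open>w i\<close> are congruent to \<open>- m\<close>,
  the character is the power \<open>- m\<close> of the product of the \<open>\<phi> (\<xi> i)\<close>, which is \<open>1\<close>.
\<close>

lemma Gchar_eq_triv_count:
  assumes w_sum: "int d dvd (\<Sum>i<d. w i)"
  shows "(\<Sum>m<d. of_bool (\<forall>i<d. int d dvd w i + int m)) =
    (of_bool (Gchar \<phi> d w = Gchar_triv d) :: complex)"
proof (cases "Gchar \<phi> d w = Gchar_triv d")
  case True
  have "(\<Prod>i<d. \<phi> (\<xi> i) powi w i) = 1" if "\<xi> \<in> Gt" for \<xi>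
    using Gchar_gcoset[OF w_sum that] that unfolding True by (simp add: Gchar_triv_def carrier_dwork_group)
  then have "of_nat (card Gt) = of_nat (card Gt) * (\<Sum>m<d. of_bool (\<forall>i<d. int d dvd w i + int m) :: complex)"
    using Gt_char_sum[of w] by simp
  moreover have "of_nat (card Gt) \<noteq> (0 :: complex)" unfolding card_Gt using d_pos by simp
  ultimately show ?thesis using True by simp
next
  case False
  have "\<not> (\<forall>i<d. int d dvd w i + int m)" for m
  proof
    assume all: "\<forall>i<d. int d dvd w i + int m"
    have one: "(\<Prod>i<d. \<phi> (\<xi> i) powi w i) = 1" if \<xi>: "\<xi> \<in> Gt" for \<xi>
    proof -
      have "\<phi> (\<xi> i) powi w i = inverse (\<phi> (\<xi> i)) ^ m" if i: "i < d" for i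
      proof -
        have x0: "\<phi> (\<xi> i) \<noteq> 0" using phi_nonzero mu_nonzero[OF Gt_mu[OF \<xi> i]] by blast
        obtain e where e: "w i = int d * e - int m"
          using all i by (metis add_diff_cancel_right' dvd_def)
        have "\<phi> (\<xi> i) ^ d = 1"
          using phi_power[OF mu_nonzero[OF Gt_mu[OF \<xi> i]], of d] Gt_mu[OF \<xi> i] F.char_one[OF phi_in]
          by (simp add: \<mu>_def)
        then show ?thesis
          unfolding e using x0 by (simp add: power_int_diff power_int_mult power_inverse divide_inverse)
      qed
      then have "(\<Prod>i<d. \<phi> (\<xi> i) powi w i) = inverse (\<Prod>i<d. \<phi> (\<xi> i)) ^ m"
        by (simp add: prod_power_distrib prod_inversef[unfolded comp_def, symmetric])
      also have "(\<Prod>i<d. \<phi> (\<xi> i)) = \<phi> (\<Prod>i<d. \<xi> i)"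
        using mu_nonzero Gt_mu[OF \<xi>] by (intro F.char_prod[OF phi_in, symmetric]) auto
      also have "\<dots> = 1" using \<xi> F.char_one[OF phi_in] by (simp add: Gt_def)
      finally show ?thesis by simp
    qed
    have "Gchar \<phi> d w g = Gchar_triv d g" for g
    proof (cases "g \<in> carrier (dwork_group d)")
      case True
      then obtain \<xi> where "\<xi> \<in> Gt" "g = gcoset \<xi>" unfolding carrier_dwork_group by blast
      then show ?thesis using Gchar_gcoset[OF w_sum] one True by (simp add: Gchar_triv_def)
    next
      case False
      then show ?thesis by (simp add: Gchar_def Gchar_triv_def)
    qed
    then show False using False by blast
  qed
  then have "of_bool (\<forall>i<d. int d dvd w i + int m) = (0 :: complex)" for m
    unfolding of_bool_def by (simp only: if_False)
  then show ?thesis using False by (simp only: sum.neutral_const of_bool_eq)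
qed

text \<open>
  The point count is the mean over \<open>Gt\<close> of the counts on the Dwork cone, divided by \<open>q - 1\<close>.
  The terms with \<open>\<Gamma>\<close>, that is, the products of the Gauss sums of \<open>\<theta>p (w i + m)\<close> for those
  \<open>\<theta> ^ m\<close> that are inverse to an upper parameter, come with opposite signs from the vectors
  with a zero coordinate and from the reduction of the hypergeometric function. Only the
  terms with \<open>L\<close>, which is \<open>1\<close> for the trivial character of the group and \<open>0\<close> otherwise, are
  left over.
\<close>

theorem dwork_count_eq:
  fixes w :: "nat \<Rightarrow> int"
  assumes w: "\<And>i. i < d \<Longrightarrow> \<not> int d dvd w i" and w_sum: "int d dvd (\<Sum>i<d. w i)"
    and lam: "lam \<noteq> 0"
    and A: "A = {#\<theta>p (w i). i \<in># mset_set {..<d}#}"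
    and B: "B = {#\<theta>p (int j). j \<in># mset_set {..<d}#}"
  shows "dwork_count r d lam (Gchar \<phi> d w) =
    (-1) ^ d * jacobi d (\<lambda>i. char_pow \<phi>\<^sub>d (w i)) ^ r * hyp_F_red (ext_field r) \<psi> A B (to_ac (lam ^ d)) +
    of_bool (Gchar \<phi> d w = Gchar_triv d) * ((1 - Q ^ (d - 1)) / (1 - Q))"
proof -
  define chi where "chi \<xi> = (\<Prod>i<d. \<phi> (\<xi> i) powi w i)" for \<xi> :: "nat \<Rightarrow> 'a"
  define gG where "gG = (of_nat (card Gt) :: complex)"
  define fx where "fx g = card {P \<in> dwork d lam. Gact d (inv\<^bsub>dwork_group d\<^esub> g) ((frob d ^^ r) P) = P}" for g
  define L where "L = (\<Sum>m<d. of_bool (\<forall>i<d. int d dvd w i + int m) :: complex)"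
  define \<Gamma> where "\<Gamma> = (\<Sum>m<d. of_bool (\<exists>i<d. int d dvd w i + int m) * (\<Prod>i<d. gsum (\<theta>p (w i + int m))))"
  define N where "N = (\<Sum>t | t \<in> {..<d} \<rightarrow>\<^sub>E U \<and> (\<Sum>i<d. t i) = of_nat d * to_ac lam \<and> (\<Prod>i<d. t i) = 1.
    \<Prod>i<d. \<theta>p (w i) (t i))"
  define H where "H = (-1) ^ d * jacobi d (\<lambda>i. char_pow \<phi>\<^sub>d (w i)) ^ r * hyp_F_red (ext_field r) \<psi> A B (to_ac (lam ^ d))"
  define D where "D = dwork_count r d lam (Gchar \<phi> d w)"
  have gG0: "gG \<noteq> 0" unfolding gG_def card_Gt using d_pos by simp
  have Q1: "Q - 1 \<noteq> 0" using Q_neq_1 by simp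
  have Qq: "of_nat (q - 1) = Q - 1" using of_nat_card_U unfolding card_U card_k .
  have D1: "gG * (Q - 1) * D = (\<Sum>\<xi>\<in>Gt. chi \<xi> * of_nat (card (dwork_cone lam \<xi>)))"
  proof -
    let ?h = "\<lambda>g. Gchar \<phi> d w g * (of_nat (fx g) * (Q - 1))"
    have "(\<Sum>\<xi>\<in>Gt. chi \<xi> * of_nat (card (dwork_cone lam \<xi>))) =
        of_nat (card \<mu>) * (\<Sum>g\<in>carrier (dwork_group d). ?h g)"
    proof (rule sum_over_cosets)
      fix \<xi> assume \<xi>: "\<xi> \<in> Gt"
      show "chi \<xi> * of_nat (card (dwork_cone lam \<xi>)) = ?h (gcoset \<xi>)"
        unfolding card_fixed_points[OF \<xi>] Gchar_gcoset[OF w_sum \<xi>] chi_def fx_def by (simp only: of_nat_mult Qq)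
    qed
    also have "(\<Sum>g\<in>carrier (dwork_group d). ?h g) =
        (Q - 1) * (\<Sum>g\<in>carrier (dwork_group d). Gchar \<phi> d w g * of_nat (fx g))"
      unfolding sum_distrib_left by (intro sum.cong refl) (simp only: mult_ac)
    also have "(\<Sum>g\<in>carrier (dwork_group d). Gchar \<phi> d w g * of_nat (fx g)) =
        of_nat (card (carrier (dwork_group d :: (nat \<Rightarrow> 'a) set monoid))) * D"
    proof -
      have "of_nat (card (carrier (dwork_group d :: (nat \<Rightarrow> 'a) set monoid))) \<noteq> (0 :: complex)"
        using gG0 unfolding gG_def card_dwork_group[symmetric] by auto
      then show ?thesis unfolding D_def dwork_count_def fx_def by simp
    qed
    also have "of_nat (card \<mu>) * ((Q - 1) * (of_nat (card (carrier (dwork_group d :: (nat \<Rightarrow> 'a) set monoid))) * D)) =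
        gG * (Q - 1) * D"
      unfolding gG_def card_dwork_group[symmetric] of_nat_mult by (simp only: mult_ac)
    finally show ?thesis by (rule sym)
  qed
  have cone: "of_nat (card (dwork_cone lam \<xi>)) =
      (of_nat (card (fermat \<xi>)) - of_nat (card (fermat_torus \<xi>))) + of_nat (card (dwork_torus lam \<xi>)) - (1 :: complex)"
    if "\<xi> \<in> Gt" for \<xi>
  proof -
    have "of_nat (card (dwork_cone lam \<xi>) + 1 + card (fermat_torus \<xi>)) =
        (of_nat (card (fermat \<xi>) + card (dwork_torus lam \<xi>)) :: complex)"
      by (simp only: card_dwork_cone[OF that])
    then show ?thesis by (simp add: algebra_simps)
  qed
  have "(\<Sum>\<xi>\<in>Gt. chi \<xi> * of_nat (card (dwork_cone lam \<xi>))) =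
      (\<Sum>\<xi>\<in>Gt. chi \<xi> * (of_nat (card (fermat \<xi>)) - of_nat (card (fermat_torus \<xi>)))) +
      (\<Sum>\<xi>\<in>Gt. chi \<xi> * of_nat (card (dwork_torus lam \<xi>))) - (\<Sum>\<xi>\<in>Gt. chi \<xi>)"
    unfolding sum.distrib[symmetric] sum_subtractf[symmetric]
    by (intro sum.cong refl) (simp add: cone algebra_simps)
  also have "(\<Sum>\<xi>\<in>Gt. chi \<xi> * (of_nat (card (fermat \<xi>)) - of_nat (card (fermat_torus \<xi>)))) =
      gG / Q * (L * (Q ^ d - (Q - 1) ^ d) - (Q - 1) * \<Gamma>)"
    unfolding chi_def fermat_minus_torus[OF w_sum] gG_def L_def \<Gamma>_def sum_subtractf
      sum_distrib_left sum_distrib_right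
    by (simp only: mult_ac)
  also have "(\<Sum>\<xi>\<in>Gt. chi \<xi> * of_nat (card (dwork_torus lam \<xi>))) = gG * (Q - 1) * N"
    unfolding chi_def dwork_torus_sum[OF w_sum] gG_def N_def ..
  also have "(\<Sum>\<xi>\<in>Gt. chi \<xi>) = gG * L" unfolding chi_def Gt_char_sum gG_def L_def ..
  finally have "gG * (Q - 1) * D = gG / Q * (L * (Q ^ d - (Q - 1) ^ d) - (Q - 1) * \<Gamma>) + gG * (Q - 1) * N - gG * L"
    unfolding D1 .
  also have "\<dots> = gG * ((L * (Q ^ d - (Q - 1) ^ d) - (Q - 1) * \<Gamma>) / Q + (Q - 1) * N - L)"
  proof -
    have "gG / Q * a + gG * (Q - 1) * N - gG * L = gG * (a / Q + (Q - 1) * N - L)" for a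
      by (simp add: algebra_simps)
    then show ?thesis .
  qed
  finally have D2: "(Q - 1) * D = (L * (Q ^ d - (Q - 1) ^ d) - (Q - 1) * \<Gamma>) / Q + (Q - 1) * N - L"
    using gG0 unfolding mult.assoc by (simp only: mult_cancel_left) simp
  have lU: "to_ac lam \<in> U" using to_ac_in_ext_field[OF r_ge1] lam by simp
  have N1: "N = H + L * (Q - 1) ^ (d - 1) / Q + \<Gamma> / Q"
  proof -
    have lift: "char_lift r (char_pow \<phi>\<^sub>d n) = \<theta>p n" for n by (rule char_lift_pow[OF r_ge1 phi_d_in, symmetric])
    have pdin: "char_pow \<phi>\<^sub>d n \<in> mult_chars UNIV" for n by (rule F.char_pow_in[OF phi_d_in])
    have phi_d_d: "\<phi>\<^sub>d x ^ d = 1" if "x \<noteq> 0" for x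
    proof -
      have "\<phi>\<^sub>d x ^ d = \<phi> x ^ (CARD('a) - 1)"
        using F.char_pow_apply[OF phi_in, of x] that d_dvd_q by (simp add: \<phi>\<^sub>d_def flip: power_mult)
      then show ?thesis using F.char_root_of_unity[OF phi_in, of x] that by simp
    qed
    have triv: "(\<Prod>i<d. char_pow \<phi>\<^sub>d (w i) x) = 1" if x: "x \<noteq> 0" for x
    proof -
      have x0: "\<phi>\<^sub>d x \<noteq> 0" using F.char_nonzero[OF phi_d_in, of x] x by simp
      obtain e where e: "(\<Sum>i<d. w i) = int d * e" using w_sum by (auto simp: dvd_def)
      have "(\<Prod>i<d. \<phi>\<^sub>d x powi w i) = \<phi>\<^sub>d x powi (int d * e)"
        unfolding e[symmetric] by (rule prod_power_int[OF x0])
      then show ?thesis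
        using F.char_pow_apply[OF phi_d_in, of x] x phi_d_d[OF x] by (simp add: power_int_mult)
    qed
    have g: "(\<Prod>i<d. gauss (ext_field r) \<psi> (\<theta>p (w i))) = Q * jacobi d (\<lambda>i. char_pow \<phi>\<^sub>d (w i)) ^ r"
      using prod_gauss_lift_eq_jacobi[OF r_ge1 _ psi pdin triv, of 0] d_pos w[of 0] theta_p_triv_iff
      unfolding lift card_k q_eq by simp
    have l: "to_ac lam ^ d = to_ac (lam ^ d)" by simp
    have "N = (-1) ^ d / Q * (Q * jacobi d (\<lambda>i. char_pow \<phi>\<^sub>d (w i)) ^ r * hyp_F_red (ext_field r) \<psi> A B (to_ac (lam ^ d)))
      + (\<Sum>m<d. of_bool (\<forall>i<d. int d dvd w i + int m) * (Q - 1) ^ (d - 1) / Q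
        + of_bool (\<exists>i<d. int d dvd w i + int m) * (\<Prod>i<d. gsum (\<theta>p (w i + int m))) / Q)"
      using torus_sum_eq_hyp_F_red[OF w w_sum lU A B] unfolding g l N_def .
    also have "(-1) ^ d / Q * (Q * jacobi d (\<lambda>i. char_pow \<phi>\<^sub>d (w i)) ^ r * hyp_F_red (ext_field r) \<psi> A B (to_ac (lam ^ d))) = H"
      unfolding H_def by simp
    finally show ?thesis
      unfolding L_def \<Gamma>_def by (simp only: sum.distrib sum_divide_distrib sum_distrib_right add.assoc)
  qed
  obtain e where e: "d = Suc e" using d_pos gr0_implies_Suc by blast
  have "(Q - 1) * D = (Q - 1) * H + L * (Q ^ (d - 1) - 1)"
  proof -
    have "(L * (Q * a - (Q - 1) * b) - (Q - 1) * \<Gamma>) / Q + (Q - 1) * (H + L * b / Q + \<Gamma> / Q) - L =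
        (Q - 1) * H + L * (a - 1)" for a b :: complex
    proof -
      have "(L * (Q * a - (Q - 1) * b) - (Q - 1) * \<Gamma>) / Q = L * a - L * ((Q - 1) * b) / Q - (Q - 1) * \<Gamma> / Q"
        using Q_nonzero by (simp add: diff_divide_distrib right_diff_distrib)
      then show ?thesis by (simp add: distrib_left right_diff_distrib left_diff_distrib add_divide_distrib diff_divide_distrib)
    qed
    then show ?thesis unfolding D2 N1 e by simp
  qed
  also have "\<dots> = (Q - 1) * (H + L * ((1 - Q ^ (d - 1)) / (1 - Q)))"
  proof -
    have "(1 - a) / (1 - Q) = (a - 1) / (Q - 1)" for a :: complex
      by (metis minus_diff_eq minus_divide_divide)
    then show ?thesis using Q1 by (simp add: distrib_left)
  qed
  finally have "D = H + L * ((1 - Q ^ (d - 1)) / (1 - Q))" using Q1 by (simp only: mult_cancel_left) simp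
  then show ?thesis unfolding D_def H_def L_def Gchar_eq_triv_count[OF w_sum] .
qed

end

section \<open>The number of points\<close>

theorem theorem1p1:
  fixes d q r :: nat
    and lam :: "'a::{field,finite}"
    and \<phi> \<phi>\<^sub>d :: "'a \<Rightarrow> complex"
    and w :: "nat \<Rightarrow> int"
    and \<chi> :: "(nat \<Rightarrow> 'a) set \<Rightarrow> complex"
    and \<psi> :: "'a alg_closure \<Rightarrow> complex"
    and A B :: "('a alg_closure \<Rightarrow> complex) multiset"
  assumes "d \<ge> 2"
    and "q = CARD('a)"
    and "d dvd q - 1"
    and "lam \<noteq> 0"
    and "generates_mult_chars UNIV \<phi>"
    and "\<phi>\<^sub>d = char_pow \<phi> (int ((q - 1) div d))"
    and "int d dvd (\<Sum>i<d. w i)"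
    and "\<And>i. i < d \<Longrightarrow> \<not> int d dvd w i"
    and "\<chi> = Gchar \<phi> d w"
    and "r \<ge> 1"
    and "nontrivial_add_char (ext_field r) \<psi>"
    and "A = {#char_pow (char_lift r \<phi>\<^sub>d) (w i). i \<in># mset_set {..<d}#}"
    and "B = {#char_lift r (triv_char UNIV)#} +
             {#char_pow (char_lift r \<phi>\<^sub>d) (int i). i \<in># mset_set {1..<d}#}"
  shows "(\<chi> \<noteq> Gchar_triv d \<longrightarrow>
            dwork_count r d lam \<chi> =
              (-1) ^ d * jacobi d (\<lambda>i. char_pow \<phi>\<^sub>d (w i)) ^ r *
              hyp_F_red (ext_field r) \<psi> A B (to_ac (lam ^ d))) \<and>
         (\<chi> = Gchar_triv d \<longrightarrow>
            dwork_count r d lam \<chi> =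
              (-1) ^ d * jacobi d (\<lambda>i. char_pow \<phi>\<^sub>d (w i)) ^ r *
              hyp_F_red (ext_field r) \<psi> A B (to_ac (lam ^ d)) +
              (1 - of_nat q ^ (r * (d - 1))) / (1 - of_nat q ^ r))"
proof -
  interpret D: dwork_setting d r "CARD('a) ^ r" \<phi> \<psi>
    using assms by unfold_locales simp_all
  have pd: "\<phi>\<^sub>d = D.\<phi>\<^sub>d" using assms(2,6) by (simp add: D.\<phi>\<^sub>d_def)
  have Q: "D.Q = of_nat q ^ r" using D.card_k assms(2) by simp
  have B: "B = {#char_pow (char_lift r D.\<phi>\<^sub>d) (int j). j \<in># mset_set {..<d}#}"
  proof -
    have "{..<d} = insert 0 {1..<d}" using assms(1) by auto
    then have "mset_set {..<d} = {#0#} + mset_set {1..<d}" by simp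
    then show ?thesis
      using D.theta_p_0 char_lift_triv[OF assms(10)] unfolding assms(13) pd by simp
  qed
  have main: "dwork_count r d lam \<chi> =
      (-1) ^ d * jacobi d (\<lambda>i. char_pow \<phi>\<^sub>d (w i)) ^ r * hyp_F_red (ext_field r) \<psi> A B (to_ac (lam ^ d)) +
      of_bool (\<chi> = Gchar_triv d) * ((1 - D.Q ^ (d - 1)) / (1 - D.Q))"
    unfolding assms(9) pd by (rule D.dwork_count_eq[OF assms(8,7,4) assms(12)[unfolded pd] B])
  show ?thesis
  proof (intro conjI impI)
    assume "\<chi> \<noteq> Gchar_triv d"
    then show "dwork_count r d lam \<chi> =
        (-1) ^ d * jacobi d (\<lambda>i. char_pow \<phi>\<^sub>d (w i)) ^ r * hyp_F_red (ext_field r) \<psi> A B (to_ac (lam ^ d))"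
      using main by simp
  next
    assume "\<chi> = Gchar_triv d"
    then show "dwork_count r d lam \<chi> =
        (-1) ^ d * jacobi d (\<lambda>i. char_pow \<phi>\<^sub>d (w i)) ^ r * hyp_F_red (ext_field r) \<psi> A B (to_ac (lam ^ d)) +
        (1 - of_nat q ^ (r * (d - 1))) / (1 - of_nat q ^ r)"
      using main unfolding Q by (simp add: power_mult)
  qed
qed

end
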